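(* Let $p\in(0,1)$ and $\alpha\in(0,1)$ be fixed and let $X\sim\mathrm{Bin}(n,p)$. Let $L_{U,CP}=p_U-p$, where $p_U$ is the one-sided $1-\alpha$ Clopper--Pearson upper bound based on $X$, and let $L_{U,A}=p_{U,A}-p$, where $p_{U,A}$ is the one-sided $1-\alpha$ Jeffreys upper bound, second-order correct upper bound, or modified loglikelihood root upper bound based on $X$. Then, in each of the three cases, as $n\to\infty$, $$E(L_{U,CP})=E(L_{U,A})+(2n)^{-1}+O(n^{-3/2}).$$
   Context: Notation: $\hat p=X/n$, $\hat q=1-\hat p$, $z=z_\alpha$ is the upper $\alpha$ quantile of the standard normal distribution, and $B(\gamma,a,b)$ is the $\gamma$-quantile of the $Beta(a,b)$ distribution. Clopper--Pearson upper bound: for $X\in\{0,\dots,n-1\}$, $p_U$ is the solution of $\sum_{k=0}^{X}\binom{n}{k}p_U^k(1-p_U)^{n-k}=\alpha$, equivalently $p_U=B(1-\alpha,X+1,n-X)$; for $X=n$, $p_U=1$. Jeffreys upper bound: $B(1-\alpha,X+1/2,n-X+1/2)$. Second-order correct upper bound (Cai's coverage-corrected one-sided Wald bound): with $\eta=\frac{z^2}{3}+\frac16$, $\gamma_1=-\big(\frac{13}{18}z^2+\frac{17}{18}\big)$ and $\gamma_2=\frac{z^2}{18}+\frac{7}{36}$, $$\frac{X+\eta}{n+2\eta}+z\,n^{-1/2}\Big(\hat p\hat q+\frac{\gamma_1\hat p\hat q+\gamma_2}{n}\Big)^{1/2}$$ (considered for $n$ large enough that the quantity under the root is nonnegative for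 every $X$). Modified loglikelihood root upper bound: for $X\in\{1,\dots,n-1\}$ and $\theta\in(0,1)$ let $\ell(\theta)=X\log\theta+(n-X)\log(1-\theta)$, $r(\theta)=\mathrm{sign}(\hat p-\theta)\{2(\ell(\hat p)-\ell(\theta))\}^{1/2}$, $Q(\theta)=\Big(\log\frac{\hat p}{1-\hat p}-\log\frac{\theta}{1-\theta}\Big)(n\hat p\hat q)^{1/2}$ and $r^*(\theta)=r(\theta)+r(\theta)^{-1}\log\{Q(\theta)/r(\theta)\}$ (extended by continuity at $\theta=\hat p$). The bound is the solution $\theta$ of $r^*(\theta)=-z$. For $X\in\{0,n\}$ the bound is assigned an arbitrary value in $[0,1]$. *)

theory Defs
  imports "HOL-Probability.Probability"
begin

definition quantile :: "real measure \<Rightarrow> real \<Rightarrow> real" where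
  "quantile M \<gamma> = Inf {x. \<gamma> \<le> cdf M x}"

definition upper_normal_quantile :: "real \<Rightarrow> real" where
  "upper_normal_quantile \<alpha> = quantile std_normal_distribution (1 - \<alpha>)"

definition beta_density :: "real \<Rightarrow> real \<Rightarrow> real \<Rightarrow> real" where
  "beta_density a b x =
     (if 0 < x \<and> x < 1 then x powr (a - 1) * (1 - x) powr (b - 1) / Beta a b else 0)"

definition beta_distribution :: "real \<Rightarrow> real \<Rightarrow> real measure" where
  "beta_distribution a b = density lborel (\<lambda>x. ennreal (beta_density a b x))"

text \<open>An upper bound is a function of the sample size \<open>n\<close> and the observed count \<open>X\<close>.\<close>

text \<open>For \<open>X < n\<close> the binomial tail below decreases strictly from \<open>1\<close> to \<open>0\<close> on the unit interval,
  so the description is proper for every \<open>\<alpha>\<close> in \<open>(0,1)\<close>.\<close>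

definition clopper_pearson_bound :: "real \<Rightarrow> nat \<Rightarrow> nat \<Rightarrow> real" where
  "clopper_pearson_bound \<alpha> n X =
     (if X < n
      then (THE \<theta>. \<theta> \<in> {0..1} \<and>
              (\<Sum>k\<le>X. real (n choose k) * \<theta> ^ k * (1 - \<theta>) ^ (n - k)) = \<alpha>)
      else 1)"

definition jeffreys_bound :: "real \<Rightarrow> nat \<Rightarrow> nat \<Rightarrow> real" where
  "jeffreys_bound \<alpha> n X =
     quantile (beta_distribution (real X + 1/2) (real n - real X + 1/2)) (1 - \<alpha>)"

text \<open>The radicand is nonnegative for every \<open>X\<close> once \<open>n\<close> is large; for the remaining small \<open>n\<close>
  the value is that of \<^const>\<open>sqrt\<close> on negative reals and carries no meaning.\<close>

definition second_order_bound :: "real \<Rightarrow> nat \<Rightarrow> nat \<Rightarrow> real" where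
  "second_order_bound \<alpha> n X =
     (let z = upper_normal_quantile \<alpha>;
          \<eta> = z\<^sup>2 / 3 + 1/6;
          \<gamma>1 = - (13/18 * z\<^sup>2 + 17/18);
          \<gamma>2 = z\<^sup>2 / 18 + 7/36;
          p = real X / real n;
          q = 1 - p
      in (real X + \<eta>) / (real n + 2 * \<eta>)
           + z * real n powr (- 1/2) * sqrt (p * q + (\<gamma>1 * (p * q) + \<gamma>2) / real n))"

definition loglik :: "nat \<Rightarrow> nat \<Rightarrow> real \<Rightarrow> real" where
  "loglik n X \<theta> = real X * ln \<theta> + (real n - real X) * ln (1 - \<theta>)"

definition loglik_root :: "nat \<Rightarrow> nat \<Rightarrow> real \<Rightarrow> real" where
  "loglik_root n X \<theta> =
     (let p = real X / real n
      in sgn (p - \<theta>) * sqrt (2 * (loglik n X p - loglik n X \<theta>)))"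

definition wald_logit :: "nat \<Rightarrow> nat \<Rightarrow> real \<Rightarrow> real" where
  "wald_logit n X \<theta> =
     (let p = real X / real n
      in (ln (p / (1 - p)) - ln (\<theta> / (1 - \<theta>))) * sqrt (real n * p * (1 - p)))"

text \<open>At \<open>\<theta> = X / n\<close> the root vanishes and the formula is extended by continuity.\<close>

definition modified_loglik_root :: "nat \<Rightarrow> nat \<Rightarrow> real \<Rightarrow> real" where
  "modified_loglik_root n X \<theta> =
     (let p = real X / real n;
          f = (\<lambda>t. loglik_root n X t
                     + ln (wald_logit n X t / loglik_root n X t) / loglik_root n X t)
      in if \<theta> = p then Lim (at p) f else f \<theta>)"

text \<open>A predicate rather than a function, because the values at \<open>X = 0\<close> and \<open>X = n\<close> are arbitrary
  in the unit interval.\<close>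

definition is_modified_loglik_root_bound :: "real \<Rightarrow> (nat \<Rightarrow> nat \<Rightarrow> real) \<Rightarrow> bool" where
  "is_modified_loglik_root_bound \<alpha> U \<longleftrightarrow>
     (\<forall>n X. 0 < X \<and> X < n \<longrightarrow>
        U n X \<in> {0<..<1} \<and> modified_loglik_root n X (U n X) = - upper_normal_quantile \<alpha>) \<and>
     (\<forall>n. \<forall>X\<in>{0, n}. U n X \<in> {0..1})"

definition expected_excess :: "nat \<Rightarrow> real \<Rightarrow> (nat \<Rightarrow> nat \<Rightarrow> real) \<Rightarrow> real" where
  "expected_excess n p U = measure_pmf.expectation (binomial_pmf n p) (\<lambda>X. U n X - p)"

end

theory Submission
  imports Defs "HOL-Real_Asymp.Real_Asymp"
begin

text \<open>Write \<open>x = X / n\<close>, \<open>\<sigma> = sqrt (x * (1 - x))\<close> and \<open>\<epsilon> = 1 / sqrt n\<close>. Uniformly for \<open>x\<close> in a compact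
  subinterval of the open unit interval, each of the four bounds equals
  \<open>x + z \<sigma> \<epsilon> + ((1 - 2 x) (z\<^sup>2 / 3 + 1 / 6) + \<tau>) \<epsilon>\<^sup>2 + O(\<epsilon>\<^sup>3)\<close>, with \<open>\<tau> = 1 / 2\<close> for Clopper--Pearson
  and \<open>\<tau> = 0\<close> for the other three; outside such an interval the bounds stay bounded and Hoeffding's
  inequality makes the probability exponentially small.

  Clopper--Pearson and Jeffreys bounds are quantiles of the densities proportional to
  \<open>\<theta> powr (n x + s - 1) * (1 - \<theta>) powr (n (1 - x) - s)\<close> with \<open>s = 1\<close> and \<open>s = 1 / 2\<close>. In the variable
  \<open>t = (\<theta> - x) / (\<sigma> \<epsilon>)\<close> such a density, scaled to be \<open>1\<close> at \<open>t = 0\<close>, differs from the derivative of an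
  explicit one-term Edgeworth expansion by at most a multiple of \<open>\<epsilon>\<^sup>2 / (1 + t\<^sup>2)\<close>. Comparison with
  the arctangent then gives the distribution function up to \<open>O(\<epsilon>\<^sup>2)\<close>, without evaluating the
  normalising constant, and inverting it gives the quantile. For the loglikelihood root the equation
  reads \<open>\<rho> = \<epsilon> z - \<epsilon>\<^sup>2 \<kappa>\<close>, with \<open>\<rho>\<close> the signed root of twice the Kullback--Leibler divergence and \<open>\<kappa>\<close> bounded;
  Pinsker's inequality localises the solution and Taylor expansion of \<open>\<rho>\<close> and \<open>\<kappa>\<close> finishes.\<close>

section \<open>The standard normal distribution\<close>

text \<open>All terms of the expansion that depend on X are common to the four bounds, so they
  cancel for each X before the expectation is taken, and only (\<tau>1 - \<tau>2) / n remains. The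
  price is uniformity: x is random, so every constant must be chosen before x, and all estimates are
  stated for m \<le> x \<le> 1 - m with constants that depend on m and \<alpha> alone.

  The envelope 1 / (1 + t^2) is what makes the comparison of densities work: the range of t grows
  like 1 / \<epsilon>, and an error of size \<epsilon>^2 stays of that size after integration only
  if its profile is integrable over the whole line. The boundary values 0 and 1 of the distribution
  function then fix the normalising constant to the same accuracy.

  The value of \<tau> comes from the exponent shift s. The weight with exponents s - 1 and - s moves
  the quantile by (s - 1 + x) / n, whose part free of 1 - 2 x is (s - 1/2) / n; the half unit of s
  between Clopper--Pearson and Jeffreys is the 1 / (2 n) of the theorem.\<close>

lemma cdf_density_has_real_derivative:
  fixes f :: "real \<Rightarrow> real"
  defines "M \<equiv> density lborel (\<lambda>x. ennreal (f x))"
  assumes [measurable]: "f \<in> borel_measurable borel" and nonneg: "\<And>x. 0 \<le> f x"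
    and M: "prob_space M" and cont: "continuous_on {a<..<b} f" and x: "a < x" "x < b"
  shows "(cdf M has_real_derivative f x) (at x)"
proof -
  interpret prob_space M by fact
  interpret finite_borel_measure M
    by unfold_locales (simp add: M_def)
  define c d where "c = (a + x) / 2" and "d = (x + b) / 2"
  have cd: "a < c" "c < x" "x < d" "d < b" using x by (auto simp: c_def d_def)
  have cont': "continuous_on {c..d} f"
    by (rule continuous_on_subset[OF cont]) (use cd in auto)
  have eq: "cdf M y = cdf M c + integral {c..y} f" if y: "c < y" "y < d" for y
  proof -
    have "f integrable_on {c..y}"
      by (rule integrable_continuous_interval, rule continuous_on_subset[OF cont']) (use y in auto)
    then have int: "(f has_integral integral {c..y} f) {c..y}" by blast
    \<comment> \<open>\<open>cdf_diff_eq\<close> measures the half-open interval, so the left end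
      point, a null set, is removed from the integral.\<close>
    have "(f has_integral integral {c..y} f) {c<..y}"
      by (rule has_integral_spike_set_eq[THEN iffD1, OF _ _ int])
        (auto intro: negligible_subset[OF negligible_sing[of c]])
    then have "((\<lambda>t. if t \<in> {c<..y} then f t else 0) has_integral integral {c..y} f) UNIV"
      by (subst has_integral_restrict_UNIV)
    then have hi: "((\<lambda>t. indicator {c<..y} t * f t) has_integral integral {c..y} f) UNIV"
      by (rule has_integral_eq[rotated]) (simp add: indicator_def)
    have "emeasure M {c<..y} = (\<integral>\<^sup>+t. ennreal (f t) * indicator {c<..y} t \<partial>lborel)"
      unfolding M_def by (subst emeasure_density) auto
    also have "\<dots> = (\<integral>\<^sup>+t. ennreal (indicator {c<..y} t * f t) \<partial>lborel)"
      by (intro nn_integral_cong) (auto split: split_indicator)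
    also have "\<dots> = ennreal (integral {c..y} f)"
      by (rule nn_integral_has_integral_lborel[OF _ _ hi]) (use nonneg in \<open>auto\<close>)
    finally have "measure M {c<..y} = integral {c..y} f"
      using integral_nonneg[OF \<open>f integrable_on {c..y}\<close>] nonneg
      by (simp add: measure_def)
    then show ?thesis using cdf_diff_eq[OF y(1)] by simp
  qed
  have "((\<lambda>y. cdf M c + integral {c..y} f) has_real_derivative 0 + f x) (at x within {c..d})"
    by (intro DERIV_add DERIV_const integral_has_real_derivative cont') (use cd in auto)
  then have "((\<lambda>y. cdf M c + integral {c..y} f) has_real_derivative f x) (at x)"
    using at_within_interior[of x "{c..d}"] cd by simp
  then show ?thesis
    by (rule has_field_derivative_transform_within_open[of _ _ _ "{c<..<d}"])
      (use cd eq in auto)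
qed

abbreviation (input) \<Phi> :: "real \<Rightarrow> real" where "\<Phi> \<equiv> cdf std_normal_distribution"
abbreviation (input) \<phi> :: "real \<Rightarrow> real" where "\<phi> \<equiv> std_normal_density"

interpretation std_normal: real_distribution std_normal_distribution
  by (rule real_dist_normal_dist)

lemma has_real_derivative_Phi [derivative_intros]:
  assumes "(f has_real_derivative D) (at x)"
  shows "((\<lambda>x. \<Phi> (f x)) has_real_derivative \<phi> (f x) * D) (at x)"
proof -
  have "(\<Phi> has_real_derivative \<phi> y) (at y)" for y
    by (rule cdf_density_has_real_derivative[where a = "y - 1" and b = "y + 1"])
      (use std_normal.prob_space_axioms in \<open>auto simp: normal_density_def intro!: continuous_intros\<close>)
  from DERIV_chain2[OF this assms] show ?thesis .
qed

text \<open>The quantile is an infimum over a superlevel set. Continuity and the limits at both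
  infinities give a point at level 1 - \<alpha>, and strict monotonicity makes the superlevel set
  the closed half-line that starts there.\<close>

lemma Phi_upper_normal_quantile:
  assumes "0 < \<alpha>" "\<alpha> < 1"
  shows "\<Phi> (upper_normal_quantile \<alpha>) = 1 - \<alpha>"
proof -
  have cont: "isCont \<Phi> x" for x
    using DERIV_isCont[OF has_real_derivative_Phi[OF DERIV_ident]] .
  have "eventually (\<lambda>x. \<Phi> x > 1 - \<alpha>) at_top"
    using order_tendstoD(1)[OF std_normal.cdf_lim_at_top_prob, of "1 - \<alpha>"] assms by simp
  then obtain b where b: "\<And>x. x \<ge> b \<Longrightarrow> \<Phi> x > 1 - \<alpha>"
    by (auto simp: eventually_at_top_linorder)
  have "eventually (\<lambda>x. \<Phi> x < 1 - \<alpha>) at_bot"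
    using order_tendstoD(2)[OF std_normal.cdf_lim_at_bot, of "1 - \<alpha>"] assms by simp
  then obtain a where a: "\<And>x. x \<le> a \<Longrightarrow> \<Phi> x < 1 - \<alpha>"
    by (auto simp: eventually_at_bot_linorder)
  have "\<exists>x\<ge>min a b. x \<le> b \<and> \<Phi> x = 1 - \<alpha>"
    by (rule IVT) (use a[of "min a b"] b[of b] cont in \<open>auto intro: less_imp_le\<close>)
  then obtain x where x: "\<Phi> x = 1 - \<alpha>" by auto
  have sm: "\<Phi> y < \<Phi> x" if "y < x" for x y
    by (rule DERIV_pos_imp_increasing[OF that])
      (auto intro!: exI[of _ "\<phi> _"] has_real_derivative_Phi[OF DERIV_ident, simplified] normal_density_pos)
  have "{y. 1 - \<alpha> \<le> \<Phi> y} = {x..}"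
    using x sm by (auto simp flip: x) (metis leD linorder_le_less_linear, metis less_eq_real_def)
  then show ?thesis
    by (simp add: upper_normal_quantile_def quantile_def x)
qed

text \<open>The source of the constant \<open>20 ^ 5\<close> in all polynomial-times-Gaussian
  estimates below: 1 + t^2 \<le> 20 (1 + t^2 / 20), and the fifth power of exp (t^2 / 20) is exp
  (t^2 / 4). Stopping at t^2 / 4 leaves half of a Gaussian factor free for other use.\<close>

lemma one_plus_sq_power5_le: "(1 + t\<^sup>2) ^ 5 \<le> 20 ^ 5 * exp (t\<^sup>2 / 4)" for t :: real
proof -
  have "(1 + t\<^sup>2) ^ 5 \<le> (20 * (1 + t\<^sup>2 / 20)) ^ 5" by (intro power_mono) auto
  also have "\<dots> \<le> 20 ^ 5 * exp (t\<^sup>2 / 20) ^ 5"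
    unfolding power_mult_distrib by (intro mult_left_mono power_mono exp_ge_add_one_self) auto
  also have "exp (t\<^sup>2 / 20) ^ 5 = exp (t\<^sup>2 / 4)" by (simp flip: exp_of_nat_mult)
  finally show ?thesis .
qed

text \<open>At |t| of order 1 / \<epsilon> an inverse square is already O(\<epsilon>^2), which is
  all that is asked of the tail. The difference of the two sides vanishes at minus infinity and is
  nondecreasing on the negative axis, because \<phi> lies below the derivative of
  \<open>20 ^ 5 / s\<^sup>2\<close>.\<close>

lemma Phi_tail: "\<Phi> t \<le> 20 ^ 5 / t\<^sup>2" if "t < 0"
proof -
  have dom: "\<phi> s \<le> - (2 * 20 ^ 5) / s ^ 3" if "s < 0" for s
  proof -
    have "\<bar>s\<bar> ^ 3 \<le> (1 + s\<^sup>2) ^ 5"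
    proof (cases "\<bar>s\<bar> \<le> 1")
      case True
      then have "\<bar>s\<bar> ^ 3 \<le> 1" by (simp add: power_le_one)
      also have "\<dots> \<le> (1 + s\<^sup>2) ^ 5" by simp
      finally show ?thesis .
    next
      case False
      have "\<bar>s\<bar> ^ 3 \<le> \<bar>s\<bar> ^ 10" using False by (intro power_increasing) auto
      also have "\<dots> = (s\<^sup>2) ^ 5" by (simp flip: power_mult)
      also have "\<dots> \<le> (1 + s\<^sup>2) ^ 5" by (intro power_mono) auto
      finally show ?thesis .
    qed
    also note one_plus_sq_power5_le[of s]
    also have "20 ^ 5 * exp (s\<^sup>2 / 4) \<le> 20 ^ 5 * exp (s\<^sup>2 / 2)" by simp
    finally have *: "\<bar>s\<bar> ^ 3 * exp (- s\<^sup>2 / 2) \<le> 20 ^ 5" by (simp add: exp_minus field_simps)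
    have "\<phi> s = 1 / sqrt (2 * pi) * exp (- s\<^sup>2 / 2)" by (simp add: std_normal_density_def)
    also have "\<dots> \<le> 1 * exp (- s\<^sup>2 / 2)"
      using pi_ge_two by (intro mult_right_mono) auto
    also have "\<dots> \<le> 20 ^ 5 / \<bar>s\<bar> ^ 3" using * that by (simp add: field_simps)
    also have "\<dots> \<le> - (2 * 20 ^ 5) / s ^ 3" using that 
      by (auto simp: field_simps abs_if)
    finally show ?thesis .
  qed
  have D: "((\<lambda>s. 20 ^ 5 / s\<^sup>2 - \<Phi> s) has_real_derivative - (2 * 20 ^ 5) / s ^ 3 - \<phi> s) (at s)"
    if "s < 0" for s
    using that by (auto intro!: derivative_eq_intros simp: field_simps power2_eq_square power3_eq_cube)
  have "0 \<le> 20 ^ 5 / t\<^sup>2 - \<Phi> t"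
  proof (rule tendsto_upperbound)
    show "((\<lambda>s. 20 ^ 5 / s\<^sup>2 - \<Phi> s) \<longlongrightarrow> 0) at_bot"
    proof -
      have "((\<lambda>s::real. 20 ^ 5 / s\<^sup>2) \<longlongrightarrow> 0) at_bot" by real_asymp
      from tendsto_diff[OF this std_normal.cdf_lim_at_bot] show ?thesis by simp
    qed
    show "\<forall>\<^sub>F s in at_bot. 20 ^ 5 / s\<^sup>2 - \<Phi> s \<le> 20 ^ 5 / t\<^sup>2 - \<Phi> t"
      unfolding eventually_at_bot_linorder
    proof (intro exI allI impI)
      fix s assume "s \<le> t"
      then show "20 ^ 5 / s\<^sup>2 - \<Phi> s \<le> 20 ^ 5 / t\<^sup>2 - \<Phi> t"
      proof (rule DERIV_nonneg_imp_nondecreasing)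
        fix y assume "y \<le> t"
        then have "y < 0" using \<open>t < 0\<close> by simp
        then show "\<exists>D. ((\<lambda>s. 20 ^ 5 / s\<^sup>2 - \<Phi> s) has_real_derivative D) (at y) \<and> 0 \<le> D"
          using D[of y] dom[of y] by (intro exI conjI) (assumption, simp_all)
      qed
    qed
  qed auto
  then show ?thesis by simp
qed

section \<open>Elementary inequalities\<close>

text \<open>The product condition says that h' has the sign of y - c, so h falls before c and rises
  after it. Applied to an envelope plus or minus a Taylor remainder, it yields two-sided
  bounds.\<close>

lemma min_at_sign_change_of_deriv:
  fixes h :: "real \<Rightarrow> real"
  assumes deriv: "\<And>y. a \<le> y \<Longrightarrow> y \<le> b \<Longrightarrow> (h has_real_derivative h' y) (at y)"
    and sgn: "\<And>y. a \<le> y \<Longrightarrow> y \<le> b \<Longrightarrow> 0 \<le> (y - c) * h' y"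
    and c: "a \<le> c" "c \<le> b" and x: "a \<le> x" "x \<le> b"
  shows "h c \<le> h x"
proof -
  have cont: "continuous_on {min c x..max c x} h"
  proof (rule DERIV_continuous_on)
    fix y assume "y \<in> {min c x..max c x}"
    then have "a \<le> y" "y \<le> b" using c x by auto
    from has_field_derivative_at_within[OF deriv[OF this]]
    show "(h has_real_derivative h' y) (at y within {min c x..max c x})" .
  qed
  show ?thesis
  proof (cases "c \<le> x")
    case True
    show ?thesis
    proof (rule DERIV_nonneg_imp_increasing_open[OF True])
      fix y assume y: "c < y" "y < x"
      then have "0 \<le> h' y" using sgn[of y] c x by (simp add: zero_le_mult_iff)
      then show "\<exists>D. (h has_real_derivative D) (at y) \<and> 0 \<le> D" using deriv[of y] y c x by auto
    qed (use cont True in auto)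
  next
    case False
    show ?thesis
    proof (rule DERIV_nonpos_imp_decreasing_open[of x c])
      fix y assume y: "x < y" "y < c"
      then have "h' y \<le> 0" using sgn[of y] c x by (simp add: zero_le_mult_iff)
      then show "\<exists>D. (h has_real_derivative D) (at y) \<and> D \<le> 0" using deriv[of y] y c x by auto
    qed (use cont False in auto)
  qed
qed

text \<open>A factor s of modulus 1 treats the upper and the lower bound at once. The derivative of
  y^4 + s times the remainder is y^3 (4 - s / (1 + y)), and the bracket is positive because 1 / (1 +
  y) \<le> 2 for |y| \<le> 1/2.\<close>

lemma abs_ln_one_plus_cubic_bound:
  fixes v :: real
  assumes "\<bar>v\<bar> \<le> 1/2"
  shows "\<bar>ln (1 + v) - (v - v\<^sup>2 / 2 + v ^ 3 / 3)\<bar> \<le> v ^ 4"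
proof -
  have "0 \<le> v ^ 4 + s * (ln (1 + v) - (v - v\<^sup>2 / 2 + v ^ 3 / 3))" if s: "\<bar>s\<bar> = 1" for s
  proof -
    have "0 ^ 4 + s * (ln (1 + 0) - (0 - 0\<^sup>2 / 2 + 0 ^ 3 / 3)) \<le> 
       v ^ 4 + s * (ln (1 + v) - (v - v\<^sup>2 / 2 + v ^ 3 / 3))"
    proof (rule min_at_sign_change_of_deriv[where a = "-1/2" and b = "1/2" and c = 0 and x = v
          and h = "\<lambda>y. y ^ 4 + s * (ln (1 + y) - (y - y\<^sup>2 / 2 + y ^ 3 / 3))"
          and h' = "\<lambda>y. y ^ 3 * (4 - s / (1 + y))"])
      fix y :: real assume y: "-1/2 \<le> y" "y \<le> 1/2"
      have "\<bar>s / (1 + y)\<bar> \<le> 2" using y s by (simp add: abs_divide divide_simps)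
      then have "0 \<le> 4 - s / (1 + y)" by linarith
      then have "0 \<le> y ^ 4 * (4 - s / (1 + y))" by simp
      also have "\<dots> = (y - 0) * (y ^ 3 * (4 - s / (1 + y)))" by (simp add: power4_eq_xxxx power3_eq_cube)
      finally show "0 \<le> (y - 0) * (y ^ 3 * (4 - s / (1 + y)))" .
      have A: "1 / (1 + y) - (1 - y + y\<^sup>2) = - (y ^ 3 / (1 + y))"
        using y by (simp add: field_simps power2_eq_square power3_eq_cube)
      have "4 * y ^ 3 + s * (1 / (1 + y) - (1 - y + y\<^sup>2)) = y ^ 3 * (4 - s / (1 + y))"
        unfolding A by (simp add: algebra_simps)
      moreover have "((\<lambda>y. y ^ 4 + s * (ln (1 + y) - (y - y\<^sup>2 / 2 + y ^ 3 / 3))) has_real_derivative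
          4 * y ^ 3 + s * (1 / (1 + y) - (1 - y + y\<^sup>2))) (at y)"
        using y by (auto intro!: derivative_eq_intros)
      ultimately show "((\<lambda>y. y ^ 4 + s * (ln (1 + y) - (y - y\<^sup>2 / 2 + y ^ 3 / 3))) has_real_derivative
          y ^ 3 * (4 - s / (1 + y))) (at y)" by simp
    qed (use assms in auto)
    then show ?thesis by simp
  qed
  from this[of 1] this[of "-1"] show ?thesis by auto
qed

lemma abs_exp_linear_bound: "\<bar>exp y - 1 - y\<bar> \<le> y\<^sup>2 * exp \<bar>y\<bar>" for y :: real
proof -
  obtain t where t: "\<bar>t\<bar> \<le> \<bar>y\<bar>" "exp y = (\<Sum>m<2. y ^ m / fact m) + exp t / fact 2 * y\<^sup>2"
    using Maclaurin_exp_le[of y 2] by auto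
  then have "\<bar>exp y - 1 - y\<bar> = exp t / 2 * y\<^sup>2" by (simp add: eval_nat_numeral)
  also have "\<dots> \<le> exp \<bar>y\<bar> * y\<^sup>2"
  proof (intro mult_right_mono)
    have "exp t \<le> exp \<bar>y\<bar>" using t(1) by simp
    then show "exp t / 2 \<le> exp \<bar>y\<bar>" using exp_gt_zero[of t] by linarith
  qed auto
  finally show ?thesis by (simp add: mult.commute)
qed

lemma abs_cube_bound: "\<bar>t\<bar> ^ 3 + \<bar>t\<bar> \<le> (1 + t\<^sup>2)\<^sup>2" for t :: real
proof -
  have "\<bar>t\<bar> * (1 + t\<^sup>2) \<le> (1 + t\<^sup>2) * (1 + t\<^sup>2)"
    using sum_squares_bound[of "\<bar>t\<bar>" 1] by (intro mult_right_mono) auto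
  then show ?thesis by (simp add: power2_eq_square power3_eq_cube algebra_simps)
qed

text \<open>The restriction on \<epsilon> |t| keeps |q + R| below (1 + t^2) / 4, so exp |q + R|
  costs at most 2 exp (t^2 / 4). The remaining half of the Gaussian absorbs all powers of 1 + t^2
  and still leaves 1 / (1 + t^2), an envelope with bounded antiderivative.\<close>

lemma gaussian_exp_perturbation:
  fixes t \<epsilon> c d R M :: real
  assumes M: "1 \<le> M" "\<bar>c\<bar> \<le> M" "\<bar>d\<bar> \<le> M" and R: "\<bar>R\<bar> \<le> M * \<epsilon>\<^sup>2 * (t ^ 4 + t\<^sup>2)"
    and \<epsilon>: "0 < \<epsilon>" "8 * M * (\<epsilon> * \<bar>t\<bar>) \<le> 1"
  shows "\<bar>exp (- t\<^sup>2 / 2 + \<epsilon> * (c * t ^ 3 + d * t) + R) - exp (- t\<^sup>2 / 2) * (1 + \<epsilon> * (c * t ^ 3 + d * t))\<bar>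
          \<le> 9 * M\<^sup>2 * 20 ^ 5 * (\<epsilon>\<^sup>2 / (1 + t\<^sup>2))"
proof -
  define q where "q = \<epsilon> * (c * t ^ 3 + d * t)"
  define w where "w = \<epsilon> * \<bar>t\<bar>"
  define T where "T = 1 + t\<^sup>2"
  have T: "1 \<le> T" by (simp add: T_def)
  have "0 \<le> w" "8 * (M * w) \<le> 1" using \<epsilon> by (simp_all add: w_def mult_ac)
  moreover from this(1) have "w \<le> M * w" using M mult_right_mono[of 1 M w] by simp
  ultimately have w: "0 \<le> w" "w \<le> 1" "M * w \<le> 1 / 8" by linarith+
  have "\<bar>c * t ^ 3 + d * t\<bar> \<le> \<bar>c\<bar> * \<bar>t\<bar> ^ 3 + \<bar>d\<bar> * \<bar>t\<bar>"
    using abs_triangle_ineq[of "c * t ^ 3" "d * t"] by (simp add: abs_mult power_abs)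
  also have "\<dots> \<le> M * \<bar>t\<bar> ^ 3 + M * \<bar>t\<bar>" using M by (intro add_mono mult_right_mono) auto
  also have "\<dots> = M * \<bar>t\<bar> * T" by (simp add: T_def power2_eq_square power3_eq_cube algebra_simps)
  finally have "\<bar>q\<bar> \<le> \<epsilon> * (M * \<bar>t\<bar> * T)" using \<epsilon> by (simp add: q_def abs_mult)
  then have q: "\<bar>q\<bar> \<le> M * w * T" by (simp add: w_def mult_ac)
  have w2: "w\<^sup>2 = \<epsilon>\<^sup>2 * t\<^sup>2" by (simp add: w_def power_mult_distrib)
  have "M * \<epsilon>\<^sup>2 * (t ^ 4 + t\<^sup>2) = M * w\<^sup>2 * T"
    unfolding w2 T_def by (simp add: power2_eq_square power4_eq_xxxx algebra_simps)
  with R have R': "\<bar>R\<bar> \<le> M * w\<^sup>2 * T" by simp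
  have "M * w\<^sup>2 * T \<le> M * w * T"
    using w M T by (intro mult_right_mono mult_left_mono) (auto simp: power2_eq_square mult_left_le)
  with q R' have y: "\<bar>q + R\<bar> \<le> 2 * (M * w * T)" by linarith
  have "M * w * T \<le> 1/8 * T" using w T by (intro mult_right_mono) auto
  with y have "\<bar>q + R\<bar> \<le> T / 4" by simp
  then have "exp \<bar>q + R\<bar> \<le> exp (1/4 + t\<^sup>2 / 4)" by (simp add: T_def)
  also have "\<dots> = exp (1/4) * exp (t\<^sup>2 / 4)" by (rule exp_add)
  also have "\<dots> \<le> 2 * exp (t\<^sup>2 / 4)"
  proof (intro mult_right_mono)
    have "exp (1/4 :: real) \<le> 1 + 1/4 + (1/4)\<^sup>2" by (rule exp_bound) auto
    then show "exp (1/4 :: real) \<le> 2" by (simp add: power2_eq_square)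
  qed auto
  finally have e: "exp \<bar>q + R\<bar> \<le> 2 * exp (t\<^sup>2 / 4)" .
  have wT: "w\<^sup>2 \<le> \<epsilon>\<^sup>2 * T" unfolding w2 T_def by (intro mult_left_mono) auto
  have "(q + R)\<^sup>2 \<le> (2 * (M * w * T))\<^sup>2" using power_mono[OF y abs_ge_zero, of 2] by simp
  also have "\<dots> = 4 * M\<^sup>2 * (w\<^sup>2 * T\<^sup>2)" by (simp add: power_mult_distrib)
  also have "\<dots> \<le> 4 * M\<^sup>2 * ((\<epsilon>\<^sup>2 * T) * T\<^sup>2)" using wT by (intro mult_left_mono mult_right_mono) auto
  finally have sq: "(q + R)\<^sup>2 \<le> 4 * M\<^sup>2 * (\<epsilon>\<^sup>2 * T ^ 3)" by (simp add: power2_eq_square power3_eq_cube mult_ac)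
  have "M * w\<^sup>2 * T \<le> M\<^sup>2 * (\<epsilon>\<^sup>2 * T) * T"
    using M wT T by (intro mult_right_mono mult_mono) (auto simp: power2_eq_square)
  also have "\<dots> = M\<^sup>2 * \<epsilon>\<^sup>2 * T\<^sup>2" by (simp add: power2_eq_square)
  also have "\<dots> \<le> M\<^sup>2 * \<epsilon>\<^sup>2 * T ^ 3" using T by (intro mult_left_mono power_increasing) auto
  also have "\<dots> \<le> M\<^sup>2 * \<epsilon>\<^sup>2 * T ^ 3 * exp (t\<^sup>2 / 4)"
    using mult_left_mono[of 1 "exp (t\<^sup>2 / 4)" "M\<^sup>2 * \<epsilon>\<^sup>2 * T ^ 3"] T by simp
  finally have R'': "\<bar>R\<bar> \<le> M\<^sup>2 * \<epsilon>\<^sup>2 * T ^ 3 * exp (t\<^sup>2 / 4)" using R' by linarith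
  have "\<bar>exp (q + R) - (1 + q)\<bar> \<le> \<bar>exp (q + R) - 1 - (q + R)\<bar> + \<bar>R\<bar>" by linarith
  also have "\<dots> \<le> (q + R)\<^sup>2 * exp \<bar>q + R\<bar> + \<bar>R\<bar>" using abs_exp_linear_bound by simp
  also have "(q + R)\<^sup>2 * exp \<bar>q + R\<bar> \<le> (4 * M\<^sup>2 * (\<epsilon>\<^sup>2 * T ^ 3)) * (2 * exp (t\<^sup>2 / 4))"
    using sq e T by (intro mult_mono) auto
  also note R''
  \<comment> \<open>The 9 is 4 * 2 from the quadratic remainder of the exponential plus 1 from
    R.\<close>
  finally have main: "\<bar>exp (q + R) - (1 + q)\<bar> \<le> 9 * M\<^sup>2 * \<epsilon>\<^sup>2 * (T ^ 3 * exp (t\<^sup>2 / 4))" by (simp add: mult_ac)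
  have "T ^ 3 * exp (t\<^sup>2 / 4) * exp (- t\<^sup>2 / 2) = T ^ 3 * exp (- t\<^sup>2 / 4)"
    by (simp flip: exp_add add: mult.assoc)
  also have "\<dots> \<le> 20 ^ 5 / T"
  proof -
    have "T ^ 3 * T \<le> T ^ 5" using power_increasing[of 4 5 T] T by (simp add: eval_nat_numeral mult_ac)
    also have "\<dots> \<le> 20 ^ 5 * exp (t\<^sup>2 / 4)" unfolding T_def by (rule one_plus_sq_power5_le)
    finally show ?thesis using T by (simp add: exp_minus divide_simps)
  qed
  finally have g: "T ^ 3 * exp (t\<^sup>2 / 4) * exp (- t\<^sup>2 / 2) \<le> 20 ^ 5 / T" .
  have "exp (- t\<^sup>2 / 2 + q + R) = exp (- t\<^sup>2 / 2) * exp (q + R)" by (simp flip: exp_add)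
  then have "\<bar>exp (- t\<^sup>2 / 2 + q + R) - exp (- t\<^sup>2 / 2) * (1 + q)\<bar> = exp (- t\<^sup>2 / 2) * \<bar>exp (q + R) - (1 + q)\<bar>"
    by (simp add: abs_mult flip: right_diff_distrib)
  also have "\<dots> \<le> exp (- t\<^sup>2 / 2) * (9 * M\<^sup>2 * \<epsilon>\<^sup>2 * (T ^ 3 * exp (t\<^sup>2 / 4)))"
    using main by (intro mult_left_mono) auto
  also have "\<dots> = 9 * M\<^sup>2 * \<epsilon>\<^sup>2 * (T ^ 3 * exp (t\<^sup>2 / 4) * exp (- t\<^sup>2 / 2))" by (simp add: mult_ac)
  also have "\<dots> \<le> 9 * M\<^sup>2 * \<epsilon>\<^sup>2 * (20 ^ 5 / T)" using g by (intro mult_left_mono) auto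
  finally show ?thesis by (simp add: q_def T_def mult_ac)
qed

section \<open>The Kullback--Leibler divergence of Bernoulli distributions\<close>

text \<open>For x = X / n, n times this is the drop of the binomial loglikelihood from its maximum.
  It is therefore the large exponent of the beta kernels and half the square of the loglikelihood
  root.\<close>

definition bernoulli_kl :: "real \<Rightarrow> real \<Rightarrow> real" where
  "bernoulli_kl x \<theta> = x * ln (x / \<theta>) + (1 - x) * ln ((1 - x) / (1 - \<theta>))"

lemma has_real_derivative_bernoulli_kl:
  assumes "0 < x" "x < 1" "0 < \<theta>" "\<theta> < 1"
  shows "(bernoulli_kl x has_real_derivative (\<theta> - x) / (\<theta> * (1 - \<theta>))) (at \<theta>)"
proof -
  have "((\<lambda>\<theta>. x * (ln x - ln \<theta>) + (1 - x) * (ln (1 - x) - ln (1 - \<theta>))) has_real_derivative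
           x * (- 1 / \<theta>) + (1 - x) * (1 / (1 - \<theta>))) (at \<theta>)"
    using assms by (auto intro!: derivative_eq_intros)
  moreover have "x * (- 1 / \<theta>) + (1 - x) * (1 / (1 - \<theta>)) = (\<theta> - x) / (\<theta> * (1 - \<theta>))"
    using assms by (simp add: field_simps)
  ultimately have "((\<lambda>\<theta>. x * (ln x - ln \<theta>) + (1 - x) * (ln (1 - x) - ln (1 - \<theta>))) has_real_derivative
           (\<theta> - x) / (\<theta> * (1 - \<theta>))) (at \<theta>)" by simp
  then show ?thesis
    by (rule has_field_derivative_transform_within_open[of _ _ _ "{0<..<1}"])
      (use assms in \<open>auto simp: bernoulli_kl_def ln_div\<close>)
qed

lemma bernoulli_kl_self [simp]: "0 < x \<Longrightarrow> x < 1 \<Longrightarrow> bernoulli_kl x x = 0"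
  by (simp add: bernoulli_kl_def)

text \<open>The right side minus the left side has derivative (\<theta> - x) (1 / (\<theta> (1 -
  \<theta>)) - 4), which has the sign of \<theta> - x because \<theta> (1 - \<theta>) \<le>
  1/4.\<close>

lemma bernoulli_kl_pinsker:
  assumes "0 < x" "x < 1" "0 < \<theta>" "\<theta> < 1"
  shows "2 * (\<theta> - x)\<^sup>2 \<le> bernoulli_kl x \<theta>"
proof -
  have "bernoulli_kl x x - 2 * (x - x)\<^sup>2 \<le> bernoulli_kl x \<theta> - 2 * (\<theta> - x)\<^sup>2"
  proof (rule min_at_sign_change_of_deriv[where a = "min x \<theta>" and b = "max x \<theta>" and c = x and x = \<theta>
        and h = "\<lambda>\<theta>. bernoulli_kl x \<theta> - 2 * (\<theta> - x)\<^sup>2"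
        and h' = "\<lambda>\<theta>. (\<theta> - x) / (\<theta> * (1 - \<theta>)) - 4 * (\<theta> - x)"])
    fix y assume "min x \<theta> \<le> y" "y \<le> max x \<theta>"
    then have y: "0 < y" "y < 1" using assms by auto
    show "((\<lambda>\<theta>. bernoulli_kl x \<theta> - 2 * (\<theta> - x)\<^sup>2) has_real_derivative
            (y - x) / (y * (1 - y)) - 4 * (y - x)) (at y)"
      by (rule derivative_eq_intros has_real_derivative_bernoulli_kl y assms refl)+ (simp add: algebra_simps)
    have "0 \<le> (1 - 2 * y)\<^sup>2" by simp
    then have "4 * (y * (1 - y)) \<le> 1" by (simp add: power2_eq_square algebra_simps)
    then have "0 \<le> 1 / (y * (1 - y)) - 4" using y by (simp add: field_simps)
    then have "0 \<le> (y - x)\<^sup>2 * (1 / (y * (1 - y)) - 4)" by simp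
    also have "\<dots> = (y - x) * ((y - x) * (1 / (y * (1 - y)) - 4))"
      by (simp only: power2_eq_square mult.assoc)
    also have "(y - x) * (1 / (y * (1 - y)) - 4) = (y - x) / (y * (1 - y)) - 4 * (y - x)"
      by (simp add: right_diff_distrib)
    finally show "0 \<le> (y - x) * ((y - x) / (y * (1 - y)) - 4 * (y - x))" .
  qed auto
  then show ?thesis using assms by simp
qed

lemma ln_divide_one_plus: "0 < x \<Longrightarrow> 0 < y \<Longrightarrow> ln (y / x) = ln (1 + (y - x) / x)" for x y :: real
  by (simp add: field_simps)

text \<open>With \<theta> = x + u the divergence is - x ln (1 + u / x) - (1 - x) ln (1 - u / (1 -
  x)). The linear terms cancel, and the quartic errors u^4 / x^3 and u^4 / (1 - x)^3 are at most u^4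
  / m^3 each.\<close>

lemma bernoulli_kl_taylor:
  assumes m: "0 < m" "m \<le> x" "x \<le> 1 - m" and u: "\<bar>u\<bar> \<le> m / 2"
  shows "\<bar>bernoulli_kl x (x + u) -
           (u\<^sup>2 / (2 * (x * (1 - x))) - (1 - 2 * x) * u ^ 3 / (3 * (x * (1 - x))\<^sup>2))\<bar> \<le> 2 * u ^ 4 / m ^ 3"
proof -
  have x: "0 < x" "x < 1" "0 < x + u" "x + u < 1" using assms by linarith+
  have v: "\<bar>u / x\<bar> \<le> 1/2" "\<bar>- u / (1 - x)\<bar> \<le> 1/2"
    using m u by (auto simp: abs_divide divide_simps)
  define e1 where "e1 = ln (1 + u / x) - (u / x - (u / x)\<^sup>2 / 2 + (u / x) ^ 3 / 3)"
  define e2 where "e2 = ln (1 + - u / (1 - x)) - (- u / (1 - x) - (- u / (1 - x))\<^sup>2 / 2 + (- u / (1 - x)) ^ 3 / 3)"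
  have e: "\<bar>e1\<bar> \<le> (u / x) ^ 4" "\<bar>e2\<bar> \<le> (- u / (1 - x)) ^ 4"
    unfolding e1_def e2_def by (intro abs_ln_one_plus_cubic_bound v)+
  have eq: "- bernoulli_kl x (x + u) = x * ln (1 + u / x) + (1 - x) * ln (1 + - u / (1 - x))"
  proof -
    have "ln (1 + u / x) = ln (x + u) - ln x" "ln (1 + - u / (1 - x)) = ln (1 - (x + u)) - ln (1 - x)"
      using ln_divide_one_plus[of x "x + u"] ln_divide_one_plus[of "1 - x" "1 - (x + u)"] x
        ln_div[of "x + u" x] ln_div[of "1 - (x + u)" "1 - x"] by simp_all
    then show ?thesis
      using x ln_div[of x "x + u"] ln_div[of "1 - x" "1 - (x + u)"]
      by (simp only: bernoulli_kl_def) (simp add: algebra_simps)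
  qed
  have P: "y * (v / y - (v / y)\<^sup>2 / 2 + (v / y) ^ 3 / 3) = v - v\<^sup>2 / y / 2 + v ^ 3 / y\<^sup>2 / 3"
    if "y \<noteq> 0" for v y :: real
    using that by (simp add: field_simps power2_eq_square power3_eq_cube)
  have "x * (u / x - (u / x)\<^sup>2 / 2 + (u / x) ^ 3 / 3) +
      (1 - x) * (- u / (1 - x) - (- u / (1 - x))\<^sup>2 / 2 + (- u / (1 - x)) ^ 3 / 3) =
      (u - u\<^sup>2 / x / 2 + u ^ 3 / x\<^sup>2 / 3) + (- u - u\<^sup>2 / (1 - x) / 2 - u ^ 3 / (1 - x)\<^sup>2 / 3)"
    using x P[of x u] P[of "1 - x" "- u"] by simp
  also have "\<dots> = - (u\<^sup>2 / (2 * (x * (1 - x))) - (1 - 2 * x) * u ^ 3 / (3 * (x * (1 - x))\<^sup>2))"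
    using x by (simp add: divide_simps) (simp add: power2_eq_square power3_eq_cube algebra_simps)
  finally have "bernoulli_kl x (x + u) -
      (u\<^sup>2 / (2 * (x * (1 - x))) - (1 - 2 * x) * u ^ 3 / (3 * (x * (1 - x))\<^sup>2)) = - (x * e1 + (1 - x) * e2)"
    using eq by (simp add: e1_def e2_def right_diff_distrib)
  then have "\<bar>bernoulli_kl x (x + u) -
      (u\<^sup>2 / (2 * (x * (1 - x))) - (1 - 2 * x) * u ^ 3 / (3 * (x * (1 - x))\<^sup>2))\<bar> \<le> x * \<bar>e1\<bar> + (1 - x) * \<bar>e2\<bar>"
    using abs_triangle_ineq[of "x * e1" "(1 - x) * e2"] x by (simp add: abs_mult)
  also have "\<dots> \<le> x * (u / x) ^ 4 + (1 - x) * (- u / (1 - x)) ^ 4"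
    using e x by (intro add_mono mult_left_mono) auto
  also have "\<dots> = u ^ 4 / x ^ 3 + u ^ 4 / (1 - x) ^ 3"
    using x by (simp add: power4_eq_xxxx power3_eq_cube)
  also have "\<dots> \<le> u ^ 4 / m ^ 3 + u ^ 4 / m ^ 3"
    using m by (intro add_mono divide_left_mono power_mono mult_pos_pos) auto
  finally show ?thesis by simp
qed

section \<open>Gaussian approximation of the beta kernels\<close>

text \<open>Up to a constant factor this is the density of Beta (n x + s, n (1 - x) - s + 1), see
  \<open>beta_kernel_powr\<close>. The exponential form separates the divergence, multiplied by n,
  from a weight that does not grow with n.\<close>

definition beta_kernel :: "real \<Rightarrow> real \<Rightarrow> real \<Rightarrow> real \<Rightarrow> real" where
  "beta_kernel n s x \<theta> =
     exp (- n * bernoulli_kl x \<theta> + (s - 1) * ln (\<theta> / x) - s * ln ((1 - \<theta>) / (1 - x)))"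

lemma variance_bounds:
  fixes m x \<sigma> :: real
  assumes m: "0 < m" "m \<le> x" "x \<le> 1 - m" and \<sigma>: "0 < \<sigma>" "\<sigma>\<^sup>2 = x * (1 - x)"
  shows "m \<le> \<sigma>" "\<sigma> \<le> 1"
proof -
  have "m * m \<le> x * (1 - x)" using m by (intro mult_mono) auto
  then have "m\<^sup>2 \<le> \<sigma>\<^sup>2" unfolding \<sigma>(2) unfolding power2_eq_square .
  then show "m \<le> \<sigma>" using \<sigma>(1) by (rule power2_le_imp_le[OF _ less_imp_le])
  have "x * (1 - x) \<le> 1 * 1" using m by (intro mult_mono) auto
  then have "\<sigma>\<^sup>2 \<le> 1\<^sup>2" unfolding \<sigma>(2) by simp
  then show "\<sigma> \<le> 1" by (rule power2_le_imp_le) simp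
qed

lemma edgeworth_coefficient_bounds:
  fixes m x \<sigma> s :: real
  assumes m: "0 < m" "m \<le> x" "x \<le> 1 - m" and \<sigma>: "0 < \<sigma>" "\<sigma>\<^sup>2 = x * (1 - x)" and s: "0 \<le> s" "s \<le> 1"
  shows "\<bar>(1 - 2 * x) / (3 * \<sigma>)\<bar> \<le> 1 / m" "\<bar>(s - 1 + x) / \<sigma>\<bar> \<le> 1 / m"
proof -
  note b = variance_bounds[OF m \<sigma>]
  have "\<bar>1 - 2 * x\<bar> * m \<le> 1 * (3 * \<sigma>)" using m b by (intro mult_mono) auto
  then show "\<bar>(1 - 2 * x) / (3 * \<sigma>)\<bar> \<le> 1 / m" using m \<sigma> by (simp add: abs_divide field_simps)
  have "\<bar>s - 1 + x\<bar> * m \<le> 1 * \<sigma>" using m b s by (intro mult_mono) auto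
  then show "\<bar>(s - 1 + x) / \<sigma>\<bar> \<le> 1 / m" using m \<sigma> by (simp add: abs_divide field_simps)
qed

text \<open>Here c collects the cubic term of the divergence and d the linear terms of the weight.
  The radius m^4 / 16 is made for \<open>gaussian_exp_perturbation\<close> with M = 2 / m^3: as
  \<sigma> \<ge> m, it gives \<epsilon> |t| \<le> m^3 / 16, that is 8 M \<epsilon> |t| \<le>
  1.\<close>

lemma beta_kernel_near:
  fixes m x \<sigma> s \<epsilon> n t :: real
  defines "c \<equiv> (1 - 2 * x) / (3 * \<sigma>)" and "d \<equiv> (s - 1 + x) / \<sigma>"
  assumes m: "0 < m" "m \<le> x" "x \<le> 1 - m" and \<sigma>: "0 < \<sigma>" "\<sigma>\<^sup>2 = x * (1 - x)"
    and s: "0 \<le> s" "s \<le> 1" and \<epsilon>: "0 < \<epsilon>" "n * \<epsilon>\<^sup>2 = 1"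
    and near: "\<bar>\<sigma> * \<epsilon> * t\<bar> \<le> m ^ 4 / 16"
  shows "\<bar>beta_kernel n s x (x + \<sigma> * \<epsilon> * t) - exp (- t\<^sup>2 / 2) * (1 + \<epsilon> * (c * t ^ 3 + d * t))\<bar>
           \<le> 9 * (2 / m ^ 3)\<^sup>2 * 20 ^ 5 * (\<epsilon>\<^sup>2 / (1 + t\<^sup>2))"
proof -
  define u where "u = \<sigma> * \<epsilon> * t"
  note b = variance_bounds[OF m \<sigma>]
  have "m \<le> 1/2" using m by linarith
  have m1: "m ^ 3 \<le> 1" "m\<^sup>2 \<le> 1" using m by (auto intro!: power_le_one)
  have "m ^ 4 / 16 = m / 2 * (m ^ 3 / 8)" by (simp add: power4_eq_xxxx power3_eq_cube)
  also have "\<dots> \<le> m / 2 * 1" using m m1 by (intro mult_left_mono) auto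
  finally have u: "\<bar>u\<bar> \<le> m / 2" using near by (simp add: u_def)
  have x: "0 < x" "x < 1" "0 < x + u" "x + u < 1" using m u by linarith+
  have v: "\<bar>u / x\<bar> \<le> 1/2" "\<bar>- u / (1 - x)\<bar> \<le> 1/2"
    using m u by (auto simp: abs_divide divide_simps)
  define e0 where "e0 = bernoulli_kl x (x + u) - (u\<^sup>2 / (2 * (x * (1 - x))) - (1 - 2 * x) * u ^ 3 / (3 * (x * (1 - x))\<^sup>2))"
  define e1 where "e1 = ln (1 + u / x) - u / x"
  define e2 where "e2 = ln (1 + - u / (1 - x)) - - u / (1 - x)"
  have e0: "\<bar>e0\<bar> \<le> 2 * u ^ 4 / m ^ 3" unfolding e0_def by (rule bernoulli_kl_taylor[OF m u])
  have e: "\<bar>e1\<bar> \<le> 2 * (u / x)\<^sup>2" "\<bar>e2\<bar> \<le> 2 * (- u / (1 - x))\<^sup>2"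
    unfolding e1_def e2_def by (intro abs_ln_one_plus_x_minus_x_bound v)+
  define R where "R = - n * e0 + (s - 1) * e1 - s * e2"
  have lns: "ln ((x + u) / x) = u / x + e1" "ln ((1 - (x + u)) / (1 - x)) = - u / (1 - x) + e2"
    using ln_divide_one_plus[of x "x + u"] ln_divide_one_plus[of "1 - x" "1 - (x + u)"] x
    by (auto simp: e1_def e2_def)
  have t2: "n * u\<^sup>2 / (x * (1 - x)) = t\<^sup>2"
  proof -
    have "n * u\<^sup>2 = (n * \<epsilon>\<^sup>2) * (\<sigma>\<^sup>2 * t\<^sup>2)" by (simp add: u_def power_mult_distrib)
    then show ?thesis unfolding \<sigma>(2)[symmetric] using \<epsilon>(2) \<sigma>(1) by simp
  qed
  have u3: "n * u ^ 3 * \<sigma> = n * \<epsilon>\<^sup>2 * \<epsilon> * t ^ 3 * (\<sigma>\<^sup>2)\<^sup>2"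
    unfolding u_def by algebra
  have t3: "n * ((1 - 2 * x) * u ^ 3 / (3 * (x * (1 - x))\<^sup>2)) = \<epsilon> * (c * t ^ 3)"
  proof -
    have "n * u ^ 3 * (3 * \<sigma>) = \<epsilon> * t ^ 3 * (3 * (\<sigma>\<^sup>2)\<^sup>2)"
      using u3 \<epsilon>(2) by simp
    then have "n * u ^ 3 / (3 * (\<sigma>\<^sup>2)\<^sup>2) = \<epsilon> * t ^ 3 / (3 * \<sigma>)"
      using \<sigma>(1) by (intro frac_eq_eq[THEN iffD2]) auto
    then have "(1 - 2 * x) * (n * u ^ 3 / (3 * (\<sigma>\<^sup>2)\<^sup>2)) = (1 - 2 * x) * (\<epsilon> * t ^ 3 / (3 * \<sigma>))" by simp
    then show ?thesis unfolding \<sigma>(2) c_def by (simp only: times_divide_eq_left times_divide_eq_right mult_ac)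
  qed
  \<comment> \<open>The numerator is (s - 1) (1 - x) + s x = s - 1 + x.\<close>
  have "(s - 1) * (u / x) - s * (- u / (1 - x)) = u * (s - 1 + x) / (x * (1 - x))"
    using x by (simp add: field_simps)
  also have "\<dots> = \<epsilon> * (d * t)"
    using \<sigma> by (simp add: d_def u_def power2_eq_square flip: \<sigma>(2))
  finally have t1: "(s - 1) * (u / x) - s * (- u / (1 - x)) = \<epsilon> * (d * t)" .
  \<comment> \<open>The Taylor polynomial P - Q, the linear parts a1, a2 and the errors are
    separated for arbitrary reals, so that the logarithms stay opaque.\<close>
  have split: "- n * K + (s - 1) * (a1 + e1) - s * (a2 + e2) =
      - (n * (2 * P)) / 2 + n * Q + ((s - 1) * a1 - s * a2) + (- n * (K - (P - Q)) + (s - 1) * e1 - s * e2)"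
    for K P Q a1 a2 by (simp add: algebra_simps)
  have "n * (2 * (u\<^sup>2 / (2 * (x * (1 - x))))) = n * u\<^sup>2 / (x * (1 - x))" by simp
  then have "- n * bernoulli_kl x (x + u) + (s - 1) * ln ((x + u) / x) - s * ln ((1 - (x + u)) / (1 - x)) =
     - (n * u\<^sup>2 / (x * (1 - x))) / 2 + n * ((1 - 2 * x) * u ^ 3 / (3 * (x * (1 - x))\<^sup>2)) +
     ((s - 1) * (u / x) - s * (- u / (1 - x))) + R"
    using split[of "bernoulli_kl x (x + u)" "u / x" "- u / (1 - x)" "u\<^sup>2 / (2 * (x * (1 - x)))"
        "(1 - 2 * x) * u ^ 3 / (3 * (x * (1 - x))\<^sup>2)"]
    unfolding lns R_def e0_def by (simp only:)
  also have "\<dots> = - t\<^sup>2 / 2 + \<epsilon> * (c * t ^ 3 + d * t) + R"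
    unfolding t1 t2 t3 by (simp add: algebra_simps)
  finally have k: "beta_kernel n s x (x + u) = exp (- t\<^sup>2 / 2 + \<epsilon> * (c * t ^ 3 + d * t) + R)"
    by (simp add: beta_kernel_def)
  have n: "0 < n" using \<epsilon> by (metis less_numeral_extra(1) zero_less_mult_pos2 zero_less_power)
  have "\<sigma>\<^sup>2 \<le> 1" using b \<sigma>(1) by (intro power_le_one) auto
  then have u2: "u\<^sup>2 \<le> \<epsilon>\<^sup>2 * t\<^sup>2"
    using mult_right_mono[of "\<sigma>\<^sup>2" 1 "\<epsilon>\<^sup>2 * t\<^sup>2"] by (simp add: u_def power_mult_distrib mult.assoc)
  have "n * u ^ 4 = n * (u\<^sup>2 * u\<^sup>2)" by (simp add: power4_eq_xxxx power2_eq_square)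
  also have "\<dots> \<le> n * ((\<epsilon>\<^sup>2 * t\<^sup>2) * (\<epsilon>\<^sup>2 * t\<^sup>2))" using n u2 by (intro mult_left_mono mult_mono) auto
  also have "\<dots> = (n * \<epsilon>\<^sup>2) * (\<epsilon>\<^sup>2 * t ^ 4)" by (simp add: power4_eq_xxxx power2_eq_square)
  finally have u4: "n * u ^ 4 \<le> \<epsilon>\<^sup>2 * t ^ 4" using \<epsilon> by simp
  have sq: "u\<^sup>2 / y\<^sup>2 \<le> (\<epsilon>\<^sup>2 * t\<^sup>2) / m ^ 3" if "m \<le> y" for y
  proof -
    have "m ^ 3 \<le> m\<^sup>2" using m by (intro power_decreasing) auto
    also have "\<dots> \<le> y\<^sup>2" using that m by (intro power_mono) auto
    finally show ?thesis using u2 m that by (intro frac_le) auto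
  qed
  have "\<bar>R\<bar> \<le> n * \<bar>e0\<bar> + ((1 - s) * \<bar>e1\<bar> + s * \<bar>e2\<bar>)"
  proof -
    have "\<bar>R\<bar> \<le> \<bar>n * e0\<bar> + \<bar>(s - 1) * e1\<bar> + \<bar>s * e2\<bar>" unfolding R_def by linarith
    then show ?thesis using n s by (simp add: abs_mult)
  qed
  also have "\<dots> \<le> n * (2 * u ^ 4 / m ^ 3) + ((1 - s) * (2 * (\<epsilon>\<^sup>2 * t\<^sup>2 / m ^ 3)) + s * (2 * (\<epsilon>\<^sup>2 * t\<^sup>2 / m ^ 3)))"
    using e e0 sq[of x] sq[of "1 - x"] m n s
    by (intro add_mono mult_left_mono) (auto simp: power_divide)
  also have "\<dots> = 2 / m ^ 3 * (n * u ^ 4) + 2 / m ^ 3 * (\<epsilon>\<^sup>2 * t\<^sup>2)"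
    using m by (simp add: field_simps)
  also have "\<dots> \<le> 2 / m ^ 3 * (\<epsilon>\<^sup>2 * t ^ 4) + 2 / m ^ 3 * (\<epsilon>\<^sup>2 * t\<^sup>2)"
    using u4 m by (intro add_mono mult_left_mono) auto
  finally have R: "\<bar>R\<bar> \<le> 2 / m ^ 3 * \<epsilon>\<^sup>2 * (t ^ 4 + t\<^sup>2)" by (simp only: distrib_left mult.assoc)
  have "1 / m \<le> 1 / m ^ 3" using m power_decreasing[of 1 3 m] by (intro divide_left_mono) auto
  also have "\<dots> \<le> 2 / m ^ 3" using m by (intro divide_right_mono) auto
  finally have cd: "\<bar>c\<bar> \<le> 2 / m ^ 3" "\<bar>d\<bar> \<le> 2 / m ^ 3"
    using edgeworth_coefficient_bounds[OF m \<sigma> s] by (auto simp: c_def d_def)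
  have "m * (\<epsilon> * \<bar>t\<bar>) \<le> \<sigma> * (\<epsilon> * \<bar>t\<bar>)" using b \<epsilon> by (intro mult_right_mono) auto
  also have "\<dots> = \<bar>\<sigma> * \<epsilon> * t\<bar>" using \<sigma> \<epsilon> by (simp add: abs_mult)
  also note near
  finally have "\<epsilon> * \<bar>t\<bar> \<le> m ^ 3 / 16" using m by (simp add: power4_eq_xxxx power3_eq_cube field_simps)
  then have "8 * (2 / m ^ 3) * (\<epsilon> * \<bar>t\<bar>) \<le> 1" using m by (simp add: field_simps)
  moreover have "1 \<le> 2 / m ^ 3" using m1 m by (simp add: field_simps)
  ultimately show ?thesis
    using gaussian_exp_perturbation[OF _ cd R \<epsilon>(1)] k by (simp add: u_def)
qed

text \<open>Pinsker's inequality makes the main factor exponentially small, but the weight can blow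
  up at 0 and at 1. So 1 / m copies of the divergence are set aside against it: x / m \<ge> 1 and (1
  - x) / m \<ge> 1 make the coefficients \<open>x / m + s - 1\<close> and
  \<open>(1 - x) / m - s\<close> nonnegative, and each logarithm is at most ln (1 / m). As n \<ge> 2
  / m, at least n / 2 copies remain for Pinsker.\<close>

lemma beta_kernel_far:
  fixes m x s n \<theta> \<delta> :: real
  assumes m: "0 < m" "m \<le> x" "x \<le> 1 - m" and s: "0 \<le> s" "s \<le> 1" and n: "2 / m \<le> n"
    and \<theta>: "0 < \<theta>" "\<theta> < 1" and \<delta>: "0 < \<delta>" "\<delta> \<le> \<bar>\<theta> - x\<bar>"
  shows "beta_kernel n s x \<theta> \<le> exp (2 / m * ln (1 / m)) * 2 / \<delta> ^ 4 / n\<^sup>2"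
proof -
  have x: "0 < x" "x < 1" using m by linarith+
  have "0 < n" using m n by (meson divide_pos_pos less_le_trans zero_less_numeral)
  define L1 where "L1 = ln (\<theta> / x)"
  define L2 where "L2 = ln ((1 - \<theta>) / (1 - x))"
  define K where "K = ln (1 / m)"
  have "\<theta> / x \<le> 1 / m" "(1 - \<theta>) / (1 - x) \<le> 1 / m"
    using m \<theta> by (auto intro!: frac_le)
  then have L: "L1 \<le> K" "L2 \<le> K" using x \<theta> m by (auto simp: L1_def L2_def K_def)
  have K: "0 \<le> K" using m by (simp add: K_def)
  have kl: "bernoulli_kl x \<theta> = - (x * L1 + (1 - x) * L2)"
    using x \<theta> by (simp add: bernoulli_kl_def L1_def L2_def ln_div algebra_simps)
  have "1 \<le> x / m" "1 \<le> (1 - x) / m" using m by auto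
  then have cf: "0 \<le> x / m + s - 1" "0 \<le> (1 - x) / m - s" using s by linarith+
  have "- n * bernoulli_kl x \<theta> + (s - 1) * L1 - s * L2 =
      - (n - 1 / m) * bernoulli_kl x \<theta> + ((x / m + s - 1) * L1 + ((1 - x) / m - s) * L2)"
    by (simp add: kl algebra_simps add_divide_distrib diff_divide_distrib)
  also have "\<dots> \<le> - (n / 2) * (2 * \<delta>\<^sup>2) + ((x / m + s - 1) * K + ((1 - x) / m - s) * K)"
  proof (intro add_mono mult_left_mono L cf)
    have "2 * \<delta>\<^sup>2 \<le> 2 * (\<theta> - x)\<^sup>2" using \<delta> by (simp add: abs_le_square_iff[symmetric])
    also have "\<dots> \<le> bernoulli_kl x \<theta>" by (rule bernoulli_kl_pinsker) fact+
    finally have "(n / 2) * (2 * \<delta>\<^sup>2) \<le> (n - 1 / m) * bernoulli_kl x \<theta>"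
      using n m \<open>0 < n\<close> by (intro mult_mono) (auto simp: field_simps)
    then show "- (n - 1 / m) * bernoulli_kl x \<theta> \<le> - (n / 2) * (2 * \<delta>\<^sup>2)"
      by (simp only: mult_minus_left neg_le_iff_le)
  qed
  also have "(x / m + s - 1) * K + ((1 - x) / m - s) * K = (1 / m - 1) * K"
    by (simp add: algebra_simps add_divide_distrib diff_divide_distrib)
  also have "\<dots> \<le> 2 / m * K" using K m by (intro mult_right_mono) (auto simp: field_simps)
  finally have "beta_kernel n s x \<theta> \<le> exp (- (n * \<delta>\<^sup>2) + 2 / m * K)"
    by (simp add: beta_kernel_def L1_def L2_def)
  also have "\<dots> = exp (2 / m * K) * exp (- (n * \<delta>\<^sup>2))" by (simp only: exp_add mult.commute)
  \<comment> \<open>Only n^-2 is kept of the exponential decay: one factor 1 / n is the error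
    allowed, the other will become the envelope in t.\<close>
  also have "exp (- (n * \<delta>\<^sup>2)) \<le> 2 / (n * \<delta>\<^sup>2)\<^sup>2"
  proof -
    have "0 \<le> n * \<delta>\<^sup>2" using \<open>0 < n\<close> by simp
    from exp_lower_Taylor_quadratic[OF this] this
    have "(n * \<delta>\<^sup>2)\<^sup>2 / 2 \<le> exp (n * \<delta>\<^sup>2)" by linarith
    then show ?thesis using \<open>0 < n\<close> \<delta> by (simp add: exp_minus field_simps)
  qed
  finally show ?thesis by (simp add: K_def power_mult_distrib mult_ac flip: power_mult)
qed

lemma Phi_uminus: "\<Phi> (- t) = 1 - \<Phi> t"
proof -
  have D: "((\<lambda>s. \<Phi> s + \<Phi> (- s)) has_real_derivative 0) (at s)" for s
  proof -
    have "\<phi> s = \<phi> (- s)" by (simp add: std_normal_density_def)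
    then show ?thesis by (auto intro!: derivative_eq_intros)
  qed
  have const: "\<Phi> s + \<Phi> (- s) = \<Phi> t + \<Phi> (- t)" for s
    using DERIV_isconst_all D by blast
  have "((\<lambda>s. \<Phi> s + \<Phi> (- s)) \<longlongrightarrow> \<Phi> t + \<Phi> (- t)) at_top"
    by (intro tendsto_eventually always_eventually allI const)
  moreover have "((\<lambda>s. \<Phi> s + \<Phi> (- s)) \<longlongrightarrow> 1 + 0) at_top"
    by (intro tendsto_add std_normal.cdf_lim_at_top_prob
        filterlim_compose[OF std_normal.cdf_lim_at_bot filterlim_uminus_at_bot_at_top])
  ultimately have "\<Phi> t + \<Phi> (- t) = 1" using tendsto_unique[of at_top] by force
  then show ?thesis by simp
qed

lemma gaussian_poly_decay: "(1 + t\<^sup>2) ^ 5 * exp (- t\<^sup>2 / 2) \<le> 20 ^ 5" for t :: real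
proof -
  have "(1 + t\<^sup>2) ^ 5 \<le> 20 ^ 5 * exp (t\<^sup>2 / 4)" by (rule one_plus_sq_power5_le)
  also have "\<dots> \<le> 20 ^ 5 * exp (t\<^sup>2 / 2)" by simp
  finally show ?thesis by (simp add: exp_minus field_simps)
qed

lemma abs_add_mult_bound:
  fixes c d M a b :: real
  assumes "\<bar>c\<bar> \<le> M" "\<bar>d\<bar> \<le> M"
  shows "\<bar>c * a + d * b\<bar> \<le> M * (\<bar>a\<bar> + \<bar>b\<bar>)"
proof -
  have "\<bar>c * a + d * b\<bar> \<le> \<bar>c\<bar> * \<bar>a\<bar> + \<bar>d\<bar> * \<bar>b\<bar>"
    using abs_triangle_ineq[of "c * a" "d * b"] by (simp add: abs_mult)
  also have "\<dots> \<le> M * \<bar>a\<bar> + M * \<bar>b\<bar>" using assms by (intro add_mono mult_right_mono) auto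
  finally show ?thesis by (simp add: distrib_left)
qed

text \<open>Far from x, kernel and approximation are small separately. The kernel is
  O(\<epsilon>^4), and since \<theta> stays in the unit interval, \<epsilon>^2 (1 + t^2) \<le> 2 /
  m^2, so one \<epsilon>^2 can be traded for 1 / (1 + t^2). The Gaussian term is O((1 + t^2)^-2),
  and 1 + t^2 \<ge> \<delta>^2 / \<epsilon>^2 turns one of these factors into \<epsilon>^2.\<close>

lemma beta_kernel_gaussian_far:
  fixes m x \<sigma> s \<epsilon> n t \<delta> :: real
  defines "c \<equiv> (1 - 2 * x) / (3 * \<sigma>)" and "d \<equiv> (s - 1 + x) / \<sigma>"
  defines "K \<equiv> exp (2 / m * ln (1 / m)) * 2 / \<delta> ^ 4"
  assumes m: "0 < m" "m \<le> x" "x \<le> 1 - m" and \<sigma>: "0 < \<sigma>" "\<sigma>\<^sup>2 = x * (1 - x)"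
    and s: "0 \<le> s" "s \<le> 1" and \<epsilon>: "0 < \<epsilon>" "n * \<epsilon>\<^sup>2 = 1" and n: "2 / m \<le> n"
    and \<theta>: "0 < x + \<sigma> * \<epsilon> * t" "x + \<sigma> * \<epsilon> * t < 1"
    and far: "0 < \<delta>" "\<delta> \<le> \<bar>\<sigma> * \<epsilon> * t\<bar>"
  shows "\<bar>beta_kernel n s x (x + \<sigma> * \<epsilon> * t) - exp (- t\<^sup>2 / 2) * (1 + \<epsilon> * (c * t ^ 3 + d * t))\<bar>
           \<le> (2 * K / m\<^sup>2 + 2 * 20 ^ 5 / (m * \<delta>\<^sup>2)) * (\<epsilon>\<^sup>2 / (1 + t\<^sup>2))"
proof -
  define T where "T = 1 + t\<^sup>2"
  have T: "1 \<le> T" by (simp add: T_def)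
  note b = variance_bounds[OF m \<sigma>]
  have m1: "m \<le> 1" using m by linarith
  have "2 \<le> 2 / m" using m m1 by (simp add: field_simps)
  then have n0: "1 \<le> n" using n by linarith
  then have "\<epsilon>\<^sup>2 \<le> n * \<epsilon>\<^sup>2" using mult_right_mono[of 1 n "\<epsilon>\<^sup>2"] by simp
  then have e1: "\<epsilon>\<^sup>2 \<le> 1" using \<epsilon> by simp
  then have e1': "\<epsilon> \<le> 1" using \<epsilon>(1) by (simp add: power2_le_iff_abs_le abs_le_square_iff power_le_one_iff)
  have "K / n\<^sup>2 = K * \<epsilon>\<^sup>2 * \<epsilon>\<^sup>2"
  proof -
    have "1 / n = \<epsilon>\<^sup>2" using n0 \<epsilon>(2) by (simp add: field_simps)
    have "K / n\<^sup>2 = K * (1 / n) * (1 / n)" by (simp add: power2_eq_square)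
    then show ?thesis unfolding \<open>1 / n = \<epsilon>\<^sup>2\<close> .
  qed
  moreover have K0: "0 \<le> K" by (simp add: K_def)
  have tm: "\<epsilon>\<^sup>2 * t\<^sup>2 \<le> 1 / m\<^sup>2"
  proof -
    have "m * \<bar>\<epsilon> * t\<bar> \<le> \<sigma> * \<bar>\<epsilon> * t\<bar>" using b by (intro mult_right_mono) auto
    also have "\<dots> = \<bar>\<sigma> * \<epsilon> * t\<bar>" using \<sigma>(1) by (simp add: abs_mult)
    also have "\<dots> \<le> 1" using \<theta> m by linarith
    finally have "(m * \<bar>\<epsilon> * t\<bar>)\<^sup>2 \<le> 1\<^sup>2" using m by (intro power_mono) auto
    then show ?thesis using m by (simp add: power_mult_distrib field_simps)
  qed
  have "1 \<le> 1 / m\<^sup>2" using m m1 by (simp add: power_le_one)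
  then have "\<epsilon>\<^sup>2 * T \<le> 2 / m\<^sup>2" using tm e1 by (simp add: T_def distrib_left)
  then have "\<epsilon>\<^sup>2 \<le> 2 / m\<^sup>2 / T"
    by (rule pos_le_divide_eq[THEN iffD2, rotated]) (use T in linarith)
  then have "K * \<epsilon>\<^sup>2 * \<epsilon>\<^sup>2 \<le> K * \<epsilon>\<^sup>2 * (2 / m\<^sup>2 / T)" using K0 by (intro mult_left_mono) auto
  moreover have "beta_kernel n s x (x + \<sigma> * \<epsilon> * t) \<le> K / n\<^sup>2"
    unfolding K_def by (rule beta_kernel_far[OF m s n \<theta> far(1)]) (use far(2) in simp)
  ultimately have A: "beta_kernel n s x (x + \<sigma> * \<epsilon> * t) \<le> 2 * K / m\<^sup>2 * (\<epsilon>\<^sup>2 / T)" by (simp add: mult_ac)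
  have "\<bar>c * t ^ 3 + d * t\<bar> \<le> 1 / m * (\<bar>t ^ 3\<bar> + \<bar>t\<bar>)"
    unfolding c_def d_def by (rule abs_add_mult_bound[OF edgeworth_coefficient_bounds[OF m \<sigma> s]])
  also have "\<dots> \<le> 1 / m * T\<^sup>2"
    unfolding T_def using abs_cube_bound[of t] m by (intro mult_left_mono) (auto simp: power_abs)
  finally have "\<epsilon> * \<bar>c * t ^ 3 + d * t\<bar> \<le> 1 * (1 / m * T\<^sup>2)"
    using e1' \<epsilon>(1) by (intro mult_mono) auto
  moreover have "1 \<le> 1 / m * T\<^sup>2"
    using mult_mono[of 1 "1 / m" 1 "T\<^sup>2"] m m1 T by simp
  ultimately have "\<bar>1 + \<epsilon> * (c * t ^ 3 + d * t)\<bar> \<le> 2 / m * T\<^sup>2"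
    using abs_triangle_ineq[of 1 "\<epsilon> * (c * t ^ 3 + d * t)"] \<epsilon>(1) by (simp add: abs_mult)
  then have "\<bar>exp (- t\<^sup>2 / 2) * (1 + \<epsilon> * (c * t ^ 3 + d * t))\<bar> \<le> exp (- t\<^sup>2 / 2) * (2 / m * T\<^sup>2)"
    unfolding abs_mult abs_exp_cancel by (rule mult_left_mono) simp
  also have "\<dots> \<le> 20 ^ 5 / T ^ 5 * (2 / m * T\<^sup>2)"
  proof (rule mult_right_mono)
    have "exp (- t\<^sup>2 / 2) * T ^ 5 \<le> 20 ^ 5"
      using gaussian_poly_decay[of t] by (simp only: T_def mult.commute)
    then show "exp (- t\<^sup>2 / 2) \<le> 20 ^ 5 / T ^ 5"
      by (rule pos_le_divide_eq[THEN iffD2, rotated]) (use T in auto)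
  qed (use m in simp)
  also have "\<dots> = 2 * 20 ^ 5 / m / T ^ 3"
    using T by (simp add: power2_eq_square power3_eq_cube eval_nat_numeral)
  also have "\<dots> \<le> 2 * 20 ^ 5 / m / T\<^sup>2"
    using T m by (intro divide_left_mono power_increasing) auto
  also have "\<dots> \<le> 2 * 20 ^ 5 / m / (T * (\<delta>\<^sup>2 / \<epsilon>\<^sup>2))"
  proof -
    have "\<delta>\<^sup>2 \<le> \<bar>\<sigma> * \<epsilon> * t\<bar>\<^sup>2" using far by (intro power_mono) auto
    also have "\<dots> = \<sigma>\<^sup>2 * (\<epsilon>\<^sup>2 * t\<^sup>2)" by (simp add: power_mult_distrib)
    also have "\<dots> \<le> 1 * (\<epsilon>\<^sup>2 * t\<^sup>2)" using b \<sigma>(1) by (intro mult_right_mono power_le_one) auto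
    also have "\<dots> \<le> \<epsilon>\<^sup>2 * T" unfolding T_def by (simp add: distrib_left)
    finally have "\<delta>\<^sup>2 / \<epsilon>\<^sup>2 \<le> T" using \<epsilon>(1) by (simp add: field_simps)
    then have "T * (\<delta>\<^sup>2 / \<epsilon>\<^sup>2) \<le> T\<^sup>2" using T unfolding power2_eq_square by (intro mult_left_mono) auto
    then show ?thesis using T m far \<epsilon>(1) by (intro divide_left_mono mult_pos_pos) auto
  qed
  also have "\<dots> = 2 * 20 ^ 5 / (m * \<delta>\<^sup>2) * (\<epsilon>\<^sup>2 / T)" using \<epsilon>(1) by simp
  finally have B: "\<bar>exp (- t\<^sup>2 / 2) * (1 + \<epsilon> * (c * t ^ 3 + d * t))\<bar> \<le> 2 * 20 ^ 5 / (m * \<delta>\<^sup>2) * (\<epsilon>\<^sup>2 / T)" .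
  have "0 \<le> beta_kernel n s x (x + \<sigma> * \<epsilon> * t)" by (simp add: beta_kernel_def)
  then have "\<bar>beta_kernel n s x (x + \<sigma> * \<epsilon> * t) - exp (- t\<^sup>2 / 2) * (1 + \<epsilon> * (c * t ^ 3 + d * t))\<bar>
           \<le> 2 * K / m\<^sup>2 * (\<epsilon>\<^sup>2 / T) + 2 * 20 ^ 5 / (m * \<delta>\<^sup>2) * (\<epsilon>\<^sup>2 / T)"
    using A B by linarith
  then show ?thesis by (simp only: T_def distrib_right)
qed

text \<open>C depends on m alone, as the later averaging over X requires. The near and far estimates
  meet at \<delta> = m^4 / 16.\<close>

lemma beta_kernel_gaussian:
  fixes m :: real
  assumes m: "0 < m"
  obtains C where "0 < C" and "\<And>x \<sigma> s \<epsilon> n t.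
    \<lbrakk>m \<le> x; x \<le> 1 - m; 0 < \<sigma>; \<sigma>\<^sup>2 = x * (1 - x); 0 \<le> s; s \<le> 1; 0 < \<epsilon>; n * \<epsilon>\<^sup>2 = 1; 2 / m \<le> n;
      0 < x + \<sigma> * \<epsilon> * t; x + \<sigma> * \<epsilon> * t < 1\<rbrakk> \<Longrightarrow>
    \<bar>beta_kernel n s x (x + \<sigma> * \<epsilon> * t) -
       exp (- t\<^sup>2 / 2) * (1 + \<epsilon> * ((1 - 2 * x) / (3 * \<sigma>) * t ^ 3 + (s - 1 + x) / \<sigma> * t))\<bar>
      \<le> C * (\<epsilon>\<^sup>2 / (1 + t\<^sup>2))"
proof -
  define \<delta> where "\<delta> = m ^ 4 / 16"
  have \<delta>: "0 < \<delta>" using m by (simp add: \<delta>_def)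
  define C1 where "C1 = 9 * (2 / m ^ 3)\<^sup>2 * 20 ^ 5"
  define C2 where "C2 = 2 * (exp (2 / m * ln (1 / m)) * 2 / \<delta> ^ 4) / m\<^sup>2 + 2 * 20 ^ 5 / (m * \<delta>\<^sup>2)"
  have pos: "0 < C1" "0 \<le> C2" using m \<delta> by (auto simp: C1_def C2_def)
  show ?thesis
  proof (rule that[of "max C1 C2"])
    fix x \<sigma> s \<epsilon> n t :: real
    assume asm: "m \<le> x" "x \<le> 1 - m" "0 < \<sigma>" "\<sigma>\<^sup>2 = x * (1 - x)" "0 \<le> s" "s \<le> 1" "0 < \<epsilon>"
      "n * \<epsilon>\<^sup>2 = 1" "2 / m \<le> n" "0 < x + \<sigma> * \<epsilon> * t" "x + \<sigma> * \<epsilon> * t < 1"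
    let ?D = "\<bar>beta_kernel n s x (x + \<sigma> * \<epsilon> * t) -
       exp (- t\<^sup>2 / 2) * (1 + \<epsilon> * ((1 - 2 * x) / (3 * \<sigma>) * t ^ 3 + (s - 1 + x) / \<sigma> * t))\<bar>"
    have "?D \<le> C1 * (\<epsilon>\<^sup>2 / (1 + t\<^sup>2)) \<or> ?D \<le> C2 * (\<epsilon>\<^sup>2 / (1 + t\<^sup>2))"
    proof (cases "\<bar>\<sigma> * \<epsilon> * t\<bar> \<le> m ^ 4 / 16")
      case True
      from beta_kernel_near[OF m asm(1-8) True] show ?thesis by (simp add: C1_def)
    next
      case False
      from beta_kernel_gaussian_far[OF m asm \<delta>] False show ?thesis by (simp add: C2_def \<delta>_def)
    qed
    moreover have "C1 * (\<epsilon>\<^sup>2 / (1 + t\<^sup>2)) \<le> max C1 C2 * (\<epsilon>\<^sup>2 / (1 + t\<^sup>2))"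
      "C2 * (\<epsilon>\<^sup>2 / (1 + t\<^sup>2)) \<le> max C1 C2 * (\<epsilon>\<^sup>2 / (1 + t\<^sup>2))"
      by (intro mult_right_mono; simp)+
    ultimately show "?D \<le> max C1 C2 * (\<epsilon>\<^sup>2 / (1 + t\<^sup>2))" by linarith
  qed (use pos in auto)
qed

section \<open>Edgeworth expansion of beta distribution functions\<close>

text \<open>The correction is \<epsilon> times the antiderivative of (c t^3 + d t) \<phi> t that
  vanishes at both infinities: t^3 \<phi> and t \<phi> are the derivatives of - (t^2 + 2) \<phi> and
  - \<phi>.\<close>

definition edgeworth :: "real \<Rightarrow> real \<Rightarrow> real \<Rightarrow> real \<Rightarrow> real" where
  "edgeworth c d \<epsilon> t = \<Phi> t - \<epsilon> * \<phi> t * (c * (t\<^sup>2 + 2) + d)"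

lemma has_real_derivative_edgeworth:
  "((\<lambda>t. sqrt (2 * pi) * edgeworth c d \<epsilon> t) has_real_derivative
     exp (- t\<^sup>2 / 2) * (1 + \<epsilon> * (c * t ^ 3 + d * t))) (at t)"
proof -
  have \<phi>: "sqrt (2 * pi) * \<phi> t = exp (- t\<^sup>2 / 2)" for t by (simp add: std_normal_density_def)
  have "sqrt (2 * pi) * edgeworth c d \<epsilon> t =
      sqrt (2 * pi) * \<Phi> t - \<epsilon> * ((sqrt (2 * pi) * \<phi> t) * (c * (t\<^sup>2 + 2) + d))" for t
    by (simp only: edgeworth_def right_diff_distrib mult_ac)
  then have "(\<lambda>t. sqrt (2 * pi) * edgeworth c d \<epsilon> t) =
      (\<lambda>t. sqrt (2 * pi) * \<Phi> t - \<epsilon> * (exp (- t\<^sup>2 / 2) * (c * (t\<^sup>2 + 2) + d)))"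
    unfolding \<phi> by (rule ext)
  moreover have "((\<lambda>t. exp (- t\<^sup>2 / 2) * (c * (t\<^sup>2 + 2) + d)) has_real_derivative
      - exp (- t\<^sup>2 / 2) * (c * t ^ 3 + d * t)) (at t)"
    by (auto intro!: derivative_eq_intros simp: algebra_simps power2_eq_square power3_eq_cube)
  then have "((\<lambda>t. sqrt (2 * pi) * \<Phi> t - \<epsilon> * (exp (- t\<^sup>2 / 2) * (c * (t\<^sup>2 + 2) + d))) has_real_derivative
      sqrt (2 * pi) * (\<phi> t * 1) - \<epsilon> * (- exp (- t\<^sup>2 / 2) * (c * t ^ 3 + d * t))) (at t)"
    by (intro DERIV_diff DERIV_cmult has_real_derivative_Phi DERIV_ident)
  ultimately show ?thesis
    by (simp add: std_normal_density_def algebra_simps)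
qed

text \<open>\<open>of_bool (0 < t)\<close> is the limit at the infinity on the side of t. The
  estimate serves at the images of \<theta> = 0 and \<theta> = 1, where |t| is at least of order 1 /
  \<epsilon> and the right-hand side is O(\<epsilon>^2).\<close>

lemma edgeworth_tail:
  fixes c d \<epsilon> M t :: real
  assumes cd: "\<bar>c\<bar> \<le> M" "\<bar>d\<bar> \<le> M" and \<epsilon>: "0 \<le> \<epsilon>" "\<epsilon> \<le> 1" and t: "t \<noteq> 0"
  shows "\<bar>edgeworth c d \<epsilon> t - of_bool (0 < t)\<bar> \<le> (1 + 3 * M) * 20 ^ 5 / t\<^sup>2"
proof -
  define T where "T = 1 + t\<^sup>2"
  have T: "1 \<le> T" by (simp add: T_def)
  have M: "0 \<le> M" using cd by linarith
  have "\<Phi> (- \<bar>t\<bar>) \<le> 20 ^ 5 / t\<^sup>2" using Phi_tail[of "- \<bar>t\<bar>"] t by simp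
  then have 1: "\<bar>\<Phi> t - of_bool (0 < t)\<bar> \<le> 20 ^ 5 / t\<^sup>2"
    using Phi_uminus[of t] std_normal.cdf_nonneg[of t] std_normal.cdf_bounded_prob[of t] t
    by (cases "0 < t") auto
  have "\<bar>c * (t\<^sup>2 + 2) + d * 1\<bar> \<le> M * (\<bar>t\<^sup>2 + 2\<bar> + \<bar>1\<bar>)" by (rule abs_add_mult_bound) fact+
  also have "\<dots> \<le> M * (3 * T ^ 4)"
  proof (intro mult_left_mono M)
    have "T ^ 1 \<le> T ^ 4" using T by (intro power_increasing) auto
    moreover have "\<bar>t\<^sup>2 + 2\<bar> + \<bar>1\<bar> \<le> 3 * T" by (simp add: T_def)
    ultimately show "\<bar>t\<^sup>2 + 2\<bar> + \<bar>1\<bar> \<le> 3 * T ^ 4" by simp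
  qed
  finally have 2: "\<bar>c * (t\<^sup>2 + 2) + d\<bar> \<le> M * (3 * T ^ 4)" by simp
  have "T ^ 5 = T ^ 4 * T" by (simp add: eval_nat_numeral)
  then have "(T ^ 4 * exp (- t\<^sup>2 / 2)) * T \<le> 20 ^ 5"
    using gaussian_poly_decay[of t] by (simp only: T_def mult_ac)
  then have "T ^ 4 * exp (- t\<^sup>2 / 2) \<le> 20 ^ 5 / T"
    by (rule pos_le_divide_eq[THEN iffD2, rotated]) (use T in auto)
  also have "\<dots> \<le> 20 ^ 5 / t\<^sup>2" using t
    by (intro divide_left_mono mult_pos_pos) (auto simp: T_def add_pos_nonneg)
  finally have 3: "T ^ 4 * exp (- t\<^sup>2 / 2) \<le> 20 ^ 5 / t\<^sup>2" .
  have "\<phi> t \<le> exp (- t\<^sup>2 / 2)"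
    unfolding std_normal_density_def using pi_ge_two by (intro mult_left_le_one_le) auto
  then have "\<phi> t * \<bar>c * (t\<^sup>2 + 2) + d\<bar> \<le> exp (- t\<^sup>2 / 2) * (M * (3 * T ^ 4))"
    using 2 by (intro mult_mono) auto
  also have "\<dots> = 3 * M * (T ^ 4 * exp (- t\<^sup>2 / 2))" by simp
  also have "\<dots> \<le> 3 * M * (20 ^ 5 / t\<^sup>2)" using 3 M by (intro mult_left_mono) auto
  finally have "\<epsilon> * (\<phi> t * \<bar>c * (t\<^sup>2 + 2) + d\<bar>) \<le> 1 * (3 * M * (20 ^ 5 / t\<^sup>2))"
    by (rule mult_mono[OF \<epsilon>(2)]) auto
  then have "\<bar>\<epsilon> * \<phi> t * (c * (t\<^sup>2 + 2) + d)\<bar> \<le> 3 * M * (20 ^ 5 / t\<^sup>2)"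
    using \<epsilon> by (simp add: abs_mult mult.assoc)
  with 1 have "\<bar>edgeworth c d \<epsilon> t - of_bool (0 < t)\<bar> \<le> 20 ^ 5 / t\<^sup>2 + 3 * M * (20 ^ 5 / t\<^sup>2)"
    unfolding edgeworth_def by linarith
  then show ?thesis by (simp add: distrib_right add_divide_distrib)
qed

text \<open>A + D and A - D are both nondecreasing. Derivatives are taken only inside the interval,
  because that of a beta distribution function is given by its kernel only for 0 < \<theta> < 1;
  continuity carries the comparison to the ends.\<close>

lemma abs_diff_le_of_deriv_bound:
  fixes D A :: "real \<Rightarrow> real"
  assumes "a \<le> b" and cont: "continuous_on {a..b} D" "continuous_on {a..b} A"
    and D: "\<And>y. a < y \<Longrightarrow> y < b \<Longrightarrow> (D has_real_derivative D' y) (at y)"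
    and A: "\<And>y. a < y \<Longrightarrow> y < b \<Longrightarrow> (A has_real_derivative A' y) (at y)"
    and le: "\<And>y. a < y \<Longrightarrow> y < b \<Longrightarrow> \<bar>D' y\<bar> \<le> A' y"
  shows "\<bar>D b - D a\<bar> \<le> A b - A a"
proof -
  have "A a + k * D a \<le> A b + k * D b" if k: "\<bar>k\<bar> = 1" for k
  proof (rule DERIV_nonneg_imp_increasing_open[OF \<open>a \<le> b\<close>])
    fix y assume y: "a < y" "y < b"
    have "0 \<le> A' y + k * D' y" using le[OF y] k by (auto simp: abs_if split: if_splits)
    moreover have "((\<lambda>y. A y + k * D y) has_real_derivative A' y + k * D' y) (at y)"
      by (intro DERIV_add DERIV_cmult D A y)
    ultimately show "\<exists>d. ((\<lambda>y. A y + k * D y) has_real_derivative d) (at y) \<and> 0 \<le> d" by blast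
  qed (intro continuous_intros cont)
  from this[of 1] this[of "-1"] show ?thesis by auto
qed

text \<open>The rescaled function N = F / (Z \<sigma> \<epsilon>) has the kernel as derivative in t,
  so N - E varies by at most C1 \<pi> \<epsilon>^2, the total increase of the arctangent envelope.
  At the ends, E is O(\<epsilon>^2) and sqrt (2 \<pi>) + O(\<epsilon>^2), which determines N 1 to
  this accuracy. Since N \<theta> = F \<theta> * N 1, the unknown Z is thereby eliminated.\<close>

lemma beta_cdf_edgeworth:
  fixes m :: real
  assumes m: "0 < m"
  obtains C where "0 < C" and "\<And>F Z x \<sigma> s \<epsilon> n \<theta>.
    \<lbrakk>m \<le> x; x \<le> 1 - m; 0 < \<sigma>; \<sigma>\<^sup>2 = x * (1 - x); 0 \<le> s; s \<le> 1; 0 < \<epsilon>; n * \<epsilon>\<^sup>2 = 1; 2 / m \<le> n;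
      continuous_on {0..1} F; F 0 = 0; F 1 = 1;
      \<And>\<theta>. 0 < \<theta> \<Longrightarrow> \<theta> < 1 \<Longrightarrow> (F has_real_derivative Z * beta_kernel n s x \<theta>) (at \<theta>);
      0 \<le> \<theta>; \<theta> \<le> 1; 0 \<le> F \<theta>; F \<theta> \<le> 1\<rbrakk> \<Longrightarrow>
    \<bar>F \<theta> - edgeworth ((1 - 2 * x) / (3 * \<sigma>)) ((s - 1 + x) / \<sigma>) \<epsilon> ((\<theta> - x) / (\<sigma> * \<epsilon>))\<bar> \<le> C * \<epsilon>\<^sup>2"
proof -
  obtain C1 where C1: "0 < C1" and approx: "\<And>x \<sigma> s \<epsilon> n t.
    \<lbrakk>m \<le> x; x \<le> 1 - m; 0 < \<sigma>; \<sigma>\<^sup>2 = x * (1 - x); 0 \<le> s; s \<le> 1; 0 < \<epsilon>; n * \<epsilon>\<^sup>2 = 1; 2 / m \<le> n;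
      0 < x + \<sigma> * \<epsilon> * t; x + \<sigma> * \<epsilon> * t < 1\<rbrakk> \<Longrightarrow>
    \<bar>beta_kernel n s x (x + \<sigma> * \<epsilon> * t) -
       exp (- t\<^sup>2 / 2) * (1 + \<epsilon> * ((1 - 2 * x) / (3 * \<sigma>) * t ^ 3 + (s - 1 + x) / \<sigma> * t))\<bar>
      \<le> C1 * (\<epsilon>\<^sup>2 / (1 + t\<^sup>2))"
    using beta_kernel_gaussian[OF m] by blast
  define C2 where "C2 = C1 * pi"
  define C3 where "C3 = (1 + 3 * (1 / m)) * 20 ^ 5 / m\<^sup>2"
  have C23: "0 < C2" "0 < C3" using C1 m by (auto simp: C2_def C3_def intro!: divide_pos_pos mult_pos_pos add_pos_pos)
  show ?thesis
  proof (rule that[of "2 * C2 + 3 * C3"])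
    fix F :: "real \<Rightarrow> real" and Z x \<sigma> s \<epsilon> n \<theta> :: real
    assume x: "m \<le> x" "x \<le> 1 - m" and \<sigma>: "0 < \<sigma>" "\<sigma>\<^sup>2 = x * (1 - x)" and s: "0 \<le> s" "s \<le> 1"
      and \<epsilon>: "0 < \<epsilon>" "n * \<epsilon>\<^sup>2 = 1" and n: "2 / m \<le> n"
      and F: "continuous_on {0..1} F" "F 0 = 0" "F 1 = 1"
      and F': "\<And>\<theta>. 0 < \<theta> \<Longrightarrow> \<theta> < 1 \<Longrightarrow> (F has_real_derivative Z * beta_kernel n s x \<theta>) (at \<theta>)"
      and \<theta>: "0 \<le> \<theta>" "\<theta> \<le> 1" "0 \<le> F \<theta>" "F \<theta> \<le> 1"
    define c where "c = (1 - 2 * x) / (3 * \<sigma>)"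
    define d where "d = (s - 1 + x) / \<sigma>"
    define t where "t = (\<lambda>\<theta>. (\<theta> - x) / (\<sigma> * \<epsilon>))"
    define E where "E = (\<lambda>\<theta>. sqrt (2 * pi) * edgeworth c d \<epsilon> (t \<theta>))"
    note b = variance_bounds[OF m x \<sigma>]
    have cd: "\<bar>c\<bar> \<le> 1 / m" "\<bar>d\<bar> \<le> 1 / m"
      unfolding c_def d_def by (rule edgeworth_coefficient_bounds[OF m x \<sigma> s])+
    have "2 \<le> 2 / m" using m x by (simp add: field_simps)
    then have "1 \<le> n" using n by linarith
    then have "\<epsilon>\<^sup>2 \<le> 1" using mult_right_mono[of 1 n "\<epsilon>\<^sup>2"] \<epsilon> by simp
    then have e1: "\<epsilon> \<le> 1" using \<epsilon>(1) by (simp add: power2_le_iff_abs_le abs_le_square_iff power_le_one_iff)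
    have se: "0 < \<sigma> * \<epsilon>" using \<sigma> \<epsilon> by simp
    have t': "(t has_real_derivative 1 / (\<sigma> * \<epsilon>)) (at \<theta>)" for \<theta>
      unfolding t_def using se by (auto intro!: derivative_eq_intros simp: field_simps)
    have E': "(E has_real_derivative exp (- (t \<theta>)\<^sup>2 / 2) * (1 + \<epsilon> * (c * t \<theta> ^ 3 + d * t \<theta>)) * (1 / (\<sigma> * \<epsilon>))) (at \<theta>)" for \<theta>
      unfolding E_def using DERIV_chain2[OF has_real_derivative_edgeworth t'] .
    have contE: "continuous_on A E" for A
      by (rule DERIV_continuous_on[OF has_field_derivative_at_within[OF E']])
    have A': "((\<lambda>\<theta>. C1 * \<epsilon>\<^sup>2 * arctan (t \<theta>)) has_real_derivative C1 * \<epsilon>\<^sup>2 * (1 / (1 + (t \<theta>)\<^sup>2) * (1 / (\<sigma> * \<epsilon>)))) (at \<theta>)" for \<theta>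
      using DERIV_cmult[OF DERIV_chain2[OF DERIV_arctan t']] by (simp add: inverse_eq_divide)
    have "Z \<noteq> 0"
    proof
      assume "Z = 0"
      then have "(F has_real_derivative 0) (at y)" if "0 < y" "y < 1" for y
        using F'[OF that] by simp
      then have "F 1 = F 0" using DERIV_isconst_end[OF _ F(1)] by simp
      then show False using F by simp
    qed
    define N where "N = (\<lambda>\<theta>. F \<theta> / (Z * (\<sigma> * \<epsilon>)))"
    have N': "(N has_real_derivative beta_kernel n s x \<theta> * (1 / (\<sigma> * \<epsilon>))) (at \<theta>)" if "0 < \<theta>" "\<theta> < 1" for \<theta>
      unfolding N_def using DERIV_cdivide[OF F'[OF that], of "Z * (\<sigma> * \<epsilon>)"] \<open>Z \<noteq> 0\<close> by simp
    have close: "\<bar>(N y - E y) - (N 0 - E 0)\<bar> \<le> C2 * \<epsilon>\<^sup>2" if y: "0 \<le> y" "y \<le> 1" for y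
    proof -
      have "\<bar>(N y - E y) - (N 0 - E 0)\<bar> \<le> C1 * \<epsilon>\<^sup>2 * arctan (t y) - C1 * \<epsilon>\<^sup>2 * arctan (t 0)"
      proof (rule abs_diff_le_of_deriv_bound[OF y(1), of "\<lambda>y. N y - E y" "\<lambda>y. C1 * \<epsilon>\<^sup>2 * arctan (t y)"])
        have "continuous_on {0..y} F" by (rule continuous_on_subset[OF F(1)]) (use y in auto)
        then show "continuous_on {0..y} (\<lambda>y. N y - E y)"
          unfolding N_def using se \<open>Z \<noteq> 0\<close> contE by (intro continuous_intros) auto
        show "continuous_on {0..y} (\<lambda>y. C1 * \<epsilon>\<^sup>2 * arctan (t y))"
          by (rule DERIV_continuous_on[OF has_field_derivative_at_within[OF A']])
        fix w assume w: "0 < w" "w < y"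
        then have w1: "0 < w" "w < 1" using y by auto
        let ?k = "beta_kernel n s x w" and ?e = "exp (- (t w)\<^sup>2 / 2) * (1 + \<epsilon> * (c * t w ^ 3 + d * t w))"
        show "((\<lambda>y. N y - E y) has_real_derivative ?k * (1 / (\<sigma> * \<epsilon>)) - ?e * (1 / (\<sigma> * \<epsilon>))) (at w)"
          by (intro DERIV_diff N' E' w1)
        show "((\<lambda>y. C1 * \<epsilon>\<^sup>2 * arctan (t y)) has_real_derivative C1 * \<epsilon>\<^sup>2 * (1 / (1 + (t w)\<^sup>2) * (1 / (\<sigma> * \<epsilon>)))) (at w)"
          by (rule A')
        have "x + \<sigma> * \<epsilon> * t w = w" using \<sigma>(1) \<epsilon>(1) by (simp add: t_def)
        then have "\<bar>?k - ?e\<bar> \<le> C1 * (\<epsilon>\<^sup>2 / (1 + (t w)\<^sup>2))"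
          using approx[OF x \<sigma> s \<epsilon> n, of "t w"] w1 by (simp add: c_def d_def)
        then have "\<bar>?k - ?e\<bar> * (1 / (\<sigma> * \<epsilon>)) \<le> C1 * (\<epsilon>\<^sup>2 / (1 + (t w)\<^sup>2)) * (1 / (\<sigma> * \<epsilon>))"
          using se by (intro mult_right_mono) auto
        moreover have "\<bar>?k * (1 / (\<sigma> * \<epsilon>)) - ?e * (1 / (\<sigma> * \<epsilon>))\<bar> = \<bar>?k - ?e\<bar> * (1 / (\<sigma> * \<epsilon>))"
          using se by (simp only: abs_mult flip: left_diff_distrib) simp
        ultimately show "\<bar>?k * (1 / (\<sigma> * \<epsilon>)) - ?e * (1 / (\<sigma> * \<epsilon>))\<bar> \<le> C1 * \<epsilon>\<^sup>2 * (1 / (1 + (t w)\<^sup>2) * (1 / (\<sigma> * \<epsilon>)))"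
          by (simp add: mult_ac)
      qed
      also have "\<dots> = C1 * \<epsilon>\<^sup>2 * (arctan (t y) - arctan (t 0))" by (simp add: right_diff_distrib)
      also have "\<dots> \<le> C1 * \<epsilon>\<^sup>2 * pi"
        using C1 arctan_bounded[of "t y"] arctan_bounded[of "t 0"] by (intro mult_left_mono) auto
      finally show ?thesis by (simp add: C2_def mult_ac)
    qed
    have tail: "\<bar>edgeworth c d \<epsilon> (t y) - of_bool (0 < t y)\<bar> \<le> C3 * \<epsilon>\<^sup>2" if y: "m \<le> \<bar>y - x\<bar>" for y
    proof -
      have "m \<le> \<bar>t y\<bar> * (\<sigma> * \<epsilon>)" using y \<sigma>(1) \<epsilon>(1) by (simp add: t_def abs_mult)
      also have "\<dots> \<le> \<bar>t y\<bar> * (1 * \<epsilon>)" using b \<epsilon> by (intro mult_left_mono mult_right_mono) auto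
      finally have *: "m \<le> \<bar>t y\<bar> * \<epsilon>" by simp
      then have "m\<^sup>2 \<le> (\<bar>t y\<bar> * \<epsilon>)\<^sup>2" using m by (intro power_mono) auto
      then have **: "m\<^sup>2 / \<epsilon>\<^sup>2 \<le> (t y)\<^sup>2" using \<epsilon> by (simp add: power_mult_distrib field_simps)
      have "t y \<noteq> 0" using * m by auto
      from edgeworth_tail[OF cd less_imp_le[OF \<epsilon>(1)] e1 this]
      have "\<bar>edgeworth c d \<epsilon> (t y) - of_bool (0 < t y)\<bar> \<le> (1 + 3 * (1 / m)) * 20 ^ 5 / (t y)\<^sup>2" .
      also have "\<dots> \<le> (1 + 3 * (1 / m)) * 20 ^ 5 / (m\<^sup>2 / \<epsilon>\<^sup>2)"
        using ** m \<epsilon> \<open>t y \<noteq> 0\<close> by (intro divide_left_mono mult_pos_pos) auto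
      finally show ?thesis by (simp add: C3_def)
    qed
    define S where "S = sqrt (2 * pi)"
    have S: "1 \<le> S" using pi_ge_two by (simp add: S_def)
    have scale: "\<bar>S * a\<bar> \<le> S * B" if "\<bar>a\<bar> \<le> B" for a B
      using that S by (simp add: abs_mult)
    \<comment> \<open>The signs of t at the two ends decide which limit, 0 or 1, \<open>tail\<close>
      delivers there.\<close>
    have "\<not> 0 < t 0" "0 < t 1" using x m se by (auto simp: t_def field_simps)
    with tail[of 0] tail[of 1] x m have "\<bar>edgeworth c d \<epsilon> (t 0)\<bar> \<le> C3 * \<epsilon>\<^sup>2" "\<bar>edgeworth c d \<epsilon> (t 1) - 1\<bar> \<le> C3 * \<epsilon>\<^sup>2"
      by auto
    from this[THEN scale] have E01: "\<bar>E 0\<bar> \<le> S * (C3 * \<epsilon>\<^sup>2)" "\<bar>E 1 - S\<bar> \<le> S * (C3 * \<epsilon>\<^sup>2)"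
      by (simp_all add: E_def S_def right_diff_distrib)
    have N0: "N 0 = 0" "N \<theta> = F \<theta> * N 1" using F by (simp_all add: N_def)
    have "\<bar>N 1 - S\<bar> \<le> C2 * \<epsilon>\<^sup>2 + 2 * (S * (C3 * \<epsilon>\<^sup>2))" using close[of 1] E01 N0 by auto
    then have "F \<theta> * \<bar>N 1 - S\<bar> \<le> 1 * (C2 * \<epsilon>\<^sup>2 + 2 * (S * (C3 * \<epsilon>\<^sup>2)))"
      using \<theta> by (intro mult_mono) auto
    then have "\<bar>F \<theta> * N 1 - S * F \<theta>\<bar> \<le> C2 * \<epsilon>\<^sup>2 + 2 * (S * (C3 * \<epsilon>\<^sup>2))"
      using \<theta> by (simp add: abs_mult mult.commute[of S] flip: right_diff_distrib)
    moreover have "\<bar>N \<theta> - E \<theta>\<bar> \<le> C2 * \<epsilon>\<^sup>2 + S * (C3 * \<epsilon>\<^sup>2)" using close[OF \<theta>(1,2)] E01 N0(1) by auto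
    ultimately have "\<bar>S * F \<theta> - E \<theta>\<bar> \<le> 2 * (C2 * \<epsilon>\<^sup>2) + 3 * (S * (C3 * \<epsilon>\<^sup>2))"
      unfolding N0(2) by linarith
    also have "\<dots> \<le> S * ((2 * C2 + 3 * C3) * \<epsilon>\<^sup>2)"
      using mult_right_mono[OF S, of "2 * (C2 * \<epsilon>\<^sup>2)"] C23 by (simp add: algebra_simps)
    finally have "S * \<bar>F \<theta> - edgeworth c d \<epsilon> (t \<theta>)\<bar> \<le> S * ((2 * C2 + 3 * C3) * \<epsilon>\<^sup>2)"
      using S by (simp add: E_def abs_mult flip: S_def right_diff_distrib)
    then have "\<bar>F \<theta> - edgeworth c d \<epsilon> (t \<theta>)\<bar> \<le> (2 * C2 + 3 * C3) * \<epsilon>\<^sup>2" using S by simp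
    then show "\<bar>F \<theta> - edgeworth ((1 - 2 * x) / (3 * \<sigma>)) ((s - 1 + x) / \<sigma>) \<epsilon> ((\<theta> - x) / (\<sigma> * \<epsilon>))\<bar>
        \<le> (2 * C2 + 3 * C3) * \<epsilon>\<^sup>2"
      by (simp add: c_def d_def t_def)
  qed (use C23 in auto)
qed

section \<open>Inversion of the Edgeworth expansion\<close>

lemma lipschitz_of_deriv_bound:
  fixes f :: "real \<Rightarrow> real"
  assumes "\<And>y. (f has_real_derivative f' y) (at y)" "\<And>y. \<bar>f' y\<bar> \<le> B"
  shows "\<bar>f t - f z\<bar> \<le> B * \<bar>t - z\<bar>"
  using field_differentiable_bound[of UNIV f f' B t z] assms by simp

lemma has_real_derivative_phi: "(\<phi> has_real_derivative - t * \<phi> t) (at t)"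
proof -
  have "((\<lambda>t. 1 / sqrt (2 * pi) * exp (- t\<^sup>2 / 2)) has_real_derivative
      1 / sqrt (2 * pi) * (exp (- t\<^sup>2 / 2) * (- t))) (at t)"
    by (intro DERIV_cmult) (auto intro!: derivative_eq_intros)
  then show ?thesis by (simp add: std_normal_density_def[abs_def] mult_ac)
qed

lemma phi_le_exp: "0 \<le> \<phi> t" "\<phi> t \<le> exp (- t\<^sup>2 / 2)"
proof -
  have "1 / sqrt (2 * pi) \<le> 1" using pi_ge_two by simp
  from mult_right_mono[OF this, of "exp (- t\<^sup>2 / 2)"]
  show "\<phi> t \<le> exp (- t\<^sup>2 / 2)" by (simp add: std_normal_density_def)
qed simp

lemma phi_poly_bound:
  assumes "0 \<le> a" "a \<le> (1 + t\<^sup>2) ^ 5"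
  shows "a * \<phi> t \<le> 20 ^ 5"
proof -
  have "a * \<phi> t \<le> (1 + t\<^sup>2) ^ 5 * exp (- t\<^sup>2 / 2)" using assms phi_le_exp by (intro mult_mono) auto
  also have "\<dots> \<le> 20 ^ 5" by (rule gaussian_poly_decay)
  finally show ?thesis .
qed

lemma abs_cube_le: "\<bar>t\<bar> \<le> (1 + t\<^sup>2) ^ 5" "\<bar>t\<bar> ^ 3 \<le> (1 + t\<^sup>2) ^ 5" "t\<^sup>2 + 2 \<le> 2 * (1 + t\<^sup>2) ^ 5" for t :: real
proof -
  have 1: "(1 + t\<^sup>2) ^ 2 \<le> (1 + t\<^sup>2) ^ 5" "(1 + t\<^sup>2) ^ 1 \<le> (1 + t\<^sup>2) ^ 5"
    by (intro power_increasing; simp)+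
  show "\<bar>t\<bar> \<le> (1 + t\<^sup>2) ^ 5" "\<bar>t\<bar> ^ 3 \<le> (1 + t\<^sup>2) ^ 5"
    using abs_cube_bound[of t] 1(1) zero_le_power[of "\<bar>t\<bar>" 3] by linarith+
  show "t\<^sup>2 + 2 \<le> 2 * (1 + t\<^sup>2) ^ 5" using 1(2)[unfolded power_one_right] zero_le_power2[of t] by linarith
qed

lemma phi_lipschitz: "\<bar>\<phi> t - \<phi> z\<bar> \<le> 20 ^ 5 * \<bar>t - z\<bar>"
proof (rule lipschitz_of_deriv_bound)
  show "(\<phi> has_real_derivative - y * \<phi> y) (at y)" for y by (rule has_real_derivative_phi)
  show "\<bar>- y * \<phi> y\<bar> \<le> 20 ^ 5" for y
    using phi_poly_bound[OF _ abs_cube_le(1)[of y]] phi_le_exp(1)[of y] by (simp add: abs_mult)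
qed

lemma phi_quadratic_lipschitz: "\<bar>\<phi> t * (t\<^sup>2 + 2) - \<phi> z * (z\<^sup>2 + 2)\<bar> \<le> 20 ^ 5 * \<bar>t - z\<bar>"
proof (rule lipschitz_of_deriv_bound)
  show "((\<lambda>y. \<phi> y * (y\<^sup>2 + 2)) has_real_derivative - (y ^ 3) * \<phi> y) (at y)" for y
    by (rule derivative_eq_intros has_real_derivative_phi refl)+
      (simp add: algebra_simps power2_eq_square power3_eq_cube)
  show "\<bar>- (y ^ 3) * \<phi> y\<bar> \<le> 20 ^ 5" for y
    using phi_poly_bound[OF _ abs_cube_le(2)[of y]] phi_le_exp(1)[of y] by (simp add: abs_mult power_abs)
qed

text \<open>The derivative 2 * 20^5 (t - z) of the envelope dominates that of the remainder, \<phi>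
  t - \<phi> z, by the Lipschitz bound on \<phi>; this gives the sign condition for both choices of
  k.\<close>

lemma Phi_taylor: "\<bar>\<Phi> t - \<Phi> z - \<phi> z * (t - z)\<bar> \<le> 20 ^ 5 * (t - z)\<^sup>2"
proof -
  have "0 \<le> 20 ^ 5 * (t - z)\<^sup>2 + k * (\<Phi> t - \<Phi> z - \<phi> z * (t - z))" if k: "\<bar>k\<bar> = 1" for k
  proof -
    have "20 ^ 5 * (z - z)\<^sup>2 + k * (\<Phi> z - \<Phi> z - \<phi> z * (z - z)) \<le>
        20 ^ 5 * (t - z)\<^sup>2 + k * (\<Phi> t - \<Phi> z - \<phi> z * (t - z))"
    proof (rule min_at_sign_change_of_deriv[where a = "min z t" and b = "max z t" and c = z and x = t
          and h = "\<lambda>t. 20 ^ 5 * (t - z)\<^sup>2 + k * (\<Phi> t - \<Phi> z - \<phi> z * (t - z))"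
          and h' = "\<lambda>t. 2 * 20 ^ 5 * (t - z) + k * (\<phi> t - \<phi> z)"])
      fix y
      show "((\<lambda>t. 20 ^ 5 * (t - z)\<^sup>2 + k * (\<Phi> t - \<Phi> z - \<phi> z * (t - z))) has_real_derivative
          2 * 20 ^ 5 * (y - z) + k * (\<phi> y - \<phi> z)) (at y)"
        by (auto intro!: derivative_eq_intros)
      have "\<bar>k * (\<phi> y - \<phi> z)\<bar> \<le> 20 ^ 5 * \<bar>y - z\<bar>" using phi_lipschitz[of y z] k by (simp add: abs_mult)
      then have "\<bar>y - z\<bar> * \<bar>k * (\<phi> y - \<phi> z)\<bar> \<le> \<bar>y - z\<bar> * (20 ^ 5 * \<bar>y - z\<bar>)" by (intro mult_left_mono) auto
      also have "\<dots> = 20 ^ 5 * (y - z)\<^sup>2" by (simp only: power2_eq_square mult.left_commute abs_mult_self_eq)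
      finally have "- ((y - z) * (k * (\<phi> y - \<phi> z))) \<le> 2 * (20 ^ 5 * (y - z)\<^sup>2)"
        using zero_le_power2[of "y - z"] by (simp only: abs_mult[symmetric])
      then show "0 \<le> (y - z) * (2 * 20 ^ 5 * (y - z) + k * (\<phi> y - \<phi> z))"
        by (simp add: power2_eq_square algebra_simps)
    qed auto
    then show ?thesis by simp
  qed
  from this[of 1] this[of "-1"] show ?thesis by auto
qed

text \<open>The number r = \<phi> (|z| + 1) bounds the density from below on [z - 1, z + 1] and
  serves twice: as a slope there, and as a threshold, since by monotonicity a t outside this window
  would move \<Phi> by at least r.\<close>

lemma Phi_local_inverse:
  obtains r where "0 < r" "\<And>t. \<bar>\<Phi> t - \<Phi> z\<bar> < r \<Longrightarrow> r * \<bar>t - z\<bar> \<le> \<bar>\<Phi> t - \<Phi> z\<bar>"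
proof (rule that[of "\<phi> (\<bar>z\<bar> + 1)"])
  show r0: "0 < \<phi> (\<bar>z\<bar> + 1)" by (simp add: normal_density_pos)
  let ?r = "\<phi> (\<bar>z\<bar> + 1)"
  have ge: "?r \<le> \<phi> s" if "\<bar>s - z\<bar> \<le> 1" for s
  proof -
    have "s\<^sup>2 \<le> (\<bar>z\<bar> + 1)\<^sup>2" using that by (intro abs_le_square_iff[THEN iffD1]) auto
    then show ?thesis by (simp add: std_normal_density_def divide_right_mono)
  qed
  have incr: "?r * (b - a) \<le> \<Phi> b - \<Phi> a" if "a \<le> b" "\<bar>a - z\<bar> \<le> 1" "\<bar>b - z\<bar> \<le> 1" for a b
  proof (cases "a = b")
    case False
    then have "a < b" using that by simp
    obtain \<xi> where \<xi>: "a < \<xi>" "\<xi> < b" "\<Phi> b - \<Phi> a = (b - a) * \<phi> \<xi>"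
      using MVT2[OF \<open>a < b\<close>, of \<Phi> \<phi>] has_real_derivative_Phi[OF DERIV_ident] by (metis mult.right_neutral)
    have "\<bar>\<xi> - z\<bar> \<le> 1" using \<xi> that by auto
    then have "?r * (b - a) \<le> \<phi> \<xi> * (b - a)" using ge \<open>a < b\<close> by (intro mult_right_mono) auto
    then show ?thesis using \<xi> by (simp add: mult.commute)
  qed simp
  fix t assume t: "\<bar>\<Phi> t - \<Phi> z\<bar> < ?r"
  have "\<bar>t - z\<bar> \<le> 1"
  proof (rule ccontr)
    assume "\<not> \<bar>t - z\<bar> \<le> 1"
    then consider "z + 1 \<le> t" | "t \<le> z - 1" by linarith
    then have "?r \<le> \<bar>\<Phi> t - \<Phi> z\<bar>"
    proof cases
      case 1
      with incr[of z "z + 1"] std_normal.cdf_nondecreasing[OF 1] show ?thesis by simp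
    next
      case 2
      with incr[of "z - 1" z] std_normal.cdf_nondecreasing[OF 2] show ?thesis by simp
    qed
    with t show False by simp
  qed
  then show "?r * \<bar>t - z\<bar> \<le> \<bar>\<Phi> t - \<Phi> z\<bar>"
    using incr[of z t] incr[of t z] by (cases "z \<le> t") auto
qed

text \<open>Two rounds. The correction is bounded uniformly in t, so the hypothesis forces \<Phi> t
  - \<Phi> z = O(\<epsilon>), and the local inverse gives t - z = O(\<epsilon>). With this, Taylor's
  formula for \<Phi> and the Lipschitz bounds for the correction P leave errors O(\<epsilon>^2)
  only. The constants depend on z, M and C, but not on c and d.\<close>

lemma edgeworth_inverse:
  fixes z M C :: real
  assumes M: "0 \<le> M" and C: "0 \<le> C"
  obtains K \<epsilon>0 where "0 < K" "0 < \<epsilon>0" "\<epsilon>0 \<le> 1" "\<And>c d \<epsilon> t.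
    \<lbrakk>\<bar>c\<bar> \<le> M; \<bar>d\<bar> \<le> M; 0 < \<epsilon>; \<epsilon> \<le> \<epsilon>0; \<bar>edgeworth c d \<epsilon> t - \<Phi> z\<bar> \<le> C * \<epsilon>\<^sup>2\<rbrakk> \<Longrightarrow>
    \<bar>t - (z + \<epsilon> * (c * (z\<^sup>2 + 2) + d))\<bar> \<le> K * \<epsilon>\<^sup>2"
proof -
  obtain r where r: "0 < r" "\<And>t. \<bar>\<Phi> t - \<Phi> z\<bar> < r \<Longrightarrow> r * \<bar>t - z\<bar> \<le> \<bar>\<Phi> t - \<Phi> z\<bar>"
    using Phi_local_inverse[of z] by blast
  define L where "L = (20 ^ 5 :: real)"
  have L: "0 < L" by (simp add: L_def)
  define K1 where "K1 = C + M * (3 * L) + 1"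
  define K2 where "K2 = K1 / r"
  define K where "K = (C + L * K2\<^sup>2 + M * (2 * (L * K2))) / \<phi> z + 1"
  \<comment> \<open>The factor 2 yields the strict inequality \<open>\<epsilon> * K1 < r\<close>
    under which \<open>Phi_local_inverse\<close> applies.\<close>
  define \<epsilon>0 where "\<epsilon>0 = min 1 (r / (2 * K1))"
  have K1: "0 < K1" using C M L by (simp add: K1_def add_nonneg_pos)
  have K2: "0 < K2" using K1 r by (simp add: K2_def)
  have phi0: "0 < \<phi> z" by (simp add: normal_density_pos)
  show ?thesis
  proof (rule that[of K \<epsilon>0])
    have "0 \<le> (C + L * K2\<^sup>2 + M * (2 * (L * K2))) / \<phi> z"
      using C L M K2 phi0 by (intro divide_nonneg_nonneg add_nonneg_nonneg mult_nonneg_nonneg) auto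
    then show "0 < K" by (simp add: K_def)
    show "0 < \<epsilon>0" using r K1 by (simp add: \<epsilon>0_def)
    show "\<epsilon>0 \<le> 1" by (simp add: \<epsilon>0_def)
    fix c d \<epsilon> t
    assume cd: "\<bar>c\<bar> \<le> M" "\<bar>d\<bar> \<le> M" and \<epsilon>: "0 < \<epsilon>" "\<epsilon> \<le> \<epsilon>0"
      and E: "\<bar>edgeworth c d \<epsilon> t - \<Phi> z\<bar> \<le> C * \<epsilon>\<^sup>2"
    have e1: "\<epsilon> \<le> 1" "\<epsilon> * K1 < r" using \<epsilon> K1 r by (auto simp: \<epsilon>0_def field_simps)
    have e2: "\<epsilon>\<^sup>2 \<le> \<epsilon>" using \<epsilon>(1) e1(1) by (simp add: power2_eq_square mult_left_le)
    define P where "P = (\<lambda>t. \<phi> t * (c * (t\<^sup>2 + 2) + d))"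
    have P: "P t = c * (\<phi> t * (t\<^sup>2 + 2)) + d * \<phi> t" for t by (simp add: P_def algebra_simps)
    have "\<bar>P t\<bar> \<le> M * (\<bar>\<phi> t * (t\<^sup>2 + 2)\<bar> + \<bar>\<phi> t\<bar>)"
      unfolding P by (rule abs_add_mult_bound[OF cd])
    also have "\<dots> \<le> M * (3 * L)"
    proof (intro mult_left_mono M)
      have "(t\<^sup>2 + 2) / 2 * \<phi> t \<le> L" unfolding L_def using abs_cube_le(3)[of t] by (intro phi_poly_bound) auto
      moreover have "1 * \<phi> t \<le> L" unfolding L_def by (intro phi_poly_bound) auto
      ultimately show "\<bar>\<phi> t * (t\<^sup>2 + 2)\<bar> + \<bar>\<phi> t\<bar> \<le> 3 * L" using phi_le_exp(1)[of t] by (simp add: abs_mult mult.commute)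
    qed
    finally have Pt: "\<bar>P t\<bar> \<le> M * (3 * L)" .
    have ew: "edgeworth c d \<epsilon> t = \<Phi> t - \<epsilon> * P t" by (simp add: edgeworth_def P_def mult.assoc)
    have "\<bar>\<Phi> t - \<Phi> z\<bar> \<le> C * \<epsilon>\<^sup>2 + \<epsilon> * \<bar>P t\<bar>"
      using E abs_triangle_ineq[of "edgeworth c d \<epsilon> t - \<Phi> z" "\<epsilon> * P t"] \<epsilon>(1) by (simp add: ew abs_mult)
    also have "\<dots> \<le> C * \<epsilon> + \<epsilon> * (M * (3 * L))"
      using e2 C Pt \<epsilon>(1) by (intro add_mono mult_left_mono) auto
    also have "\<dots> \<le> \<epsilon> * K1" using \<epsilon>(1) by (simp add: K1_def algebra_simps)
    finally have d1: "\<bar>\<Phi> t - \<Phi> z\<bar> \<le> \<epsilon> * K1" .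
    with e1(2) have "r * \<bar>t - z\<bar> \<le> \<epsilon> * K1" using r(2)[of t] by linarith
    then have tz: "\<bar>t - z\<bar> \<le> \<epsilon> * K2" using r(1) by (simp add: K2_def field_simps)
    then have "\<bar>t - z\<bar>\<^sup>2 \<le> (\<epsilon> * K2)\<^sup>2" by (intro power_mono) auto
    then have tz2: "(t - z)\<^sup>2 \<le> \<epsilon>\<^sup>2 * K2\<^sup>2" by (simp add: power_mult_distrib)
    have "\<bar>\<Phi> t - \<Phi> z - \<phi> z * (t - z)\<bar> \<le> L * (t - z)\<^sup>2" unfolding L_def by (rule Phi_taylor)
    also have "\<dots> \<le> L * (\<epsilon>\<^sup>2 * K2\<^sup>2)" using tz2 L by (intro mult_left_mono) auto
    finally have A: "\<bar>\<Phi> t - \<Phi> z - \<phi> z * (t - z)\<bar> \<le> L * (\<epsilon>\<^sup>2 * K2\<^sup>2)" .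
    have "\<bar>P t - P z\<bar> = \<bar>c * (\<phi> t * (t\<^sup>2 + 2) - \<phi> z * (z\<^sup>2 + 2)) + d * (\<phi> t - \<phi> z)\<bar>"
      unfolding P by (simp add: algebra_simps)
    also have "\<dots> \<le> M * (\<bar>\<phi> t * (t\<^sup>2 + 2) - \<phi> z * (z\<^sup>2 + 2)\<bar> + \<bar>\<phi> t - \<phi> z\<bar>)"
      by (rule abs_add_mult_bound[OF cd])
    also have "\<dots> \<le> M * (L * \<bar>t - z\<bar> + L * \<bar>t - z\<bar>)"
      unfolding L_def by (intro mult_left_mono add_mono phi_lipschitz phi_quadratic_lipschitz M)
    also have "\<dots> \<le> M * (L * (\<epsilon> * K2) + L * (\<epsilon> * K2))"
      using tz L M by (intro mult_left_mono add_mono) auto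
    finally have "\<epsilon> * \<bar>P t - P z\<bar> \<le> \<epsilon> * (M * (L * (\<epsilon> * K2) + L * (\<epsilon> * K2)))"
      using \<epsilon>(1) by (intro mult_left_mono) auto
    moreover have "\<bar>\<epsilon> * (P t - P z)\<bar> = \<epsilon> * \<bar>P t - P z\<bar>" using \<epsilon>(1) by (simp only: abs_mult abs_of_pos)
    moreover have "\<epsilon> * (M * (L * (\<epsilon> * K2) + L * (\<epsilon> * K2))) = M * (2 * (L * K2)) * \<epsilon>\<^sup>2"
      by (simp add: power2_eq_square algebra_simps)
    ultimately have B: "\<bar>\<epsilon> * (P t - P z)\<bar> \<le> M * (2 * (L * K2)) * \<epsilon>\<^sup>2" by linarith
    let ?y = "t - (z + \<epsilon> * (c * (z\<^sup>2 + 2) + d))"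
    have "\<phi> z * ?y = \<phi> z * (t - z) - \<epsilon> * P z" by (simp add: P_def algebra_simps)
    \<comment> \<open>Three terms of order \<epsilon>^2: the given error, the Taylor remainder of
      \<Phi>, and \<epsilon> times the change of P between z and t.\<close>
    also have "\<dots> = (edgeworth c d \<epsilon> t - \<Phi> z) - (\<Phi> t - \<Phi> z - \<phi> z * (t - z)) + \<epsilon> * (P t - P z)"
      by (simp add: ew algebra_simps)
    finally have "\<bar>\<phi> z * ?y\<bar> \<le> C * \<epsilon>\<^sup>2 + L * (\<epsilon>\<^sup>2 * K2\<^sup>2) + M * (2 * (L * K2)) * \<epsilon>\<^sup>2"
      using E A B by linarith
    moreover have "\<bar>\<phi> z * ?y\<bar> = \<phi> z * \<bar>?y\<bar>" using phi0 by (simp only: abs_mult abs_of_pos)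
    moreover have "C * \<epsilon>\<^sup>2 + L * (\<epsilon>\<^sup>2 * K2\<^sup>2) + M * (2 * (L * K2)) * \<epsilon>\<^sup>2 =
        (C + L * K2\<^sup>2 + M * (2 * (L * K2))) * \<epsilon>\<^sup>2" by (simp add: algebra_simps)
    ultimately have "\<phi> z * \<bar>?y\<bar> \<le> (C + L * K2\<^sup>2 + M * (2 * (L * K2))) * \<epsilon>\<^sup>2" by linarith
    then have "\<bar>?y\<bar> \<le> (C + L * K2\<^sup>2 + M * (2 * (L * K2))) / \<phi> z * \<epsilon>\<^sup>2"
      using phi0 by (simp add: pos_le_divide_eq mult.commute)
    also have "\<dots> \<le> K * \<epsilon>\<^sup>2" by (intro mult_right_mono) (auto simp: K_def)
    finally show "\<bar>?y\<bar> \<le> K * \<epsilon>\<^sup>2" .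
  qed
qed

section \<open>Clopper--Pearson and Jeffreys bounds\<close>

text \<open>The factor Z stays existential, since the boundary values determine it. Complementary
  binomial tails and distribution functions of beta measures both fit this form.\<close>

definition beta_cdf :: "real \<Rightarrow> real \<Rightarrow> real \<Rightarrow> (real \<Rightarrow> real) \<Rightarrow> bool" where
  "beta_cdf n s x F \<longleftrightarrow> continuous_on {0..1} F \<and> F 0 = 0 \<and> F 1 = 1 \<and>
     (\<exists>Z. \<forall>\<theta>. 0 < \<theta> \<longrightarrow> \<theta> < 1 \<longrightarrow> (F has_real_derivative Z * beta_kernel n s x \<theta>) (at \<theta>))"

text \<open>Multiplying the expansion of t by \<sigma> \<epsilon> turns c and d into (1 - 2 x) / 3
  and s - 1 + x, so no \<sigma> is left in the term of order 1 / n.\<close>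

lemma beta_quantile_expansion:
  fixes m \<alpha> :: real
  defines "z \<equiv> upper_normal_quantile \<alpha>"
  assumes m: "0 < m" and \<alpha>: "0 < \<alpha>" "\<alpha> < 1"
  shows "\<exists>K N. \<forall>F x s n \<theta>. m \<le> x \<longrightarrow> x \<le> 1 - m \<longrightarrow> 0 \<le> s \<longrightarrow> s \<le> 1 \<longrightarrow> N \<le> n \<longrightarrow> beta_cdf n s x F \<longrightarrow>
      \<theta> \<in> {0..1} \<longrightarrow> F \<theta> = 1 - \<alpha> \<longrightarrow>
    \<bar>\<theta> - (x + z * sqrt (x * (1 - x)) / sqrt n + ((1 - 2 * x) * (z\<^sup>2 + 2) / 3 + (s - 1 + x)) / n)\<bar>
      \<le> K * n powr (- 3/2)"
proof -
  obtain C where C: "0 < C" and edge: "\<And>F Z x \<sigma> s \<epsilon> n \<theta>.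
    \<lbrakk>m \<le> x; x \<le> 1 - m; 0 < \<sigma>; \<sigma>\<^sup>2 = x * (1 - x); 0 \<le> s; s \<le> 1; 0 < \<epsilon>; n * \<epsilon>\<^sup>2 = 1; 2 / m \<le> n;
      continuous_on {0..1} F; F 0 = 0; F 1 = 1;
      \<And>\<theta>. 0 < \<theta> \<Longrightarrow> \<theta> < 1 \<Longrightarrow> (F has_real_derivative Z * beta_kernel n s x \<theta>) (at \<theta>);
      0 \<le> \<theta>; \<theta> \<le> 1; 0 \<le> F \<theta>; F \<theta> \<le> 1\<rbrakk> \<Longrightarrow>
    \<bar>F \<theta> - edgeworth ((1 - 2 * x) / (3 * \<sigma>)) ((s - 1 + x) / \<sigma>) \<epsilon> ((\<theta> - x) / (\<sigma> * \<epsilon>))\<bar> \<le> C * \<epsilon>\<^sup>2"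
    using beta_cdf_edgeworth[OF m] by blast
  have "0 \<le> 1 / m" "0 \<le> C" using m C by auto
  from edgeworth_inverse[OF this, of z] obtain K \<epsilon>0 where K: "0 < K" "0 < \<epsilon>0" "\<epsilon>0 \<le> 1"
    and inv: "\<And>c d \<epsilon> t. \<lbrakk>\<bar>c\<bar> \<le> 1 / m; \<bar>d\<bar> \<le> 1 / m; 0 < \<epsilon>; \<epsilon> \<le> \<epsilon>0; \<bar>edgeworth c d \<epsilon> t - \<Phi> z\<bar> \<le> C * \<epsilon>\<^sup>2\<rbrakk> \<Longrightarrow>
      \<bar>t - (z + \<epsilon> * (c * (z\<^sup>2 + 2) + d))\<bar> \<le> K * \<epsilon>\<^sup>2"
    by blast
  show ?thesis
  proof (intro exI allI impI)
    fix F :: "real \<Rightarrow> real" and x s n \<theta> :: real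
    \<comment> \<open>The witness N is read off from this assumption: 2 / m serves the far range of
      the kernel, and 1 / \<epsilon>0^2 gives \<epsilon> \<le> \<epsilon>0.\<close>
    assume x: "m \<le> x" "x \<le> 1 - m" and s: "0 \<le> s" "s \<le> 1" and n: "max 1 (max (2 / m) (1 / \<epsilon>0\<^sup>2)) \<le> n"
      and bc: "beta_cdf n s x F" and \<theta>': "\<theta> \<in> {0..1}" and q: "F \<theta> = 1 - \<alpha>"
    have \<theta>: "0 \<le> \<theta>" "\<theta> \<le> 1" using \<theta>' by auto
    obtain Z where F: "continuous_on {0..1} F" "F 0 = 0" "F 1 = 1"
      "\<And>\<theta>. 0 < \<theta> \<Longrightarrow> \<theta> < 1 \<Longrightarrow> (F has_real_derivative Z * beta_kernel n s x \<theta>) (at \<theta>)"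
      using bc unfolding beta_cdf_def by blast
    define \<sigma> where "\<sigma> = sqrt (x * (1 - x))"
    define \<epsilon> where "\<epsilon> = 1 / sqrt n"
    define c where "c = (1 - 2 * x) / (3 * \<sigma>)"
    define d where "d = (s - 1 + x) / \<sigma>"
    define t where "t = (\<theta> - x) / (\<sigma> * \<epsilon>)"
    have n1: "1 \<le> n" "2 / m \<le> n" "1 / \<epsilon>0\<^sup>2 \<le> n" using n by auto
    have \<epsilon>: "0 < \<epsilon>" "n * \<epsilon>\<^sup>2 = 1" using n1 by (auto simp: \<epsilon>_def power_divide)
    have "0 < x * (1 - x)" using x m by auto
    then have \<sigma>: "0 < \<sigma>" "\<sigma>\<^sup>2 = x * (1 - x)" by (auto simp: \<sigma>_def)
    have "1 / \<epsilon>0 \<le> sqrt n" using n1 K by (intro real_le_rsqrt) (simp add: power_divide)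
    then have \<epsilon>0: "\<epsilon> \<le> \<epsilon>0" using K n1 by (simp add: \<epsilon>_def field_simps)
    have "\<bar>F \<theta> - edgeworth c d \<epsilon> t\<bar> \<le> C * \<epsilon>\<^sup>2"
      unfolding c_def d_def t_def
      by (rule edge[OF x \<sigma> s \<epsilon> n1(2) F \<theta>]) (use q \<alpha> in auto)
    then have "\<bar>edgeworth c d \<epsilon> t - \<Phi> z\<bar> \<le> C * \<epsilon>\<^sup>2"
      using q Phi_upper_normal_quantile[OF \<alpha>] by (simp add: z_def abs_minus_commute)
    from inv[OF _ _ \<epsilon>(1) \<epsilon>0 this] edgeworth_coefficient_bounds[OF m x \<sigma> s]
    have "\<bar>t - (z + \<epsilon> * (c * (z\<^sup>2 + 2) + d))\<bar> \<le> K * \<epsilon>\<^sup>2" by (simp add: c_def d_def)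
    then have "\<sigma> * \<epsilon> * \<bar>t - (z + \<epsilon> * (c * (z\<^sup>2 + 2) + d))\<bar> \<le> 1 * \<epsilon> * (K * \<epsilon>\<^sup>2)"
      using variance_bounds[OF m x \<sigma>] \<epsilon> \<sigma> by (intro mult_mono) auto
    then have A: "\<bar>\<sigma> * \<epsilon> * (t - (z + \<epsilon> * (c * (z\<^sup>2 + 2) + d)))\<bar> \<le> K * \<epsilon> ^ 3"
      using \<epsilon>(1) \<sigma>(1) by (simp add: abs_mult power2_eq_square power3_eq_cube mult_ac)
    have B: "\<sigma> * \<epsilon> * (t - (z + \<epsilon> * (c * (z\<^sup>2 + 2) + d))) =
        \<theta> - (x + z * \<sigma> * \<epsilon> + ((\<sigma> * c) * (z\<^sup>2 + 2) + \<sigma> * d) * \<epsilon>\<^sup>2)"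
    proof -
      have "\<sigma> * \<epsilon> * t = \<theta> - x" using \<epsilon>(1) \<sigma>(1) by (simp add: t_def)
      moreover have "\<sigma> * \<epsilon> * (t - (z + \<epsilon> * (c * (z\<^sup>2 + 2) + d))) =
          \<sigma> * \<epsilon> * t - (z * \<sigma> * \<epsilon> + ((\<sigma> * c) * (z\<^sup>2 + 2) + \<sigma> * d) * \<epsilon>\<^sup>2)"
        by (simp add: algebra_simps power2_eq_square)
      ultimately show ?thesis by linarith
    qed
    have cd: "\<sigma> * c = (1 - 2 * x) / 3" "\<sigma> * d = s - 1 + x" using \<sigma>(1) by (auto simp: c_def d_def)
    have e1: "z * \<sigma> * \<epsilon> = z * \<sigma> / sqrt n" by (simp add: \<epsilon>_def)
    have e2: "\<epsilon>\<^sup>2 = 1 / n" using n1 by (simp add: \<epsilon>_def power_divide)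
    have e3: "\<epsilon> ^ 3 = n powr (- 3/2)"
    proof -
      have "\<epsilon> = n powr (- 1/2)" using n1 by (simp add: \<epsilon>_def powr_minus_divide powr_half_sqrt)
      then have "\<epsilon> ^ 3 = n powr (- 1/2 * 3)" using n1 by (simp add: powr_power)
      then show ?thesis by simp
    qed
    from A have "\<bar>\<theta> - (x + z * \<sigma> / sqrt n + ((1 - 2 * x) / 3 * (z\<^sup>2 + 2) + (s - 1 + x)) * (1 / n))\<bar>
      \<le> K * n powr (- 3/2)"
      unfolding B cd e1 e2 e3 .
    then show "\<bar>\<theta> - (x + z * sqrt (x * (1 - x)) / sqrt n + ((1 - 2 * x) * (z\<^sup>2 + 2) / 3 + (s - 1 + x)) / n)\<bar>
      \<le> K * n powr (- 3/2)"
      by (simp flip: \<sigma>_def)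
  qed
qed

text \<open>Only \<tau> distinguishes the bounds. K and N are chosen after m but before n and X,
  which makes the expansion uniform over the central range.\<close>

definition second_order_expansion :: "real \<Rightarrow> real \<Rightarrow> (nat \<Rightarrow> nat \<Rightarrow> real) \<Rightarrow> bool" where
  "second_order_expansion \<alpha> \<tau> B \<longleftrightarrow>
     (\<forall>m>0. \<exists>K N. \<forall>n X. N \<le> real n \<longrightarrow> 1 \<le> n \<longrightarrow> m \<le> real X / real n \<longrightarrow> real X / real n \<le> 1 - m \<longrightarrow>
        (let x = real X / real n; z = upper_normal_quantile \<alpha>
         in \<bar>B n X - (x + z * sqrt (x * (1 - x)) / sqrt (real n) + ((1 - 2 * x) * (z\<^sup>2 / 3 + 1/6) + \<tau>) / real n)\<bar>
              \<le> K * real n powr (- 3/2)))"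

lemma beta_bound_expansion:
  assumes \<alpha>: "0 < \<alpha>" "\<alpha> < 1" and s: "0 \<le> s" "s \<le> 1"
    and B: "\<And>n X. 0 < X \<Longrightarrow> X < n \<Longrightarrow>
      \<exists>F. beta_cdf n s (real X / real n) F \<and> B n X \<in> {0..1} \<and> F (B n X) = 1 - \<alpha>"
  shows "second_order_expansion \<alpha> (s - 1/2) B"
  unfolding second_order_expansion_def Let_def
proof (intro allI impI)
  fix m :: real assume m: "0 < m"
  define z where "z = upper_normal_quantile \<alpha>"
  obtain K N where exp: "\<forall>F x s n \<theta>. m \<le> x \<longrightarrow> x \<le> 1 - m \<longrightarrow> 0 \<le> s \<longrightarrow> s \<le> 1 \<longrightarrow> N \<le> n \<longrightarrow> beta_cdf n s x F \<longrightarrow>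
      \<theta> \<in> {0..1} \<longrightarrow> F \<theta> = 1 - \<alpha> \<longrightarrow>
    \<bar>\<theta> - (x + z * sqrt (x * (1 - x)) / sqrt n + ((1 - 2 * x) * (z\<^sup>2 + 2) / 3 + (s - 1 + x)) / n)\<bar>
      \<le> K * n powr (- 3/2)"
    using beta_quantile_expansion[OF m \<alpha>] unfolding z_def by (elim exE)
  show "\<exists>K N. \<forall>n X. N \<le> real n \<longrightarrow> 1 \<le> n \<longrightarrow> m \<le> real X / real n \<longrightarrow> real X / real n \<le> 1 - m \<longrightarrow>
      \<bar>B n X - (real X / real n + upper_normal_quantile \<alpha> * sqrt (real X / real n * (1 - real X / real n)) / sqrt (real n) +
         ((1 - 2 * (real X / real n)) * ((upper_normal_quantile \<alpha>)\<^sup>2 / 3 + 1/6) + (s - 1/2)) / real n)\<bar> \<le> K * real n powr (- 3/2)"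
  proof (intro exI allI impI)
    fix n X :: nat
    assume n: "N \<le> real n" and n1: "1 \<le> n" and X: "m \<le> real X / real n" "real X / real n \<le> 1 - m"
    define x where "x = real X / real n"
    have "0 < real X / real n" "real X / real n < 1" using m X by linarith+
    then have "0 < X" "X < n" using n1 by (auto simp: zero_less_divide_iff)
    then obtain F where "beta_cdf n s x F" "B n X \<in> {0..1}" "F (B n X) = 1 - \<alpha>"
      using B unfolding x_def by blast
    with exp[rule_format, OF X s n] have "\<bar>B n X - (x + z * sqrt (x * (1 - x)) / sqrt n +
        ((1 - 2 * x) * (z\<^sup>2 + 2) / 3 + (s - 1 + x)) / n)\<bar> \<le> K * n powr (- 3/2)"
      by (simp add: x_def)
    \<comment> \<open>The x in the shift is absorbed by the skewness term: s - 1 + x = (s - 1/2) -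
      (1 - 2 x) / 2, and 2/3 - 1/2 = 1/6.\<close>
    moreover have "(1 - 2 * x) * (z\<^sup>2 + 2) / 3 + (s - 1 + x) = (1 - 2 * x) * (z\<^sup>2 / 3 + 1/6) + (s - 1/2)"
      by (simp add: field_simps)
    ultimately show "\<bar>B n X - (real X / real n + upper_normal_quantile \<alpha> * sqrt (real X / real n * (1 - real X / real n)) / sqrt (real n) +
         ((1 - 2 * (real X / real n)) * ((upper_normal_quantile \<alpha>)\<^sup>2 / 3 + 1/6) + (s - 1/2)) / real n)\<bar> \<le> K * real n powr (- 3/2)"
      by (simp only: x_def z_def)
  qed
qed

section \<open>Binomial tails and the Clopper--Pearson bound\<close>

lemma beta_kernel_powr:
  assumes "0 < x" "x < 1" "0 < \<theta>" "\<theta> < 1"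
  shows "\<theta> powr (n * x + s - 1) * (1 - \<theta>) powr (n * (1 - x) - s) =
           x powr (n * x + s - 1) * (1 - x) powr (n * (1 - x) - s) * beta_kernel n s x \<theta>"
proof -
  have "(n * x + s - 1) * ln \<theta> + (n * (1 - x) - s) * ln (1 - \<theta>) =
      ((n * x + s - 1) * ln x + (n * (1 - x) - s) * ln (1 - x)) +
      (- n * bernoulli_kl x \<theta> + (s - 1) * ln (\<theta> / x) - s * ln ((1 - \<theta>) / (1 - x)))"
    using assms by (simp add: bernoulli_kl_def ln_div algebra_simps)
  then show ?thesis using assms by (simp add: powr_def beta_kernel_def flip: exp_add)
qed

text \<open>The sum telescopes: by (X + 1) (n choose X + 1) = (n - X) (n choose X), the positive
  part of the derivative of the new term cancels the derivative of the previous sum. What is left is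
  minus the Beta (X + 1, n - X) density.\<close>

lemma has_real_derivative_binomial_tail:
  fixes \<theta> :: real
  assumes "X < n"
  shows "((\<lambda>\<theta>. \<Sum>k\<le>X. real (n choose k) * \<theta> ^ k * (1 - \<theta>) ^ (n - k)) has_real_derivative
           - (real (n - X) * real (n choose X) * \<theta> ^ X * (1 - \<theta>) ^ (n - X - 1))) (at \<theta>)"
  using assms
proof (induction X)
  case 0
  show ?case by (auto intro!: derivative_eq_intros)
next
  case (Suc X)
  have "Suc X * (n choose Suc X) = (n - X) * (n choose X)"
    by (simp only: binomial_absorption binomial_absorb_comp)
  then have eq: "real (Suc X) * real (n choose Suc X) = real (n - X) * real (n choose X)"
    by (simp only: flip: of_nat_mult)
  have "((\<lambda>\<theta>. real (n choose Suc X) * \<theta> ^ Suc X * (1 - \<theta>) ^ (n - Suc X)) has_real_derivative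
      (real (Suc X) * real (n choose Suc X)) * \<theta> ^ X * (1 - \<theta>) ^ (n - Suc X) -
        real (n - Suc X) * real (n choose Suc X) * \<theta> ^ Suc X * (1 - \<theta>) ^ (n - Suc X - 1)) (at \<theta>)"
    by (rule derivative_eq_intros refl)+ (simp add: algebra_simps)
  from DERIV_add[OF Suc.IH this] Suc.prems show ?case
    unfolding eq by simp
qed

text \<open>The two strict inequalities together give the uniqueness behind the \<open>THE\<close>
  in \<open>clopper_pearson_bound\<close>; the first one identifies the superlevel set in a
  quantile.\<close>

lemma unique_level_point:
  fixes F :: "real \<Rightarrow> real"
  assumes cont: "continuous_on {0..1} F" and F01: "F 0 = 0" "F 1 = 1"
    and deriv: "\<And>\<theta>. 0 < \<theta> \<Longrightarrow> \<theta> < 1 \<Longrightarrow> (F has_real_derivative f \<theta>) (at \<theta>)"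
    and pos: "\<And>\<theta>. 0 < \<theta> \<Longrightarrow> \<theta> < 1 \<Longrightarrow> 0 < f \<theta>"
    and \<gamma>: "0 < \<gamma>" "\<gamma> < 1"
  obtains \<theta> where "0 < \<theta>" "\<theta> < 1" "F \<theta> = \<gamma>" "\<And>y. 0 \<le> y \<Longrightarrow> y < \<theta> \<Longrightarrow> F y < \<gamma>"
    "\<And>y. \<theta> < y \<Longrightarrow> y \<le> 1 \<Longrightarrow> \<gamma> < F y"
proof -
  have mono: "F a < F b" if ab: "0 \<le> a" "a < b" "b \<le> 1" for a b
  proof (rule DERIV_pos_imp_increasing_open[OF ab(2)])
    show "\<exists>D. (F has_real_derivative D) (at y) \<and> 0 < D" if "a < y" "y < b" for y
      using deriv[of y] pos[of y] that ab by auto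
    show "continuous_on {a..b} F" by (rule continuous_on_subset[OF cont]) (use ab in auto)
  qed
  obtain \<theta> where \<theta>: "0 \<le> \<theta>" "\<theta> \<le> 1" "F \<theta> = \<gamma>"
    using IVT'[of F 0 \<gamma> 1] cont F01 \<gamma> by auto
  have "\<theta> \<noteq> 0" "\<theta> \<noteq> 1" using \<theta>(3) F01 \<gamma> by auto
  with \<theta> have \<theta>': "0 < \<theta>" "\<theta> < 1" by linarith+
  show ?thesis
  proof (rule that[OF \<theta>' \<theta>(3)])
    show "F y < \<gamma>" if "0 \<le> y" "y < \<theta>" for y using mono[of y \<theta>] that \<theta> by simp
    show "\<gamma> < F y" if "\<theta> < y" "y \<le> 1" for y using mono[of \<theta> y] that \<theta> by simp
  qed
qed

text \<open>F is the complementary tail, so that it increases from 0 to 1 like a distribution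
  function and the bound is its level point for 1 - \<alpha>.\<close>

lemma clopper_pearson_bound_solves:
  fixes n X :: nat and \<alpha> :: real
  defines "F \<equiv> (\<lambda>\<theta>. 1 - (\<Sum>k\<le>X. real (n choose k) * \<theta> ^ k * (1 - \<theta>) ^ (n - k)))"
  assumes X: "X < n" and \<alpha>: "0 < \<alpha>" "\<alpha> < 1"
  shows "continuous_on {0..1} F" "F 0 = 0" "F 1 = 1"
    and "(F has_real_derivative real (n - X) * real (n choose X) * \<theta> ^ X * (1 - \<theta>) ^ (n - X - 1)) (at \<theta>)"
    and "clopper_pearson_bound \<alpha> n X \<in> {0..1}" "F (clopper_pearson_bound \<alpha> n X) = 1 - \<alpha>"
proof -
  define c where "c = real (n - X) * real (n choose X)"
  have F': "(F has_real_derivative c * \<theta> ^ X * (1 - \<theta>) ^ (n - X - 1)) (at \<theta>)" for \<theta>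
    unfolding F_def using DERIV_diff[OF DERIV_const has_real_derivative_binomial_tail[OF X], of 1 \<theta>]
    by (simp add: c_def)
  then show "(F has_real_derivative real (n - X) * real (n choose X) * \<theta> ^ X * (1 - \<theta>) ^ (n - X - 1)) (at \<theta>)"
    unfolding c_def .
  show cont: "continuous_on {0..1} F" by (rule DERIV_continuous_on[OF has_field_derivative_at_within[OF F']])
  \<comment> \<open>At 0 only k = 0 survives, because 0 ^ 0 = 1. At 1, treated next, every term
    vanishes, because n - k > 0 for k \<le> X < n.\<close>
  have "(\<Sum>k\<le>X. real (n choose k) * 0 ^ k * (1 - 0) ^ (n - k)) = (\<Sum>k\<in>{0::nat}. 1)"
    by (rule sum.mono_neutral_cong_right) auto
  then show F0: "F 0 = 0" by (simp add: F_def)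
  have "(\<Sum>k\<le>X. real (n choose k) * 1 ^ k * (1 - 1) ^ (n - k)) = 0"
    by (rule sum.neutral) (use X in auto)
  then show F1: "F 1 = 1" by (simp add: F_def)
  have c: "0 < c" using X by (simp add: c_def)
  obtain \<theta> where \<theta>: "0 < \<theta>" "\<theta> < 1" "F \<theta> = 1 - \<alpha>" "\<And>y. 0 \<le> y \<Longrightarrow> y < \<theta> \<Longrightarrow> F y < 1 - \<alpha>"
    "\<And>y. \<theta> < y \<Longrightarrow> y \<le> 1 \<Longrightarrow> 1 - \<alpha> < F y"
    by (rule unique_level_point[OF cont F0 F1 F', of "1 - \<alpha>"]) (use \<alpha> c in auto)
  have "clopper_pearson_bound \<alpha> n X = \<theta>"
    unfolding clopper_pearson_bound_def if_P[OF X]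
  proof (rule the_equality)
    show "\<theta> \<in> {0..1} \<and> (\<Sum>k\<le>X. real (n choose k) * \<theta> ^ k * (1 - \<theta>) ^ (n - k)) = \<alpha>"
      using \<theta>(1-3) by (simp add: F_def)
    fix y assume "y \<in> {0..1} \<and> (\<Sum>k\<le>X. real (n choose k) * y ^ k * (1 - y) ^ (n - k)) = \<alpha>"
    then have "0 \<le> y" "y \<le> 1" "F y = 1 - \<alpha>" by (auto simp: F_def)
    then show "y = \<theta>" using \<theta>(4,5)[of y] by (cases y \<theta> rule: linorder_cases) auto
  qed
  then show "clopper_pearson_bound \<alpha> n X \<in> {0..1}" "F (clopper_pearson_bound \<alpha> n X) = 1 - \<alpha>"
    using \<theta>(1-3) by auto
qed

lemma clopper_pearson_bound_range:
  assumes "X \<le> n" "0 < \<alpha>" "\<alpha> < 1"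
  shows "clopper_pearson_bound \<alpha> n X \<in> {0..1}"
proof (cases "X < n")
  case True
  then show ?thesis using assms by (intro clopper_pearson_bound_solves)
qed (simp add: clopper_pearson_bound_def)

lemma clopper_pearson_bound_is_beta_quantile:
  fixes n X :: nat and \<alpha> :: real
  assumes X: "0 < X" "X < n" and \<alpha>: "0 < \<alpha>" "\<alpha> < 1"
  shows "\<exists>F. beta_cdf n 1 (real X / real n) F \<and> clopper_pearson_bound \<alpha> n X \<in> {0..1} \<and>
    F (clopper_pearson_bound \<alpha> n X) = 1 - \<alpha>"
proof -
  define x where "x = real X / real n"
  define c where "c = real (n - X) * real (n choose X)"
  define F :: "real \<Rightarrow> real" where "F = (\<lambda>\<theta>. 1 - (\<Sum>k\<le>X. real (n choose k) * \<theta> ^ k * (1 - \<theta>) ^ (n - k)))"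
  have x: "0 < x" "x < 1" using X by (auto simp: x_def)
  have nx: "real n * x = real X" using X by (simp add: x_def)
  note F = clopper_pearson_bound_solves[OF X(2) \<alpha>, folded F_def c_def]
  have "(F has_real_derivative
      c * (x powr (n * x + 1 - 1) * (1 - x) powr (n * (1 - x) - 1)) * beta_kernel n 1 x y) (at y)"
    if y: "0 < y" "y < 1" for y
  proof -
    \<comment> \<open>The truncated subtraction is exact since X < n. The exponents X and n - X - 1
      are those of the kernel with s = 1.\<close>
    have "n * (1 - x) - 1 = real (n - X - 1)" using X nx by (simp add: right_diff_distrib of_nat_diff)
    then have "y ^ X * (1 - y) ^ (n - X - 1) = y powr (n * x + 1 - 1) * (1 - y) powr (n * (1 - x) - 1)"
      using y nx by (simp add: powr_realpow)
    also note beta_kernel_powr[OF x y]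
    finally show ?thesis using F(4)[of y] by (simp add: mult.assoc)
  qed
  moreover have "F 0 = 0" "F 1 = 1" and level: "F (clopper_pearson_bound \<alpha> n X) = 1 - \<alpha>"
    unfolding F_def by (fact F(2), fact F(3), fact F(6))
  ultimately have "beta_cdf n 1 x F" using F(1)
    unfolding beta_cdf_def
    by (intro conjI exI[of _ "c * (x powr (n * x + 1 - 1) * (1 - x) powr (n * (1 - x) - 1))"] allI impI)
  with F(5) level show ?thesis unfolding x_def by (intro exI[of _ F] conjI)
qed

lemma clopper_pearson_expansion:
  assumes \<alpha>: "0 < \<alpha>" "\<alpha> < 1"
  shows "second_order_expansion \<alpha> (1/2) (clopper_pearson_bound \<alpha>)"
  using beta_bound_expansion[OF \<alpha>, of 1 "clopper_pearson_bound \<alpha>"] clopper_pearson_bound_is_beta_quantile[OF _ _ \<alpha>]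
  by simp

section \<open>Beta distributions and the Jeffreys bound\<close>

lemma Beta_real_pos: "0 < a \<Longrightarrow> 0 < b \<Longrightarrow> 0 < Beta a b" for a b :: real
  by (simp add: Beta_def)

lemma beta_density_measurable [measurable]: "beta_density a b \<in> borel_measurable borel"
  unfolding beta_density_def[abs_def] by measurable

lemma beta_density_nonneg: "0 < a \<Longrightarrow> 0 < b \<Longrightarrow> 0 \<le> beta_density a b x"
  using Beta_real_pos[of a b] by (simp add: beta_density_def)

lemma prob_space_beta_distribution:
  assumes "0 < a" "0 < b"
  shows "prob_space (beta_distribution a b)"
proof
  have "((\<lambda>t. t powr (a - 1) * (1 - t) powr (b - 1)) has_integral Beta a b) {0<..<1}"
    using has_integral_Beta_real[OF assms] by (simp add: has_integral_Icc_iff_Ioo)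
  then have "((\<lambda>t. if t \<in> {0<..<1} then t powr (a - 1) * (1 - t) powr (b - 1) else 0) has_integral Beta a b) UNIV"
    by (subst has_integral_restrict_UNIV)
  from has_integral_divide[OF this, of "Beta a b"]
  have "((\<lambda>t. (if t \<in> {0<..<1} then t powr (a - 1) * (1 - t) powr (b - 1) else 0) / Beta a b) has_integral 1) UNIV"
    using Beta_real_pos[OF assms] by simp
  then have "(beta_density a b has_integral 1) UNIV"
    by (rule has_integral_eq[rotated]) (simp add: beta_density_def)
  then have "(\<integral>\<^sup>+x. ennreal (beta_density a b x) \<partial>lborel) = ennreal 1"
    by (intro nn_integral_has_integral_lborel) (use assms in \<open>auto intro: beta_density_nonneg\<close>)
  then show "emeasure (beta_distribution a b) (space (beta_distribution a b)) = 1"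
    by (simp add: beta_distribution_def emeasure_density)
qed

lemma beta_cdf_boundary:
  assumes "0 < a" "0 < b"
  shows "cdf (beta_distribution a b) 0 = 0" "cdf (beta_distribution a b) 1 = 1"
proof -
  interpret prob_space "beta_distribution a b" by (rule prob_space_beta_distribution[OF assms])
  have "emeasure (beta_distribution a b) {..0} = (\<integral>\<^sup>+x. ennreal (beta_density a b x) * indicator {..0} x \<partial>lborel)"
    unfolding beta_distribution_def by (rule emeasure_density) auto
  also have "\<dots> = (\<integral>\<^sup>+x. 0 \<partial>(lborel :: real measure))"
    by (rule nn_integral_cong) (auto simp: beta_density_def indicator_def)
  finally show "cdf (beta_distribution a b) 0 = 0" by (simp add: cdf_def measure_def)
  have "emeasure (beta_distribution a b) {..1} = (\<integral>\<^sup>+x. ennreal (beta_density a b x) * indicator {..1} x \<partial>lborel)"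
    unfolding beta_distribution_def by (rule emeasure_density) auto
  also have "\<dots> = (\<integral>\<^sup>+x. ennreal (beta_density a b x) * indicator UNIV x \<partial>lborel)"
    by (rule nn_integral_cong) (auto simp: beta_density_def indicator_def)
  also have "\<dots> = emeasure (beta_distribution a b) UNIV"
    unfolding beta_distribution_def by (rule emeasure_density[symmetric]) auto
  also have "\<dots> = 1" using emeasure_space_1 by (simp add: beta_distribution_def)
  finally show "cdf (beta_distribution a b) 1 = 1" by (simp add: cdf_def measure_def)
qed

text \<open>The derivative formula covers the open interval only. Continuity at 0 and 1 comes from
  absolute continuity, which excludes atoms.\<close>

lemma isCont_beta_cdf:
  assumes "0 < a" "0 < b"
  shows "isCont (cdf (beta_distribution a b)) x"
proof -
  interpret prob_space "beta_distribution a b" by (rule prob_space_beta_distribution[OF assms])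
  interpret finite_borel_measure "beta_distribution a b"
    by unfold_locales (simp add: beta_distribution_def)
  have "absolutely_continuous lborel (beta_distribution a b)"
    unfolding beta_distribution_def by (rule absolutely_continuousI_density) simp
  moreover have "{x} \<in> null_sets lborel" by (auto simp: null_sets_def)
  ultimately have "{x} \<in> null_sets (beta_distribution a b)" by (auto simp: absolutely_continuous_def)
  then have "measure (beta_distribution a b) {x} = 0" by (simp add: null_sets_def measure_def)
  then show ?thesis by (simp add: isCont_cdf)
qed

lemma beta_distribution_quantile:
  fixes a b \<gamma> :: real
  defines "F \<equiv> cdf (beta_distribution a b)"
  assumes ab: "0 < a" "0 < b" and \<gamma>: "0 < \<gamma>" "\<gamma> < 1"
  shows "continuous_on {0..1} F" "F 0 = 0" "F 1 = 1"
    and "\<And>\<theta>. 0 < \<theta> \<Longrightarrow> \<theta> < 1 \<Longrightarrow> (F has_real_derivative beta_density a b \<theta>) (at \<theta>)"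
    and "quantile (beta_distribution a b) \<gamma> \<in> {0..1}" "F (quantile (beta_distribution a b) \<gamma>) = \<gamma>"
proof -
  interpret prob_space "beta_distribution a b" by (rule prob_space_beta_distribution[OF ab])
  interpret finite_borel_measure "beta_distribution a b"
    by unfold_locales (simp add: beta_distribution_def)
  show F': "(F has_real_derivative beta_density a b \<theta>) (at \<theta>)" if \<theta>: "0 < \<theta>" "\<theta> < 1" for \<theta>
    unfolding F_def beta_distribution_def
  proof (rule cdf_density_has_real_derivative[OF _ _ _ _ \<theta>])
    show "continuous_on {0<..<1} (beta_density a b)"
    proof (rule continuous_on_eq)
      show "continuous_on {0<..<1} (\<lambda>x. x powr (a - 1) * (1 - x) powr (b - 1) / Beta a b)"
        using Beta_real_pos[OF ab] by (intro continuous_intros) auto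
    qed (auto simp: beta_density_def)
    show "prob_space (density lborel (\<lambda>x. ennreal (beta_density a b x)))"
      using prob_space_axioms unfolding beta_distribution_def .
  qed (use beta_density_nonneg[OF ab] in auto)
  show cont: "continuous_on {0..1} F"
    unfolding F_def by (intro continuous_at_imp_continuous_on ballI isCont_beta_cdf ab)
  note F01 = beta_cdf_boundary[OF ab, folded F_def]
  then show "F 0 = 0" "F 1 = 1" .
  have pos: "0 < beta_density a b \<theta>" if "0 < \<theta>" "\<theta> < 1" for \<theta>
    using that Beta_real_pos[OF ab] by (simp add: beta_density_def)
  obtain \<theta> where \<theta>: "0 < \<theta>" "\<theta> < 1" "F \<theta> = \<gamma>" "\<And>y. 0 \<le> y \<Longrightarrow> y < \<theta> \<Longrightarrow> F y < \<gamma>"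
    by (rule unique_level_point[OF cont F01 F' pos \<gamma>]) auto
  have "{y. \<gamma> \<le> F y} = {\<theta>..}"
  proof (intro equalityI subsetI)
    fix y assume y: "y \<in> {y. \<gamma> \<le> F y}"
    show "y \<in> {\<theta>..}"
    proof (rule ccontr)
      assume "y \<notin> {\<theta>..}"
      then have "y < \<theta>" by simp
      \<comment> \<open>\<open>unique_level_point\<close> speaks of the unit interval only, so a
        negative y is first moved to 0.\<close>
      have "F y \<le> F (max 0 y)" unfolding F_def by (rule cdf_nondecreasing) simp
      also have "\<dots> < \<gamma>" using \<theta>(4)[of "max 0 y"] \<open>y < \<theta>\<close> \<theta>(1) by simp
      finally show False using y by simp
    qed
  next
    fix y assume "y \<in> {\<theta>..}"
    then have "F \<theta> \<le> F y" unfolding F_def by (intro cdf_nondecreasing) simp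
    then show "y \<in> {y. \<gamma> \<le> F y}" using \<theta>(3) by simp
  qed
  then have "quantile (beta_distribution a b) \<gamma> = \<theta>"
    by (simp add: quantile_def F_def)
  then show "quantile (beta_distribution a b) \<gamma> \<in> {0..1}" "F (quantile (beta_distribution a b) \<gamma>) = \<gamma>"
    using \<theta>(1-3) by auto
qed

lemma jeffreys_bound_range:
  assumes "X \<le> n" "0 < \<alpha>" "\<alpha> < 1"
  shows "jeffreys_bound \<alpha> n X \<in> {0..1}"
  unfolding jeffreys_bound_def by (rule beta_distribution_quantile(5)) (use assms in auto)

lemma jeffreys_bound_is_beta_quantile:
  fixes n X :: nat and \<alpha> :: real
  assumes X: "0 < X" "X < n" and \<alpha>: "0 < \<alpha>" "\<alpha> < 1"
  shows "\<exists>F. beta_cdf n (1/2) (real X / real n) F \<and> jeffreys_bound \<alpha> n X \<in> {0..1} \<and>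
    F (jeffreys_bound \<alpha> n X) = 1 - \<alpha>"
proof -
  define x where "x = real X / real n"
  define a b where "a = real X + 1/2" and "b = real n - real X + 1/2"
  have ab: "0 < a" "0 < b" using X by (auto simp: a_def b_def)
  have x: "0 < x" "x < 1" using X by (auto simp: x_def)
  have nx: "real n * x = real X" using X by (simp add: x_def)
  define F where "F = cdf (beta_distribution a b)"
  have "0 < 1 - \<alpha>" "1 - \<alpha> < 1" using \<alpha> by auto
  note F = beta_distribution_quantile[OF ab this, folded F_def]
  have "(F has_real_derivative
      x powr (n * x + 1/2 - 1) * (1 - x) powr (n * (1 - x) - 1/2) / Beta a b * beta_kernel n (1/2) x y) (at y)"
    if y: "0 < y" "y < 1" for y
  proof -
    have "a - 1 = n * x + 1/2 - 1" "b - 1 = n * (1 - x) - 1/2"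
      using nx by (auto simp: a_def b_def right_diff_distrib)
    then have "beta_density a b y = y powr (n * x + 1/2 - 1) * (1 - y) powr (n * (1 - x) - 1/2) / Beta a b"
      using y by (simp add: beta_density_def)
    then show ?thesis using F(4)[OF y] beta_kernel_powr[OF x y, of n "1/2"] by simp
  qed
  with F(1-3) have "beta_cdf n (1/2) x F"
    unfolding beta_cdf_def
    by (intro conjI exI[of _ "x powr (n * x + 1/2 - 1) * (1 - x) powr (n * (1 - x) - 1/2) / Beta a b"] allI impI)
  with F(5,6) show ?thesis unfolding x_def jeffreys_bound_def a_def b_def by (intro exI[of _ F] conjI)
qed

lemma jeffreys_expansion:
  assumes \<alpha>: "0 < \<alpha>" "\<alpha> < 1"
  shows "second_order_expansion \<alpha> 0 (jeffreys_bound \<alpha>)"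
  using beta_bound_expansion[OF \<alpha>, of "1/2" "jeffreys_bound \<alpha>"] jeffreys_bound_is_beta_quantile[OF _ _ \<alpha>]
  by simp

section \<open>The modified loglikelihood root\<close>

text \<open>This and \<open>signed_root\<close> carry the sign of \<theta> - x, opposite to
  \<open>wald_logit\<close> and \<open>loglik_root\<close>, and are free of n. The two sign changes
  cancel in the quotient Q / r and turn the target - z into z.\<close>

definition logit_diff :: "real \<Rightarrow> real \<Rightarrow> real" where
  "logit_diff x \<theta> = ln (\<theta> / (1 - \<theta>)) - ln (x / (1 - x))"

definition signed_root :: "real \<Rightarrow> real \<Rightarrow> real" where
  "signed_root x \<theta> = sgn (\<theta> - x) * sqrt (2 * bernoulli_kl x \<theta>)"

text \<open>With \<open>x = X / n\<close>, the modified loglikelihood root is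
  \<open>- (sqrt n * signed_root x \<theta> + root_correction x \<theta> / sqrt n)\<close>; the value at \<open>\<theta> = x\<close> is the limit there.\<close>

definition root_correction :: "real \<Rightarrow> real \<Rightarrow> real" where
  "root_correction x \<theta> =
     (if \<theta> = x then - (1 - 2 * x) / (6 * sqrt (x * (1 - x)))
      else ln (sqrt (x * (1 - x)) * logit_diff x \<theta> / signed_root x \<theta>) / signed_root x \<theta>)"

text \<open>With S = sqrt (1 + y) one has y = (S - 1) (S + 1), hence |S - 1| \<le> |y| and S - 1 - y
  / 2 = - (S - 1)^2 / 2.\<close>

lemma sqrt_one_plus_bounds:
  fixes y :: real
  assumes "\<bar>y\<bar> \<le> 1/2"
  shows "\<bar>sqrt (1 + y) - 1 - y / 2\<bar> \<le> y\<^sup>2" "\<bar>sqrt (1 + y) - 1\<bar> \<le> \<bar>y\<bar>" "1/2 \<le> sqrt (1 + y)"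
proof -
  define S where "S = sqrt (1 + y)"
  have S: "0 \<le> S" "S\<^sup>2 = 1 + y" using assms by (auto simp: S_def)
  have y: "y = (S - 1) * (S + 1)" using S(2) by (simp add: power2_eq_square algebra_simps)
  have "\<bar>S - 1\<bar> * 1 \<le> \<bar>S - 1\<bar> * \<bar>S + 1\<bar>" using S(1) by (intro mult_left_mono) auto
  then have 1: "\<bar>S - 1\<bar> \<le> \<bar>y\<bar>" unfolding y abs_mult by simp
  then show "\<bar>sqrt (1 + y) - 1\<bar> \<le> \<bar>y\<bar>" by (simp add: S_def)
  show "1/2 \<le> sqrt (1 + y)" using 1 assms unfolding S_def by linarith
  have "S - 1 - y / 2 = - ((S - 1)\<^sup>2 / 2)" unfolding y by (simp add: power2_eq_square field_simps)
  moreover have "(S - 1)\<^sup>2 \<le> y\<^sup>2" using 1 by (simp add: abs_le_square_iff)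
  ultimately show "\<bar>sqrt (1 + y) - 1 - y / 2\<bar> \<le> y\<^sup>2"
    unfolding S_def[symmetric] using zero_le_power2[of "S - 1"] by linarith
qed

text \<open>In the application 1 + y and 1 + w are the divergence and the logit difference relative
  to their leading terms. The correction divides the logarithm by a root proportional to u sqrt (1 +
  y), so its first-order term is compared with that square root attached.\<close>

lemma sqrt_ln_perturbation:
  fixes K u y y1 w w1 :: real
  assumes K: "1 \<le> K" and y1: "\<bar>y1\<bar> \<le> K" and w1: "\<bar>w1\<bar> \<le> K"
    and y: "\<bar>y - y1 * u\<bar> \<le> K * u\<^sup>2" and w: "\<bar>w - w1 * u\<bar> \<le> K * u\<^sup>2" and u: "4 * K * \<bar>u\<bar> \<le> 1"
  shows "\<bar>sqrt (1 + y) - (1 + y1 / 2 * u)\<bar> \<le> 5 * K\<^sup>2 * u\<^sup>2"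
    and "\<bar>ln (1 + w) - ln (1 + y) / 2 - (w1 - y1 / 2) * u * sqrt (1 + y)\<bar> \<le> 18 * K\<^sup>2 * u\<^sup>2"
    and "\<bar>y\<bar> \<le> 1/2" "\<bar>w\<bar> \<le> 1/2"
proof -
  have Ku: "K * u\<^sup>2 \<le> K * \<bar>u\<bar>"
  proof -
    have "\<bar>u\<bar> \<le> K * \<bar>u\<bar>" using K mult_right_mono[of 1 K "\<bar>u\<bar>"] by simp
    then have "\<bar>u\<bar> \<le> 1" using u by linarith
    then have "\<bar>u\<bar> * \<bar>u\<bar> \<le> 1 * \<bar>u\<bar>" by (intro mult_right_mono) auto
    then show ?thesis using K by (simp add: power2_eq_square)
  qed
  have lin: "\<bar>a\<bar> \<le> 2 * K * \<bar>u\<bar>" if "\<bar>a - a1 * u\<bar> \<le> K * u\<^sup>2" "\<bar>a1\<bar> \<le> K" for a a1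
  proof -
    have "\<bar>a1 * u\<bar> \<le> K * \<bar>u\<bar>" using that(2) by (simp add: abs_mult mult_right_mono)
    then show ?thesis using that(1) Ku by linarith
  qed
  have yb: "\<bar>y\<bar> \<le> 2 * K * \<bar>u\<bar>" and wb: "\<bar>w\<bar> \<le> 2 * K * \<bar>u\<bar>" using lin y w y1 w1 by auto
  have half: "\<bar>y\<bar> \<le> 1/2" "\<bar>w\<bar> \<le> 1/2" using yb wb u by linarith+
  then show "\<bar>y\<bar> \<le> 1/2" "\<bar>w\<bar> \<le> 1/2" .
  have sq: "a\<^sup>2 \<le> 4 * (K\<^sup>2 * u\<^sup>2)" if "\<bar>a\<bar> \<le> 2 * K * \<bar>u\<bar>" for a
    using power_mono[OF that abs_ge_zero, of 2] by (simp add: power_mult_distrib mult.assoc)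
  have KK: "K * u\<^sup>2 \<le> K\<^sup>2 * u\<^sup>2" using K by (intro mult_right_mono) (auto simp: power2_eq_square)
  note s = sqrt_one_plus_bounds[OF half(1)]
  show "\<bar>sqrt (1 + y) - (1 + y1 / 2 * u)\<bar> \<le> 5 * K\<^sup>2 * u\<^sup>2"
    using s(1) sq[OF yb] y KK by linarith
  have "\<bar>ln (1 + y) - y\<bar> \<le> 2 * y\<^sup>2" "\<bar>ln (1 + w) - w\<bar> \<le> 2 * w\<^sup>2"
    using half by (intro abs_ln_one_plus_x_minus_x_bound; simp)+
  \<comment> \<open>14 covers 8 + 4 from the quadratic errors of the logarithms and 1 + 1/2 from
    those of w and y; the factor \<open>sqrt (1 + y)\<close> adds 4 below.\<close>
  then have l: "\<bar>ln (1 + w) - ln (1 + y) / 2 - (w1 - y1 / 2) * u\<bar> \<le> 14 * (K\<^sup>2 * u\<^sup>2)"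
    using sq[OF yb] sq[OF wb] y w KK by (simp add: algebra_simps)
  have "\<bar>w1 - y1 / 2\<bar> * \<bar>u\<bar> * \<bar>sqrt (1 + y) - 1\<bar> \<le> (2 * K) * \<bar>u\<bar> * (2 * K * \<bar>u\<bar>)"
    using y1 w1 s(2) yb K by (intro mult_mono) auto
  then have "\<bar>(w1 - y1 / 2) * u * (sqrt (1 + y) - 1)\<bar> \<le> 4 * (K\<^sup>2 * u\<^sup>2)"
    by (simp add: abs_mult power2_eq_square mult_ac)
  moreover have "ln (1 + w) - ln (1 + y) / 2 - (w1 - y1 / 2) * u * sqrt (1 + y) =
      (ln (1 + w) - ln (1 + y) / 2 - (w1 - y1 / 2) * u) - (w1 - y1 / 2) * u * (sqrt (1 + y) - 1)"
    by (simp only: right_diff_distrib mult_1_right)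
  ultimately show "\<bar>ln (1 + w) - ln (1 + y) / 2 - (w1 - y1 / 2) * u * sqrt (1 + y)\<bar> \<le> 18 * K\<^sup>2 * u\<^sup>2"
    using l by linarith
qed

lemma abs_ln_one_plus_quadratic_bound:
  fixes v :: real
  assumes "\<bar>v\<bar> \<le> 1/2"
  shows "\<bar>ln (1 + v) - (v - v\<^sup>2 / 2)\<bar> \<le> \<bar>v\<bar> ^ 3"
proof -
  have "v ^ 4 = \<bar>v\<bar> * \<bar>v\<bar> ^ 3" by (simp add: power4_eq_xxxx power3_eq_cube flip: abs_mult)
  also have "\<dots> \<le> 1/2 * \<bar>v\<bar> ^ 3" using assms by (intro mult_right_mono) auto
  finally have "v ^ 4 \<le> \<bar>v\<bar> ^ 3 / 2" by simp
  moreover have "\<bar>v ^ 3 / 3\<bar> \<le> \<bar>v\<bar> ^ 3 / 2" by (simp add: power_abs)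
  ultimately show ?thesis using abs_ln_one_plus_cubic_bound[OF assms] by linarith
qed

lemma logit_diff_taylor:
  assumes m: "0 < m" "m \<le> x" "x \<le> 1 - m" and u: "\<bar>u\<bar> \<le> m / 2"
  shows "\<bar>logit_diff x (x + u) - (u / (x * (1 - x)) - (1 - 2 * x) * u\<^sup>2 / (2 * (x * (1 - x))\<^sup>2))\<bar>
           \<le> 2 * \<bar>u\<bar> ^ 3 / m ^ 3"
proof -
  have x: "0 < x" "x < 1" "0 < x + u" "x + u < 1" using assms by linarith+
  have v: "\<bar>u / x\<bar> \<le> 1/2" "\<bar>- u / (1 - x)\<bar> \<le> 1/2"
    using m u by (auto simp: abs_divide divide_simps)
  define e1 where "e1 = ln (1 + u / x) - (u / x - (u / x)\<^sup>2 / 2)"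
  define e2 where "e2 = ln (1 + - u / (1 - x)) - (- u / (1 - x) - (- u / (1 - x))\<^sup>2 / 2)"
  have e: "\<bar>e1\<bar> \<le> \<bar>u / x\<bar> ^ 3" "\<bar>e2\<bar> \<le> \<bar>- u / (1 - x)\<bar> ^ 3"
    unfolding e1_def e2_def by (intro abs_ln_one_plus_quadratic_bound v)+
  have "ln (1 + u / x) = ln (x + u) - ln x" "ln (1 + - u / (1 - x)) = ln (1 - (x + u)) - ln (1 - x)"
    using ln_divide_one_plus[of x "x + u"] ln_divide_one_plus[of "1 - x" "1 - (x + u)"] x
      ln_div[of "x + u" x] ln_div[of "1 - (x + u)" "1 - x"] by simp_all
  then have "logit_diff x (x + u) = ln (1 + u / x) - ln (1 + - u / (1 - x))"
    using x by (simp add: logit_diff_def ln_div)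
  moreover have "(u / x - (u / x)\<^sup>2 / 2) - (- u / (1 - x) - (- u / (1 - x))\<^sup>2 / 2) =
      u / (x * (1 - x)) - (1 - 2 * x) * u\<^sup>2 / (2 * (x * (1 - x))\<^sup>2)"
    using x by (simp add: divide_simps) (simp add: power2_eq_square algebra_simps)
  ultimately have "logit_diff x (x + u) - (u / (x * (1 - x)) - (1 - 2 * x) * u\<^sup>2 / (2 * (x * (1 - x))\<^sup>2)) = e1 - e2"
    unfolding e1_def e2_def by linarith
  then have "\<bar>logit_diff x (x + u) - (u / (x * (1 - x)) - (1 - 2 * x) * u\<^sup>2 / (2 * (x * (1 - x))\<^sup>2))\<bar>
      \<le> \<bar>u / x\<bar> ^ 3 + \<bar>- u / (1 - x)\<bar> ^ 3"
    using e by linarith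
  also have "\<dots> = \<bar>u\<bar> ^ 3 / x ^ 3 + \<bar>u\<bar> ^ 3 / (1 - x) ^ 3"
    using x by (simp add: abs_divide power_divide)
  also have "\<dots> \<le> \<bar>u\<bar> ^ 3 / m ^ 3 + \<bar>u\<bar> ^ 3 / m ^ 3"
    using m x by (intro add_mono divide_left_mono power_mono mult_pos_pos zero_less_power) auto
  finally show ?thesis by simp
qed

text \<open>The relative first-order coefficients are y1 = - (2/3) (1 - 2 x) / V for the divergence
  and w1 = - (1/2) (1 - 2 x) / V for the logit difference. The logarithm in the correction has slope
  w1 - y1 / 2 = - (1 - 2 x) / (6 V), and division by the root, about u / \<sigma>, gives - (1 - 2 x)
  / (6 \<sigma>), the value of \<open>root_correction\<close> at \<theta> = x.\<close>

lemma signed_root_near: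
  fixes m x u \<sigma> :: real
  defines "K \<equiv> 4 / m ^ 3"
  assumes m: "0 < m" "m \<le> x" "x \<le> 1 - m" and \<sigma>: "0 < \<sigma>" "\<sigma>\<^sup>2 = x * (1 - x)"
    and u: "u \<noteq> 0" "4 * K * \<bar>u\<bar> \<le> 1"
  shows "\<bar>signed_root x (x + u) - (u / \<sigma> - (1 - 2 * x) / (3 * \<sigma> ^ 3) * u\<^sup>2)\<bar> \<le> 5 * K\<^sup>2 / m * \<bar>u\<bar> ^ 3"
    and "\<bar>root_correction x (x + u) + (1 - 2 * x) / (6 * \<sigma>)\<bar> \<le> 36 * K\<^sup>2 * \<bar>u\<bar>"
proof -
  define V where "V = x * (1 - x)"
  note b = variance_bounds[OF m \<sigma>]
  have V2: "V = \<sigma>\<^sup>2" using \<sigma>(2) by (simp only: V_def)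
  have V: "0 < V" "V = \<sigma>\<^sup>2" "V \<le> 1" unfolding V2 using \<sigma>(1) b by (auto intro: power_le_one)
  have m1: "m \<le> 1" using m by linarith
  have m3: "m ^ 3 \<le> 1" "m ^ 3 \<le> m\<^sup>2" using m m1 by (auto intro!: power_le_one power_decreasing)
  have K: "1 \<le> K" using m m3 by (simp add: K_def field_simps)
  have Vm: "1 / V \<le> 1 / m ^ 3"
  proof -
    have "m\<^sup>2 \<le> V" unfolding V(2) using b m by (intro power_mono) auto
    then have "m ^ 3 \<le> V" using m3 by linarith
    then show ?thesis using m V by (intro divide_left_mono) auto
  qed
  have u2: "\<bar>u\<bar> \<le> m / 2"
  proof -
    have "m ^ 3 \<le> m ^ 1" using m m1 by (intro power_decreasing) auto
    then have "m ^ 3 / 16 \<le> m / 2" using m by simp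
    moreover have "\<bar>u\<bar> \<le> m ^ 3 / 16" using u m by (simp add: K_def field_simps)
    ultimately show ?thesis by linarith
  qed
  have x: "0 < x" "x < 1" "0 < x + u" "x + u < 1" using m u2 by linarith+
  define y where "y = 2 * V * bernoulli_kl x (x + u) / u\<^sup>2 - 1"
  define y1 where "y1 = (- 2 / 3) * (1 - 2 * x) / V"
  define w where "w = V * logit_diff x (x + u) / u - 1"
  define w1 where "w1 = (- 1 / 2) * (1 - 2 * x) / V"
  have kl: "bernoulli_kl x (x + u) = u\<^sup>2 / (2 * V) * (1 + y)" using u(1) V(1) by (simp add: y_def)
  have lo: "logit_diff x (x + u) = u / V * (1 + w)" using u(1) V(1) by (simp add: w_def)
  have c: "\<bar>1 - 2 * x\<bar> \<le> 1" using x by linarith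
  have coef: "\<bar>q * (1 - 2 * x) / V\<bar> \<le> K" if "\<bar>q\<bar> \<le> 1" for q
  proof -
    have "\<bar>q * (1 - 2 * x) / V\<bar> = (\<bar>q\<bar> * \<bar>1 - 2 * x\<bar>) * (1 / V)" using V(1) by (simp add: abs_mult)
    also have "\<dots> \<le> (1 * 1) * (1 / m ^ 3)" using that c Vm V by (intro mult_mono) auto
    also have "\<dots> \<le> K" using m by (simp add: K_def divide_right_mono)
    finally show ?thesis .
  qed
  have y1: "\<bar>y1\<bar> \<le> K" and w1: "\<bar>w1\<bar> \<le> K"
    unfolding y1_def w1_def by (rule coef; simp)+
  have y: "\<bar>y - y1 * u\<bar> \<le> K * u\<^sup>2"
  proof -
    have "y - y1 * u = 2 * V / u\<^sup>2 * (bernoulli_kl x (x + u) - (u\<^sup>2 / (2 * V) - (1 - 2 * x) * u ^ 3 / (3 * V\<^sup>2)))"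
      using u(1) V(1) by (simp add: y_def y1_def field_simps power2_eq_square power3_eq_cube)
    then have "\<bar>y - y1 * u\<bar> = 2 * V / u\<^sup>2 * \<bar>bernoulli_kl x (x + u) - (u\<^sup>2 / (2 * V) - (1 - 2 * x) * u ^ 3 / (3 * V\<^sup>2))\<bar>"
      using V(1) by (simp add: abs_mult)
    \<comment> \<open>This estimate, with V \<le> 1, dictates K = 4 / m^3.\<close>
    also have "\<dots> \<le> 2 * 1 / u\<^sup>2 * (2 * u ^ 4 / m ^ 3)"
      using bernoulli_kl_taylor[OF m u2] V unfolding V_def[symmetric]
      by (intro mult_mono divide_right_mono) auto
    also have "\<dots> = K * u\<^sup>2" using u by (simp add: K_def power4_eq_xxxx power2_eq_square)
    finally show ?thesis .
  qed
  have w: "\<bar>w - w1 * u\<bar> \<le> K * u\<^sup>2"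
  proof -
    have "w - w1 * u = V / u * (logit_diff x (x + u) - (u / V - (1 - 2 * x) * u\<^sup>2 / (2 * V\<^sup>2)))"
      using u(1) V(1) by (simp add: w_def w1_def field_simps power2_eq_square)
    then have "\<bar>w - w1 * u\<bar> = V / \<bar>u\<bar> * \<bar>logit_diff x (x + u) - (u / V - (1 - 2 * x) * u\<^sup>2 / (2 * V\<^sup>2))\<bar>"
      using V(1) by (simp add: abs_mult)
    also have "\<dots> \<le> 1 / \<bar>u\<bar> * (2 * \<bar>u\<bar> ^ 3 / m ^ 3)"
      using logit_diff_taylor[OF m u2] V unfolding V_def[symmetric]
      by (intro mult_mono divide_right_mono) auto
    also have "\<dots> = 2 / m ^ 3 * u\<^sup>2" using u by (simp add: power3_eq_cube power2_eq_square)
    also have "\<dots> \<le> K * u\<^sup>2" using m by (intro mult_right_mono) (auto simp: K_def divide_right_mono)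
    finally show ?thesis .
  qed
  note P = sqrt_ln_perturbation[OF K y1 w1 y w u(2)]
  define S where "S = sqrt (1 + y)"
  have S: "1/2 \<le> S" unfolding S_def by (rule sqrt_one_plus_bounds(3)[OF P(3)])
  have root: "signed_root x (x + u) = u / \<sigma> * S"
  proof -
    have "2 * bernoulli_kl x (x + u) = (u / \<sigma>)\<^sup>2 * (1 + y)" unfolding kl V2 by (simp add: power_divide)
    then have "sqrt (2 * bernoulli_kl x (x + u)) = \<bar>u / \<sigma>\<bar> * S" by (simp add: S_def real_sqrt_mult)
    moreover have "sgn u * \<bar>u / \<sigma>\<bar> = u / \<sigma>" using \<sigma>(1) by (cases "0 < u") (auto simp: abs_divide sgn_if)
    ultimately show ?thesis by (simp only: signed_root_def add_diff_cancel_left' flip: mult.assoc)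
  qed
  have "signed_root x (x + u) - (u / \<sigma> - (1 - 2 * x) / (3 * \<sigma> ^ 3) * u\<^sup>2) = u / \<sigma> * (S - (1 + y1 / 2 * u))"
    unfolding root y1_def V2 using \<sigma>(1) by (simp add: field_simps power2_eq_square power3_eq_cube)
  then have "\<bar>signed_root x (x + u) - (u / \<sigma> - (1 - 2 * x) / (3 * \<sigma> ^ 3) * u\<^sup>2)\<bar> = \<bar>u\<bar> / \<sigma> * \<bar>S - (1 + y1 / 2 * u)\<bar>"
    using \<sigma>(1) by (simp add: abs_mult)
  also have "\<dots> \<le> \<bar>u\<bar> / m * (5 * K\<^sup>2 * u\<^sup>2)"
    using P(1) b m unfolding S_def by (intro mult_mono frac_le) auto
  also have "\<dots> = 5 * K\<^sup>2 / m * \<bar>u\<bar> ^ 3" by (simp add: power3_eq_cube power2_eq_square mult_ac flip: abs_mult)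
  finally show "\<bar>signed_root x (x + u) - (u / \<sigma> - (1 - 2 * x) / (3 * \<sigma> ^ 3) * u\<^sup>2)\<bar> \<le> 5 * K\<^sup>2 / m * \<bar>u\<bar> ^ 3" .
  have s\<sigma>: "sqrt (x * (1 - x)) = \<sigma>" using \<sigma> by (metis less_imp_le real_sqrt_unique)
  have "\<sigma> * logit_diff x (x + u) / signed_root x (x + u) = (1 + w) / S"
    using u(1) \<sigma>(1) S by (simp add: lo root V(2) power2_eq_square)
  moreover have "ln ((1 + w) / S) = ln (1 + w) - ln (1 + y) / 2"
  proof -
    have "0 < 1 + w" "0 < 1 + y" using P(3,4) by linarith+
    then show ?thesis by (simp add: ln_div S_def ln_sqrt)
  qed
  ultimately have "root_correction x (x + u) = (ln (1 + w) - ln (1 + y) / 2) / (u / \<sigma> * S)"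
    using u(1) by (simp add: root_correction_def s\<sigma> root)
  moreover have "- ((1 - 2 * x) / (6 * \<sigma>)) = (w1 - y1 / 2) * u * S / (u / \<sigma> * S)"
    using u(1) \<sigma>(1) S by (simp add: w1_def y1_def V(2) field_simps power2_eq_square)
  ultimately have "root_correction x (x + u) + (1 - 2 * x) / (6 * \<sigma>) =
      (ln (1 + w) - ln (1 + y) / 2 - (w1 - y1 / 2) * u * S) / (u / \<sigma> * S)"
    by (simp only: diff_divide_distrib)
  then have "\<bar>root_correction x (x + u) + (1 - 2 * x) / (6 * \<sigma>)\<bar> =
      \<bar>ln (1 + w) - ln (1 + y) / 2 - (w1 - y1 / 2) * u * S\<bar> * (\<sigma> / (\<bar>u\<bar> * S))"
    using \<sigma>(1) S by (simp add: abs_mult)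
  also have "\<dots> \<le> 18 * K\<^sup>2 * u\<^sup>2 * (1 / (\<bar>u\<bar> * (1/2)))"
    using P(2) b S u(1) \<sigma>(1) unfolding S_def[symmetric]
    by (intro mult_mono frac_le mult_left_mono mult_pos_pos) auto
  also have "\<dots> = 36 * K\<^sup>2 * \<bar>u\<bar>"
  proof -
    have *: "18 * K\<^sup>2 * (a * a) * (1 / (a * (1/2))) = 36 * K\<^sup>2 * a" if "a \<noteq> 0" for a
      using that by simp
    have "u\<^sup>2 = \<bar>u\<bar> * \<bar>u\<bar>" by (simp add: power2_eq_square)
    then show ?thesis by (simp only:) (rule *, use u(1) in simp)
  qed
  finally show "\<bar>root_correction x (x + u) + (1 - 2 * x) / (6 * \<sigma>)\<bar> \<le> 36 * K\<^sup>2 * \<bar>u\<bar>" .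
qed

text \<open>The divergences in the two directions add up to (\<theta> - x) times the logit
  difference, and the reversed one is nonnegative.\<close>

lemma bernoulli_kl_le_logit:
  assumes "0 < x" "x < 1" "0 < \<theta>" "\<theta> < 1"
  shows "bernoulli_kl x \<theta> \<le> (\<theta> - x) * logit_diff x \<theta>"
proof -
  have "0 \<le> bernoulli_kl \<theta> x"
    using bernoulli_kl_pinsker[of \<theta> x] assms zero_le_power2[of "x - \<theta>"] by linarith
  moreover have "bernoulli_kl x \<theta> + bernoulli_kl \<theta> x = (\<theta> - x) * logit_diff x \<theta>"
    using assms by (simp add: bernoulli_kl_def logit_diff_def ln_div algebra_simps)
  ultimately show ?thesis by linarith
qed

lemma signed_root_abs:
  assumes "0 < x" "x < 1" "0 < \<theta>" "\<theta> < 1"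
  shows "\<bar>signed_root x \<theta>\<bar> = sqrt (2 * bernoulli_kl x \<theta>)" "2 * \<bar>\<theta> - x\<bar> \<le> \<bar>signed_root x \<theta>\<bar>"
    "(signed_root x \<theta>)\<^sup>2 = 2 * bernoulli_kl x \<theta>"
proof -
  note p = bernoulli_kl_pinsker[OF assms]
  have kl0: "0 \<le> bernoulli_kl x \<theta>" using p zero_le_power2[of "\<theta> - x"] by linarith
  show a: "\<bar>signed_root x \<theta>\<bar> = sqrt (2 * bernoulli_kl x \<theta>)"
    using assms kl0 by (cases "\<theta> = x") (simp_all add: signed_root_def abs_mult)
  have "(2 * \<bar>\<theta> - x\<bar>)\<^sup>2 \<le> 2 * bernoulli_kl x \<theta>"
    using p by (simp add: power_mult_distrib)
  then show "2 * \<bar>\<theta> - x\<bar> \<le> \<bar>signed_root x \<theta>\<bar>" unfolding a by (rule real_le_rsqrt)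
  have "(signed_root x \<theta>)\<^sup>2 = \<bar>signed_root x \<theta>\<bar>\<^sup>2" by simp
  then show "(signed_root x \<theta>)\<^sup>2 = 2 * bernoulli_kl x \<theta>" using kl0 by (simp only: a) simp
qed

text \<open>Near 0 and 1 both the logit difference l and the root r diverge, so the logarithm of
  their quotient has to be bounded by a multiple of r. From below, \<open>r \<le> l\<close> follows
  from \<open>bernoulli_kl_le_logit\<close> and Pinsker. From above, m l is at most the divergence
  r^2 / 2 plus a constant, so l / r grows at most linearly in r.\<close>

lemma root_correction_far:
  fixes m x \<theta> \<delta> :: real
  assumes m: "0 < m" "m \<le> x" "x \<le> 1 - m" and \<theta>: "0 < \<theta>" "\<theta> < 1" and \<delta>: "0 < \<delta>" "\<delta> \<le> \<bar>\<theta> - x\<bar>"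
  shows "\<bar>root_correction x \<theta>\<bar> \<le> (1/2 + ln (1 / m) / (2 * \<delta>\<^sup>2)) / m + ln (1 / m) / (2 * \<delta>)"
proof -
  have x: "0 < x" "x < 1" using m by linarith+
  define \<sigma> where "\<sigma> = sqrt (x * (1 - x))"
  define k where "k = ln (1 / m)"
  define r where "r = \<bar>signed_root x \<theta>\<bar>"
  define l where "l = \<bar>logit_diff x \<theta>\<bar>"
  have \<sigma>: "0 < \<sigma>" "\<sigma>\<^sup>2 = x * (1 - x)" using x by (auto simp: \<sigma>_def)
  note b = variance_bounds[OF m \<sigma>]
  have k: "0 \<le> k" using m by (simp add: k_def)
  note s = signed_root_abs[OF x \<theta>]
  have r: "2 * \<delta> \<le> r" using s(2) \<delta> by (simp add: r_def)
  have kl: "r\<^sup>2 = 2 * bernoulli_kl x \<theta>" using s(3) by (simp add: r_def)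
  have "0 < r\<^sup>2" using r \<delta> by simp
  then have "0 < bernoulli_kl x \<theta>" using kl by simp
  then have pos: "0 < (\<theta> - x) * logit_diff x \<theta>" using bernoulli_kl_le_logit[OF x \<theta>] by linarith
  have lr: "logit_diff x \<theta> / signed_root x \<theta> = l / r"
  proof (cases "x < \<theta>")
    case True
    then have "0 < logit_diff x \<theta>" using pos by (simp add: zero_less_mult_iff)
    then show ?thesis using True \<open>0 < bernoulli_kl x \<theta>\<close> by (simp add: l_def r_def signed_root_def)
  next
    case False
    then have "\<theta> < x" "logit_diff x \<theta> < 0" using pos by (auto simp: zero_less_mult_iff)
    then show ?thesis using \<open>0 < bernoulli_kl x \<theta>\<close> by (simp add: l_def r_def signed_root_def)
  qed
  have "r * r = 2 * bernoulli_kl x \<theta>" using kl by (simp add: power2_eq_square)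
  also have "\<dots> \<le> 2 * \<bar>(\<theta> - x) * logit_diff x \<theta>\<bar>" using bernoulli_kl_le_logit[OF x \<theta>] by linarith
  also have "\<dots> = (2 * \<bar>\<theta> - x\<bar>) * l" by (simp add: abs_mult l_def)
  also have "\<dots> \<le> r * l" using s(2) by (intro mult_right_mono) (auto simp: r_def l_def)
  finally have "r \<le> l" using r \<delta> by simp
  then have "m \<le> \<sigma> * (l / r)" using b r \<delta> mult_mono[of m \<sigma> 1 "l / r"] m by simp
  then have ratio1: "m \<le> \<sigma> * l / r" by simp
  define a where "a = ln (x / \<theta>)"
  define b' where "b' = ln ((1 - x) / (1 - \<theta>))"
  have ge: "- k \<le> ln (c / e)" if "m \<le> c" "0 < e" "e < 1" for c e
  proof -
    have "m \<le> c / e" using that m mult_mono[of m c e 1] by (simp add: field_simps)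
    then have "ln m \<le> ln (c / e)" using m that by simp
    then show ?thesis using m by (simp add: k_def ln_div)
  qed
  have ab: "- k \<le> a" "- k \<le> b'" unfolding a_def b'_def using m \<theta> by (auto intro!: ge)
  \<comment> \<open>Since a and b' are at least - k, |a| \<le> a + 2 k and likewise for b'; the
    weights x and 1 - x, at least m, then rebuild the divergence.\<close>
  have "m * l \<le> m * (\<bar>a\<bar> + \<bar>b'\<bar>)"
  proof (rule mult_left_mono)
    have "logit_diff x \<theta> = b' - a" using x \<theta> by (simp add: logit_diff_def a_def b'_def ln_div)
    then show "l \<le> \<bar>a\<bar> + \<bar>b'\<bar>" by (simp add: l_def)
  qed (use m in simp)
  also have "\<dots> \<le> x * (a + 2 * k) + (1 - x) * (b' + 2 * k)"
    unfolding distrib_left[of m] using m ab k by (intro add_mono mult_mono) auto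
  also have "\<dots> = r\<^sup>2 / 2 + 2 * k"
  proof -
    have "r\<^sup>2 / 2 = x * a + (1 - x) * b'" by (simp add: kl bernoulli_kl_def a_def b'_def)
    then show ?thesis by (simp add: algebra_simps)
  qed
  finally have "l \<le> (r\<^sup>2 / 2 + 2 * k) / m" using m by (simp add: field_simps)
  then have "\<sigma> * l \<le> 1 * ((r\<^sup>2 / 2 + 2 * k) / m)" using b \<sigma>(1) by (intro mult_mono) (auto simp: l_def)
  then have "\<sigma> * l / r \<le> (r\<^sup>2 / 2 + 2 * k) / m / r" using r \<delta> by (intro divide_right_mono) auto
  also have "\<dots> = (r / 2 + 2 * k / r) / m" using r \<delta> m by (simp add: field_simps power2_eq_square)
  finally have ratio2: "\<sigma> * l / r \<le> (r / 2 + 2 * k / r) / m" .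
  define L where "L = ln (\<sigma> * l / r)"
  have rp: "0 < r" using r \<delta> by simp
  have "\<bar>root_correction x \<theta>\<bar> = \<bar>L\<bar> / r"
  proof -
    have "\<theta> \<noteq> x" using \<delta> by auto
    moreover have "\<sigma> * logit_diff x \<theta> / signed_root x \<theta> = \<sigma> * l / r"
      using lr by (simp only: times_divide_eq_right[symmetric])
    ultimately show ?thesis by (simp add: root_correction_def \<sigma>_def[symmetric] L_def r_def)
  qed
  moreover have "L \<le> (r / 2 + 2 * k / r) / m"
    using ln_le_minus_one[of "\<sigma> * l / r"] ratio1 ratio2 m by (simp add: L_def)
  moreover have "- k \<le> L"
  proof -
    have "ln m \<le> L" unfolding L_def using ratio1 m by simp
    then show ?thesis using m by (simp add: k_def ln_div)
  qed
  moreover have "0 \<le> (r / 2 + 2 * k / r) / m" using rp k m by simp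
  ultimately have "\<bar>root_correction x \<theta>\<bar> \<le> ((r / 2 + 2 * k / r) / m + k) / r"
    using rp k by (simp add: divide_right_mono abs_le_iff)
  also have "\<dots> = (1/2 + 2 * k / (r * r)) / m + k / r"
    using rp m by (simp add: field_simps)
  also have "\<dots> \<le> (1/2 + 2 * k / ((2 * \<delta>) * (2 * \<delta>))) / m + k / (2 * \<delta>)"
    using r \<delta> k m rp by (intro add_mono divide_right_mono divide_left_mono mult_mono mult_pos_pos) auto
  also have "\<dots> = (1/2 + k / (2 * \<delta>\<^sup>2)) / m + k / (2 * \<delta>)" by (simp add: power2_eq_square)
  finally show ?thesis by (simp add: k_def)
qed

text \<open>Boundedness over the whole open unit interval is what turns the defining equation into
  \<open>signed_root\<close> = O(\<epsilon>), before the solution is known to lie near x.\<close>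

lemma root_correction_bounded:
  fixes m :: real
  assumes m: "0 < m"
  obtains C where "0 < C" "\<And>x \<theta>. m \<le> x \<Longrightarrow> x \<le> 1 - m \<Longrightarrow> 0 < \<theta> \<Longrightarrow> \<theta> < 1 \<Longrightarrow> \<bar>root_correction x \<theta>\<bar> \<le> C"
proof -
  define K where "K = 4 / m ^ 3"
  \<comment> \<open>The radius up to which \<open>signed_root_near\<close> applies.\<close>
  define \<delta> where "\<delta> = 1 / (4 * K)"
  define C1 where "C1 = \<bar>(1/2 + ln (1 / m) / (2 * \<delta>\<^sup>2)) / m + ln (1 / m) / (2 * \<delta>)\<bar>"
  define C2 where "C2 = 36 * K\<^sup>2 * \<delta> + 1 / m"
  have K: "0 < K" using m by (simp add: K_def)
  then have \<delta>: "0 < \<delta>" by (simp add: \<delta>_def)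
  have C12: "0 \<le> C1" "0 < C2" using m K \<delta> by (auto simp: C1_def C2_def intro!: add_pos_pos mult_pos_pos)
  show ?thesis
  proof (rule that[of "C1 + C2"])
    fix x \<theta> :: real
    assume x: "m \<le> x" "x \<le> 1 - m" and \<theta>: "0 < \<theta>" "\<theta> < 1"
    have x': "0 < x" "x < 1" using x m by linarith+
    define \<sigma> where "\<sigma> = sqrt (x * (1 - x))"
    have \<sigma>: "0 < \<sigma>" "\<sigma>\<^sup>2 = x * (1 - x)" using x' by (auto simp: \<sigma>_def)
    have lead: "\<bar>(1 - 2 * x) / (6 * \<sigma>)\<bar> \<le> 1 / m"
    proof -
      have "\<bar>(1 - 2 * x) / (6 * \<sigma>)\<bar> = \<bar>(1 - 2 * x) / (3 * \<sigma>)\<bar> / 2" using \<sigma>(1) by (simp add: abs_divide)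
      moreover have "A \<le> c" if "A = B / 2" "B \<le> c" "0 \<le> B" for A B c :: real using that by linarith
      ultimately show ?thesis using edgeworth_coefficient_bounds(1)[OF m x \<sigma> order_refl zero_le_one] abs_ge_zero by blast
    qed
    show "\<bar>root_correction x \<theta>\<bar> \<le> C1 + C2"
    proof (cases "\<theta> = x")
      case True
      then have "root_correction x \<theta> = - ((1 - 2 * x) / (6 * \<sigma>))"
        by (simp add: root_correction_def \<sigma>_def minus_divide_left)
      then have "\<bar>root_correction x \<theta>\<bar> = \<bar>(1 - 2 * x) / (6 * \<sigma>)\<bar>" by (simp only: abs_minus_cancel)
      also have "\<dots> \<le> C2" using lead K \<delta> by (simp add: C2_def add_increasing)
      finally show ?thesis using C12 by simp
    next
      case False
      show ?thesis
      proof (cases "\<bar>\<theta> - x\<bar> \<le> \<delta>")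
        case near: True
        have "4 * K * \<bar>\<theta> - x\<bar> \<le> 1" using near K by (simp add: \<delta>_def field_simps)
        then have "\<bar>root_correction x \<theta> + (1 - 2 * x) / (6 * \<sigma>)\<bar> \<le> 36 * K\<^sup>2 * \<bar>\<theta> - x\<bar>"
          using signed_root_near(2)[OF m x \<sigma>, of "\<theta> - x"] False by (simp add: K_def)
        also have "\<dots> \<le> 36 * K\<^sup>2 * \<delta>" using near by (intro mult_left_mono) auto
        finally have "\<bar>root_correction x \<theta> + (1 - 2 * x) / (6 * \<sigma>)\<bar> \<le> 36 * K\<^sup>2 * \<delta>" .
        moreover have "\<bar>a\<bar> \<le> C1 + (P + Q)" if "\<bar>a + h\<bar> \<le> P" "\<bar>h\<bar> \<le> Q" for a h P Q :: real
          using that C12(1) by linarith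
        ultimately show ?thesis using lead unfolding C2_def by blast
      next
        case far: False
        then show ?thesis using root_correction_far[OF m x \<theta> \<delta>] C12 by (simp add: C1_def)
      qed
    qed
  qed (use C12 in simp)
qed

text \<open>\<open>modified_loglik_root\<close> takes a \<open>Lim\<close> at \<theta> = X / n, and
  its value there is known only once the limit is shown to exist.\<close>

lemma tendsto_root_correction:
  assumes x: "0 < x" "x < 1"
  shows "(root_correction x \<longlongrightarrow> root_correction x x) (at x)"
proof -
  define m where "m = min x (1 - x)"
  define K where "K = 4 / m ^ 3"
  define \<sigma> where "\<sigma> = sqrt (x * (1 - x))"
  have m: "0 < m" "m \<le> x" "x \<le> 1 - m" using x by (auto simp: m_def)
  have \<sigma>: "0 < \<sigma>" "\<sigma>\<^sup>2 = x * (1 - x)" using x by (auto simp: \<sigma>_def)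
  have K: "0 < K" using m by (simp add: K_def)
  have "((\<lambda>\<theta>. root_correction x \<theta> - root_correction x x) \<longlongrightarrow> 0) (at x)"
  proof (rule Lim_null_comparison)
    show "((\<lambda>\<theta>. 36 * K\<^sup>2 * \<bar>\<theta> - x\<bar>) \<longlongrightarrow> 0) (at x)"
      by (rule tendsto_eq_intros refl)+ simp
    have "\<forall>\<^sub>F \<theta> in at x. \<theta> \<noteq> x \<and> dist \<theta> x < 1 / (4 * K)"
      unfolding eventually_at using K by (intro exI[of _ "1 / (4 * K)"]) auto
    then show "\<forall>\<^sub>F \<theta> in at x. norm (root_correction x \<theta> - root_correction x x) \<le> 36 * K\<^sup>2 * \<bar>\<theta> - x\<bar>"
    proof eventually_elim
      case (elim \<theta>)
      then have "4 * K * \<bar>\<theta> - x\<bar> \<le> 1" using K by (simp add: dist_real_def field_simps)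
      then have "\<bar>root_correction x \<theta> + (1 - 2 * x) / (6 * \<sigma>)\<bar> \<le> 36 * K\<^sup>2 * \<bar>\<theta> - x\<bar>"
        using signed_root_near(2)[OF m \<sigma>, of "\<theta> - x"] elim by (simp add: K_def)
      moreover have "root_correction x x = - ((1 - 2 * x) / (6 * \<sigma>))"
        by (simp add: root_correction_def \<sigma>_def minus_divide_left)
      ultimately show ?case by simp
    qed
  qed
  then show ?thesis by (simp add: LIM_zero_cancel)
qed

lemma tendsto_signed_root:
  assumes x: "0 < x" "x < 1"
  shows "(signed_root x \<longlongrightarrow> 0) (at x)"
proof (rule Lim_null_comparison)
  have "isCont (bernoulli_kl x) x" by (rule DERIV_isCont[OF has_real_derivative_bernoulli_kl[OF x x]])
  then have "(bernoulli_kl x \<longlongrightarrow> 0) (at x)" using x by (simp add: isCont_def)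
  from tendsto_real_sqrt[OF tendsto_mult_left[OF this, of 2]]
  show "((\<lambda>\<theta>. sqrt (2 * bernoulli_kl x \<theta>)) \<longlongrightarrow> 0) (at x)" by simp
  have "\<forall>\<^sub>F \<theta> in at x. 0 < \<theta> \<and> \<theta> < 1"
    using x eventually_at_in_open'[of "{0<..<1}" x] by simp
  then show "\<forall>\<^sub>F \<theta> in at x. norm (signed_root x \<theta>) \<le> sqrt (2 * bernoulli_kl x \<theta>)"
    by eventually_elim (use signed_root_abs(1)[OF x] in auto)
qed

text \<open>Both r and Q contain n through a factor sqrt n, which cancels in Q / r. Only the outer 1
  / r keeps it, so the correction is 1 / sqrt n times a function of x and \<theta>.\<close>

lemma modified_loglik_root_eq:
  fixes n X :: nat and \<theta> :: real
  defines "x \<equiv> real X / real n"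
  assumes X: "0 < X" "X < n" and \<theta>: "0 < \<theta>" "\<theta> < 1"
  shows "modified_loglik_root n X \<theta> = - (sqrt n * signed_root x \<theta> + root_correction x \<theta> / sqrt n)"
proof -
  define f where "f = (\<lambda>t. loglik_root n X t + ln (wald_logit n X t / loglik_root n X t) / loglik_root n X t)"
  have x: "0 < x" "x < 1" using X by (auto simp: x_def)
  have n: "0 < real n" using X by simp
  have nx: "real X = n * x" using X by (simp add: x_def)
  have f: "f t = - (sqrt n * signed_root x t + root_correction x t / sqrt n)" if t: "0 < t" "t < 1" "t \<noteq> x" for t
  proof -
    have "loglik n X x - loglik n X t = n * bernoulli_kl x t"
      using x t unfolding loglik_def bernoulli_kl_def nx by (simp add: ln_div algebra_simps)
    then have "loglik_root n X t = sgn (x - t) * sqrt (n * (2 * bernoulli_kl x t))"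
      unfolding loglik_root_def Let_def x_def[symmetric] by (simp add: mult_ac)
    also have "\<dots> = - (sqrt n * signed_root x t)"
      using sgn_minus[of "t - x"] by (simp add: signed_root_def real_sqrt_mult)
    finally have root: "loglik_root n X t = - (sqrt n * signed_root x t)" .
    have "wald_logit n X t = - (sqrt n * (sqrt (x * (1 - x)) * logit_diff x t))"
    proof -
      have "sqrt (n * x * (1 - x)) = sqrt n * sqrt (x * (1 - x))" by (simp only: mult.assoc real_sqrt_mult)
      then show ?thesis
        unfolding wald_logit_def Let_def x_def[symmetric] logit_diff_def by (simp add: algebra_simps)
    qed
    then have "wald_logit n X t / loglik_root n X t = sqrt (x * (1 - x)) * logit_diff x t / signed_root x t"
      using n by (simp add: root)
    then have "f t = - (sqrt n * signed_root x t) +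
        ln (sqrt (x * (1 - x)) * logit_diff x t / signed_root x t) / (- (sqrt n * signed_root x t))"
      by (simp only: f_def root)
    then show ?thesis using t by (simp add: root_correction_def divide_divide_eq_left mult.commute)
  qed
  show ?thesis
  proof (cases "\<theta> = x")
    case False
    then have "modified_loglik_root n X \<theta> = f \<theta>"
      by (simp add: modified_loglik_root_def Let_def f_def x_def)
    then show ?thesis using f[OF \<theta> False] by simp
  next
    case True
    have "((\<lambda>t. - (sqrt n * signed_root x t + root_correction x t / sqrt n)) \<longlongrightarrow>
        - (sqrt n * 0 + root_correction x x / sqrt n)) (at x)"
      using n by (intro tendsto_intros tendsto_signed_root tendsto_root_correction x) auto
    moreover have "\<forall>\<^sub>F t in at x. - (sqrt n * signed_root x t + root_correction x t / sqrt n) = f t"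
      using eventually_at_in_open[of "{0<..<1}" x] x f by (auto elim!: eventually_mono)
    ultimately have "(f \<longlongrightarrow> - (sqrt n * 0 + root_correction x x / sqrt n)) (at x)"
      by (rule Lim_transform_eventually)
    then have "Lim (at x) f = - (sqrt n * 0 + root_correction x x / sqrt n)"
      by (rule tendsto_Lim[OF trivial_limit_at])
    moreover have "modified_loglik_root n X \<theta> = Lim (at x) f"
      using True by (simp add: modified_loglik_root_def Let_def f_def x_def)
    moreover have "signed_root x x = 0" using x by (simp add: signed_root_def)
    ultimately show ?thesis using True by simp
  qed
qed

text \<open>Bootstrapping: the bounded correction gives |r| \<le> B \<epsilon>, and Pinsker the same
  for u = \<theta> - x, so the local expansions apply. They give u / \<sigma> = \<epsilon> z + P
  with |P| \<le> D \<epsilon>^2, and inserting this into the quadratic term leaves an error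
  O(\<epsilon>^3).\<close>

lemma root_equation_expansion:
  fixes m x \<sigma> \<epsilon> z \<theta> C :: real
  defines "K \<equiv> 4 / m ^ 3"
  defines "B \<equiv> \<bar>z\<bar> + C"
  defines "C1 \<equiv> 5 * K\<^sup>2 / m"
  defines "D \<equiv> C + 1 / m ^ 3 * B\<^sup>2 + C1 * B ^ 3"
  assumes m: "0 < m" "m \<le> x" "x \<le> 1 - m" and \<sigma>: "0 < \<sigma>" "\<sigma>\<^sup>2 = x * (1 - x)"
    and \<theta>: "0 < \<theta>" "\<theta> < 1" and \<epsilon>: "0 < \<epsilon>" "\<epsilon> \<le> 1" "4 * K * B * \<epsilon> \<le> 1"
    and C: "0 < C" "\<bar>root_correction x \<theta>\<bar> \<le> C"
    and eq: "signed_root x \<theta> = \<epsilon> * z - \<epsilon>\<^sup>2 * root_correction x \<theta>"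
  shows "\<bar>\<theta> - (x + z * \<sigma> * \<epsilon> + (1 - 2 * x) * (z\<^sup>2 / 3 + 1/6) * \<epsilon>\<^sup>2)\<bar>
    \<le> (36 * K\<^sup>2 * B + 1 / m ^ 3 * (D * (D + 2 * \<bar>z\<bar>)) + C1 * B ^ 3) * \<epsilon> ^ 3"
proof -
  have x: "0 < x" "x < 1" using m by linarith+
  note b = variance_bounds[OF m \<sigma>]
  have m1: "m \<le> 1" using m by linarith
  have K: "0 < K" using m by (simp add: K_def)
  have C1: "0 \<le> C1" using m K by (simp add: C1_def)
  have B: "0 < B" using C by (simp add: B_def add_nonneg_pos)
  have D: "0 \<le> D" using C B C1 m by (simp add: D_def)
  have e2: "\<epsilon>\<^sup>2 \<le> \<epsilon>" "\<epsilon> ^ 3 \<le> \<epsilon>\<^sup>2" using \<epsilon> power_decreasing[of 1 2 \<epsilon>] power_decreasing[of 2 3 \<epsilon>] by auto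
  define r where "r = signed_root x \<theta>"
  define \<kappa> where "\<kappa> = root_correction x \<theta>"
  define u where "u = \<theta> - x"
  define h where "h = (1 - 2 * x) / (6 * \<sigma>)"
  define g where "g = (1 - 2 * x) / (3 * \<sigma> ^ 3)"
  have "\<epsilon>\<^sup>2 * \<bar>\<kappa>\<bar> \<le> \<epsilon> * C" using C e2 \<epsilon>(1) by (intro mult_mono) (auto simp: \<kappa>_def)
  moreover have "\<bar>r\<bar> \<le> \<epsilon> * \<bar>z\<bar> + \<epsilon>\<^sup>2 * \<bar>\<kappa>\<bar>"
    using abs_triangle_ineq4[of "\<epsilon> * z" "\<epsilon>\<^sup>2 * \<kappa>"] \<epsilon>(1) by (simp add: r_def eq \<kappa>_def abs_mult)
  ultimately have rB: "\<bar>r\<bar> \<le> B * \<epsilon>" by (simp add: B_def algebra_simps)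
  have uB: "\<bar>u\<bar> \<le> B * \<epsilon>"
  proof -
    have "\<bar>u\<bar> \<le> 2 * \<bar>u\<bar>" by simp
    also have "\<dots> \<le> \<bar>r\<bar>" unfolding u_def r_def by (rule signed_root_abs(2)[OF x \<theta>])
    also note rB
    finally show ?thesis .
  qed
  have near: "4 * K * \<bar>u\<bar> \<le> 1"
  proof -
    have "4 * K * \<bar>u\<bar> \<le> 4 * K * (B * \<epsilon>)" using uB K by (intro mult_left_mono) auto
    then show ?thesis using \<epsilon>(3) by (simp add: mult.assoc)
  qed
  have n: "\<bar>r - (u / \<sigma> - g * u\<^sup>2)\<bar> \<le> C1 * \<bar>u\<bar> ^ 3" "\<bar>\<kappa> + h\<bar> \<le> 36 * K\<^sup>2 * \<bar>u\<bar>"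
  proof -
    have "\<bar>r - (u / \<sigma> - g * u\<^sup>2)\<bar> \<le> C1 * \<bar>u\<bar> ^ 3 \<and> \<bar>\<kappa> + h\<bar> \<le> 36 * K\<^sup>2 * \<bar>u\<bar>"
    proof (cases "u = 0")
      case True
      have "sqrt (x * (1 - x)) = \<sigma>" using \<sigma> by (metis less_imp_le real_sqrt_unique)
      then have "\<kappa> = - h" "r = 0"
        using True by (simp_all add: \<kappa>_def h_def r_def u_def root_correction_def signed_root_def minus_divide_left)
      then show ?thesis using True by simp
    next
      case False
      have "x + u = \<theta>" by (simp add: u_def)
      then show ?thesis
        using signed_root_near[OF m \<sigma> False near[unfolded K_def]]
        by (simp add: r_def \<kappa>_def g_def h_def C1_def K_def)
    qed
    then show "\<bar>r - (u / \<sigma> - g * u\<^sup>2)\<bar> \<le> C1 * \<bar>u\<bar> ^ 3" "\<bar>\<kappa> + h\<bar> \<le> 36 * K\<^sup>2 * \<bar>u\<bar>" by auto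
  qed
  define E where "E = r - (u / \<sigma> - g * u\<^sup>2)"
  have "C1 * \<bar>u\<bar> ^ 3 \<le> C1 * (B * \<epsilon>) ^ 3" using uB C1 by (intro mult_left_mono power_mono) auto
  then have E: "\<bar>E\<bar> \<le> C1 * B ^ 3 * \<epsilon> ^ 3" using n(1) by (simp add: E_def power_mult_distrib mult.assoc)
  have "36 * K\<^sup>2 * \<bar>u\<bar> \<le> 36 * K\<^sup>2 * (B * \<epsilon>)" using uB by (intro mult_left_mono) auto
  then have kh: "\<bar>\<kappa> + h\<bar> \<le> 36 * K\<^sup>2 * B * \<epsilon>" using n(2) by (simp add: mult.assoc)
  have g: "\<bar>g\<bar> \<le> 1 / m ^ 3"
  proof -
    have "m ^ 3 \<le> \<sigma> ^ 3" using b m by (intro power_mono) auto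
    then have "m ^ 3 \<le> 3 * \<sigma> ^ 3" using zero_less_power[OF \<sigma>(1), of 3] by linarith
    then have "\<bar>1 - 2 * x\<bar> * m ^ 3 \<le> 1 * (3 * \<sigma> ^ 3)" using x m \<sigma>(1) by (intro mult_mono) auto
    then show ?thesis using m \<sigma>(1) by (simp add: g_def abs_divide field_simps)
  qed
  define P where "P = u / \<sigma> - \<epsilon> * z"
  have P: "P = - (\<epsilon>\<^sup>2 * \<kappa>) + g * u\<^sup>2 - E" using eq by (simp add: P_def E_def r_def \<kappa>_def)
  have "\<bar>g * u\<^sup>2\<bar> \<le> 1 / m ^ 3 * (B * \<epsilon>)\<^sup>2"
  proof -
    have "\<bar>u\<bar>\<^sup>2 \<le> (B * \<epsilon>)\<^sup>2" using uB by (intro power_mono) auto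
    then show ?thesis using g m unfolding abs_mult by (intro mult_mono) auto
  qed
  moreover have "\<bar>\<epsilon>\<^sup>2 * \<kappa>\<bar> \<le> \<epsilon>\<^sup>2 * C" using C by (simp add: abs_mult \<kappa>_def mult_left_mono)
  moreover have "C1 * B ^ 3 * \<epsilon> ^ 3 \<le> C1 * B ^ 3 * \<epsilon>\<^sup>2" using e2 C1 B by (intro mult_left_mono) auto
  ultimately have "\<bar>P\<bar> \<le> \<epsilon>\<^sup>2 * C + 1 / m ^ 3 * (B * \<epsilon>)\<^sup>2 + C1 * B ^ 3 * \<epsilon>\<^sup>2"
    using E unfolding P by linarith
  then have PD: "\<bar>P\<bar> \<le> D * \<epsilon>\<^sup>2" by (simp add: D_def power_mult_distrib algebra_simps)
  have "D * \<epsilon>\<^sup>2 \<le> D * \<epsilon>" using e2 D by (intro mult_left_mono) auto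
  moreover have "\<bar>P + 2 * (\<epsilon> * z)\<bar> \<le> \<bar>P\<bar> + 2 * \<bar>z\<bar> * \<epsilon>"
    using abs_triangle_ineq[of P "2 * (\<epsilon> * z)"] \<epsilon>(1) by (simp add: abs_mult mult_ac)
  ultimately have P2: "\<bar>P + 2 * (\<epsilon> * z)\<bar> \<le> (D + 2 * \<bar>z\<bar>) * \<epsilon>" using PD by (simp add: distrib_right)
  have u\<sigma>: "u = \<sigma> * (P + \<epsilon> * z)" using \<sigma>(1) by (simp add: P_def)
  have diff: "u\<^sup>2 - \<sigma>\<^sup>2 * (\<epsilon>\<^sup>2 * z\<^sup>2) = \<sigma>\<^sup>2 * (P * (P + 2 * (\<epsilon> * z)))"
    unfolding u\<sigma> by (simp add: power2_eq_square algebra_simps)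
  have PP: "\<bar>P\<bar> * \<bar>P + 2 * (\<epsilon> * z)\<bar> \<le> (D * \<epsilon>\<^sup>2) * ((D + 2 * \<bar>z\<bar>) * \<epsilon>)"
    using PD P2 D by (intro mult_mono) auto
  have "\<sigma>\<^sup>2 \<le> 1" using b \<sigma>(1) by (intro power_le_one) auto
  from mult_mono[OF this PP] have "\<sigma>\<^sup>2 * (\<bar>P\<bar> * \<bar>P + 2 * (\<epsilon> * z)\<bar>) \<le> 1 * ((D * \<epsilon>\<^sup>2) * ((D + 2 * \<bar>z\<bar>) * \<epsilon>))" by simp
  then have "\<bar>u\<^sup>2 - \<sigma>\<^sup>2 * (\<epsilon>\<^sup>2 * z\<^sup>2)\<bar> \<le> D * (D + 2 * \<bar>z\<bar>) * \<epsilon> ^ 3"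
    using \<sigma>(1) unfolding diff by (simp add: abs_mult power2_eq_square power3_eq_cube mult_ac)
  then have "\<bar>g\<bar> * \<bar>u\<^sup>2 - \<sigma>\<^sup>2 * (\<epsilon>\<^sup>2 * z\<^sup>2)\<bar> \<le> 1 / m ^ 3 * (D * (D + 2 * \<bar>z\<bar>) * \<epsilon> ^ 3)"
    using g m by (intro mult_mono) auto
  then have G: "\<bar>g * (u\<^sup>2 - \<sigma>\<^sup>2 * (\<epsilon>\<^sup>2 * z\<^sup>2))\<bar> \<le> 1 / m ^ 3 * (D * (D + 2 * \<bar>z\<bar>)) * \<epsilon> ^ 3"
    by (simp only: abs_mult mult.assoc)
  have "\<epsilon>\<^sup>2 * \<bar>\<kappa> + h\<bar> \<le> \<epsilon>\<^sup>2 * (36 * K\<^sup>2 * B * \<epsilon>)" using kh by (intro mult_left_mono) auto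
  moreover have "\<epsilon>\<^sup>2 * (36 * K\<^sup>2 * B * \<epsilon>) = 36 * K\<^sup>2 * B * \<epsilon> ^ 3"
    by (simp only: power2_eq_square power3_eq_cube mult_ac)
  moreover have "\<bar>\<epsilon>\<^sup>2 * (\<kappa> + h)\<bar> = \<epsilon>\<^sup>2 * \<bar>\<kappa> + h\<bar>" by (simp add: abs_mult)
  ultimately have H: "\<bar>\<epsilon>\<^sup>2 * (\<kappa> + h)\<bar> \<le> 36 * K\<^sup>2 * B * \<epsilon> ^ 3" by linarith
  \<comment> \<open>Subtracted is the \<epsilon>^2 part of P: the correction contributes h, and g
    u^2 with u about \<sigma> \<epsilon> z contributes g \<sigma>^2 z^2. Times \<sigma>, these are
    (1 - 2 x) / 6 and (1 - 2 x) z^2 / 3.\<close>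
  define Q where "Q = P - (\<epsilon>\<^sup>2 * h + g * (\<sigma>\<^sup>2 * (\<epsilon>\<^sup>2 * z\<^sup>2)))"
  have "Q = - (\<epsilon>\<^sup>2 * (\<kappa> + h)) + g * (u\<^sup>2 - \<sigma>\<^sup>2 * (\<epsilon>\<^sup>2 * z\<^sup>2)) - E"
    unfolding Q_def P by (simp add: algebra_simps)
  then have "\<bar>Q\<bar> \<le> 36 * K\<^sup>2 * B * \<epsilon> ^ 3 + 1 / m ^ 3 * (D * (D + 2 * \<bar>z\<bar>)) * \<epsilon> ^ 3 + C1 * B ^ 3 * \<epsilon> ^ 3"
    using H G E by linarith
  then have Q: "\<bar>Q\<bar> \<le> (36 * K\<^sup>2 * B + 1 / m ^ 3 * (D * (D + 2 * \<bar>z\<bar>)) + C1 * B ^ 3) * \<epsilon> ^ 3"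
    by (simp only: distrib_right)
  have sh: "\<sigma> * h = (1 - 2 * x) / 6" and sg: "\<sigma> * (g * \<sigma>\<^sup>2) = (1 - 2 * x) / 3"
    using \<sigma>(1) by (simp_all add: h_def g_def power2_eq_square power3_eq_cube)
  have "\<sigma> * Q = u - z * \<sigma> * \<epsilon> - ((\<sigma> * h) + (\<sigma> * (g * \<sigma>\<^sup>2)) * z\<^sup>2) * \<epsilon>\<^sup>2"
    unfolding u\<sigma> Q_def by (simp add: algebra_simps)
  also have "(\<sigma> * h) + (\<sigma> * (g * \<sigma>\<^sup>2)) * z\<^sup>2 = (1 - 2 * x) * (z\<^sup>2 / 3 + 1/6)"
    unfolding sh sg by (simp add: field_simps)
  finally have "\<bar>u - z * \<sigma> * \<epsilon> - (1 - 2 * x) * (z\<^sup>2 / 3 + 1/6) * \<epsilon>\<^sup>2\<bar> = \<bar>\<sigma> * Q\<bar>" by simp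
  also have "\<dots> = \<sigma> * \<bar>Q\<bar>" using \<sigma>(1) by (simp add: abs_mult)
  also have "\<dots> \<le> 1 * \<bar>Q\<bar>" using b by (intro mult_right_mono) auto
  finally have "\<bar>u - z * \<sigma> * \<epsilon> - (1 - 2 * x) * (z\<^sup>2 / 3 + 1/6) * \<epsilon>\<^sup>2\<bar> \<le> \<bar>Q\<bar>" by simp
  then show ?thesis using Q unfolding u_def by (simp add: algebra_simps)
qed

text \<open>The localisation applies to every solution in the open unit interval, so U may select
  any root of the equation.\<close>

lemma modified_loglik_root_expansion:
  assumes U: "is_modified_loglik_root_bound \<alpha> U"
  shows "second_order_expansion \<alpha> 0 U"
  unfolding second_order_expansion_def Let_def
proof (intro allI impI)
  fix m :: real assume m: "0 < m"
  define z where "z = upper_normal_quantile \<alpha>"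
  obtain C where C: "0 < C"
    "\<And>x \<theta>. m \<le> x \<Longrightarrow> x \<le> 1 - m \<Longrightarrow> 0 < \<theta> \<Longrightarrow> \<theta> < 1 \<Longrightarrow> \<bar>root_correction x \<theta>\<bar> \<le> C"
    using root_correction_bounded[OF m] by blast
  define K where "K = 4 / m ^ 3"
  define B where "B = \<bar>z\<bar> + C"
  define C1 where "C1 = 5 * K\<^sup>2 / m"
  define D where "D = C + 1 / m ^ 3 * B\<^sup>2 + C1 * B ^ 3"
  show "\<exists>K N. \<forall>n X. N \<le> real n \<longrightarrow> 1 \<le> n \<longrightarrow> m \<le> real X / real n \<longrightarrow> real X / real n \<le> 1 - m \<longrightarrow>
      \<bar>U n X - (real X / real n + upper_normal_quantile \<alpha> * sqrt (real X / real n * (1 - real X / real n)) / sqrt (real n) +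
         ((1 - 2 * (real X / real n)) * ((upper_normal_quantile \<alpha>)\<^sup>2 / 3 + 1/6) + 0) / real n)\<bar> \<le> K * real n powr (- 3/2)"
  proof (intro exI allI impI)
    fix n X :: nat
    \<comment> \<open>This threshold is the condition 4 K B \<epsilon> \<le> 1 of
      \<open>root_equation_expansion\<close>.\<close>
    assume n: "(4 * K * B)\<^sup>2 \<le> real n" and n1: "1 \<le> n" and X: "m \<le> real X / real n" "real X / real n \<le> 1 - m"
    define x where "x = real X / real n"
    define \<sigma> where "\<sigma> = sqrt (x * (1 - x))"
    define \<epsilon> where "\<epsilon> = 1 / sqrt n"
    have x: "0 < x" "x < 1" using m X by (auto simp: x_def)
    then have X': "0 < X" "X < n" using n1 by (auto simp: x_def zero_less_divide_iff)
    have \<sigma>: "0 < \<sigma>" "\<sigma>\<^sup>2 = x * (1 - x)" using x by (auto simp: \<sigma>_def)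
    have \<epsilon>: "0 < \<epsilon>" "\<epsilon> \<le> 1" using n1 by (auto simp: \<epsilon>_def)
    have "4 * K * B \<le> sqrt n" using n by (rule real_le_rsqrt)
    then have e: "4 * K * B * \<epsilon> \<le> 1" using n1 by (simp add: \<epsilon>_def)
    have \<theta>: "0 < U n X" "U n X < 1" and "modified_loglik_root n X (U n X) = - z"
      using U X' unfolding is_modified_loglik_root_bound_def z_def by auto
    then have "sqrt n * signed_root x (U n X) + root_correction x (U n X) / sqrt n = z"
      using modified_loglik_root_eq[OF X' \<theta>] by (simp add: x_def)
    then have "sqrt n * signed_root x (U n X) + root_correction x (U n X) * \<epsilon> = z" by (simp add: \<epsilon>_def)
    then have "\<epsilon> * z = \<epsilon> * (sqrt n * signed_root x (U n X) + root_correction x (U n X) * \<epsilon>)" by simp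
    also have "\<dots> = (\<epsilon> * sqrt n) * signed_root x (U n X) + \<epsilon>\<^sup>2 * root_correction x (U n X)"
      by (simp only: power2_eq_square distrib_left mult_ac)
    also have "\<epsilon> * sqrt n = 1" using n1 by (simp add: \<epsilon>_def)
    finally have "signed_root x (U n X) = \<epsilon> * z - \<epsilon>\<^sup>2 * root_correction x (U n X)" by simp
    from root_equation_expansion[OF m X[folded x_def] \<sigma> \<theta> \<epsilon> e[unfolded K_def B_def] C(1) C(2)[OF X[folded x_def] \<theta>] this]
    have main: "\<bar>U n X - (x + z * \<sigma> * \<epsilon> + (1 - 2 * x) * (z\<^sup>2 / 3 + 1/6) * \<epsilon>\<^sup>2)\<bar>
        \<le> (36 * K\<^sup>2 * B + 1 / m ^ 3 * (D * (D + 2 * \<bar>z\<bar>)) + C1 * B ^ 3) * \<epsilon> ^ 3"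
      unfolding K_def[symmetric] B_def[symmetric] C1_def[symmetric] D_def[symmetric] .
    have e1: "z * \<sigma> * \<epsilon> = z * \<sigma> / sqrt n" by (simp add: \<epsilon>_def)
    have e2: "\<epsilon>\<^sup>2 = 1 / n" using n1 by (simp add: \<epsilon>_def power_divide)
    have e3: "\<epsilon> ^ 3 = n powr (- 3/2)"
    proof -
      have "\<epsilon> = n powr (- 1/2)" using n1 by (simp add: \<epsilon>_def powr_minus_divide powr_half_sqrt)
      then have "\<epsilon> ^ 3 = n powr (- 1/2 * 3)" using n1 by (simp add: powr_power)
      then show ?thesis by simp
    qed
    from main show "\<bar>U n X - (real X / real n + upper_normal_quantile \<alpha> * sqrt (real X / real n * (1 - real X / real n)) / sqrt (real n) +
         ((1 - 2 * (real X / real n)) * ((upper_normal_quantile \<alpha>)\<^sup>2 / 3 + 1/6) + 0) / real n)\<bar> \<le>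
         (36 * K\<^sup>2 * B + 1 / m ^ 3 * (D * (D + 2 * \<bar>z\<bar>)) + C1 * B ^ 3) * real n powr (- 3/2)"
      unfolding e1 e2 e3 by (simp add: \<sigma>_def x_def z_def)
  qed
qed

section \<open>The second-order correct bound\<close>

lemma second_order_bound_expansion: "second_order_expansion \<alpha> 0 (second_order_bound \<alpha>)"
  unfolding second_order_expansion_def Let_def
proof (intro allI impI)
  fix m :: real assume m: "0 < m"
  define z where "z = upper_normal_quantile \<alpha>"
  define \<eta> where "\<eta> = z\<^sup>2 / 3 + 1/6"
  define \<gamma>1 where "\<gamma>1 = - (13/18 * z\<^sup>2 + 17/18)"
  define \<gamma>2 where "\<gamma>2 = z\<^sup>2 / 18 + 7/36"
  define w where "w = \<bar>\<gamma>1\<bar> + \<bar>\<gamma>2\<bar>"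
  have \<eta>: "0 < \<eta>" by (simp add: \<eta>_def add_nonneg_pos)
  have w: "0 \<le> w" by (simp add: w_def)
  show "\<exists>K N. \<forall>n X. N \<le> real n \<longrightarrow> 1 \<le> n \<longrightarrow> m \<le> real X / real n \<longrightarrow> real X / real n \<le> 1 - m \<longrightarrow>
      \<bar>second_order_bound \<alpha> n X - (real X / real n + upper_normal_quantile \<alpha> * sqrt (real X / real n * (1 - real X / real n)) / sqrt (real n) +
         ((1 - 2 * (real X / real n)) * ((upper_normal_quantile \<alpha>)\<^sup>2 / 3 + 1/6) + 0) / real n)\<bar> \<le> K * real n powr (- 3/2)"
  proof (intro exI allI impI)
    fix n X :: nat
    assume n: "w / m\<^sup>2 \<le> real n" and n1: "1 \<le> n" and X: "m \<le> real X / real n" "real X / real n \<le> 1 - m"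
    define N where "N = real n"
    define x where "x = real X / N"
    define V where "V = x * (1 - x)"
    define W where "W = \<gamma>1 * V + \<gamma>2"
    have N: "1 \<le> N" using n1 by (simp add: N_def)
    have xm: "m \<le> x" "x \<le> 1 - m" using X by (auto simp: x_def N_def)
    have x: "0 < x" "x < 1" using m xm by linarith+
    have "m * m \<le> V" unfolding V_def using m xm by (intro mult_mono) auto
    then have V: "m\<^sup>2 \<le> V" "0 < V" using mult_pos_pos[OF m m] unfolding power2_eq_square by linarith+
    have "V \<le> 1 * 1" unfolding V_def using x by (intro mult_mono) auto
    then have "\<bar>\<gamma>1 * V\<bar> \<le> \<bar>\<gamma>1\<bar>" using V by (simp add: abs_mult mult_left_le)
    then have W: "\<bar>W\<bar> \<le> w" unfolding W_def w_def by linarith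
    \<comment> \<open>As V \<ge> m^2 in the central range, n \<ge> w / m^2 makes the radicand
      nonnegative there.\<close>
    have "w \<le> N * m\<^sup>2" using n m by (simp add: N_def field_simps)
    also have "\<dots> \<le> N * V" using V N by (intro mult_left_mono) auto
    finally have "- W \<le> N * V" using W by linarith
    then have nn: "0 \<le> V + W / N" using N by (simp add: field_simps)
    define S where "S = sqrt (V + W / N)"
    define \<sigma> where "\<sigma> = sqrt V"
    have \<sigma>: "m \<le> \<sigma>" unfolding \<sigma>_def using V(1) by (rule real_le_rsqrt)
    \<comment> \<open>The difference of the two roots is recovered by dividing by S + \<sigma>,
      which is at least m.\<close>
    have "(S - \<sigma>) * (S + \<sigma>) = W / N"
      using nn V by (simp add: S_def \<sigma>_def algebra_simps)
    moreover have "\<bar>S - \<sigma>\<bar> * (S + \<sigma>) = \<bar>(S - \<sigma>) * (S + \<sigma>)\<bar>"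
      using \<sigma> m nn by (simp add: abs_mult S_def)
    moreover have "\<bar>W / N\<bar> = \<bar>W\<bar> / N" using N by simp
    ultimately have "\<bar>S - \<sigma>\<bar> * (S + \<sigma>) = \<bar>W\<bar> / N" by (simp only:)
    moreover have "\<bar>S - \<sigma>\<bar> * m \<le> \<bar>S - \<sigma>\<bar> * (S + \<sigma>)"
    proof (rule mult_left_mono)
      have "0 \<le> S" using nn by (simp add: S_def)
      then show "m \<le> S + \<sigma>" using \<sigma> by linarith
    qed simp
    moreover have "\<bar>W\<bar> / N \<le> w / N" using W N by (intro divide_right_mono) auto
    ultimately have "\<bar>S - \<sigma>\<bar> * m \<le> w / N" by linarith
    then have S: "\<bar>S - \<sigma>\<bar> \<le> w / m / N" using m N by (simp add: field_simps)
    have "(real X + \<eta>) / (N + 2 * \<eta>) - (x + (1 - 2 * x) * \<eta> / N) = - (2 * \<eta>\<^sup>2 * (1 - 2 * x)) / (N * (N + 2 * \<eta>))"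
    proof -
      have "real X = x * N" using N by (simp add: x_def)
      then show ?thesis using N \<eta> by (simp add: field_simps power2_eq_square)
    qed
    then have "\<bar>(real X + \<eta>) / (N + 2 * \<eta>) - (x + (1 - 2 * x) * \<eta> / N)\<bar> = 2 * \<eta>\<^sup>2 * \<bar>1 - 2 * x\<bar> / (N * (N + 2 * \<eta>))"
      using N \<eta> by (simp add: abs_mult)
    also have "\<dots> \<le> 2 * \<eta>\<^sup>2 * 1 / (N * N)"
      using x N \<eta> by (intro frac_le mult_left_mono) auto
    also have "\<dots> = 2 * \<eta>\<^sup>2 * N powr (- 2)"
      using N by (simp add: powr_minus_divide power2_eq_square powr_numeral)
    also have "\<dots> \<le> 2 * \<eta>\<^sup>2 * N powr (- 3/2)" using N by (intro mult_left_mono powr_mono) auto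
    finally have A: "\<bar>(real X + \<eta>) / (N + 2 * \<eta>) - (x + (1 - 2 * x) * \<eta> / N)\<bar> \<le> 2 * \<eta>\<^sup>2 * N powr (- 3/2)" .
    have "\<bar>z * N powr (- 1/2) * S - z * N powr (- 1/2) * \<sigma>\<bar> = \<bar>z\<bar> * N powr (- 1/2) * \<bar>S - \<sigma>\<bar>"
      by (simp add: abs_mult flip: right_diff_distrib)
    also have "\<dots> \<le> \<bar>z\<bar> * N powr (- 1/2) * (w / m / N)" using S by (intro mult_left_mono) auto
    also have "\<dots> = \<bar>z\<bar> * w / m * (N powr (- 1/2) * N powr (- 1))" using N by (simp add: powr_minus_divide)
    also have "N powr (- 1/2) * N powr (- 1) = N powr (- 3/2)" by (simp only: powr_add[symmetric]) simp
    finally have B: "\<bar>z * N powr (- 1/2) * S - z * N powr (- 1/2) * \<sigma>\<bar> \<le> \<bar>z\<bar> * w / m * N powr (- 3/2)" .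
    have e: "z * N powr (- 1/2) * \<sigma> = z * \<sigma> / sqrt N" using N by (simp add: powr_minus_divide powr_half_sqrt)
    have "second_order_bound \<alpha> n X = (real X + \<eta>) / (N + 2 * \<eta>) + z * N powr (- 1/2) * S"
      by (simp add: second_order_bound_def Let_def S_def W_def V_def x_def N_def \<gamma>1_def \<gamma>2_def \<eta>_def z_def)
    then have "\<bar>second_order_bound \<alpha> n X - (x + z * \<sigma> / sqrt N + (1 - 2 * x) * \<eta> / N)\<bar> \<le>
        2 * \<eta>\<^sup>2 * N powr (- 3/2) + \<bar>z\<bar> * w / m * N powr (- 3/2)"
      using A B unfolding e by linarith
    then show "\<bar>second_order_bound \<alpha> n X - (real X / real n + upper_normal_quantile \<alpha> * sqrt (real X / real n * (1 - real X / real n)) / sqrt (real n) +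
         ((1 - 2 * (real X / real n)) * ((upper_normal_quantile \<alpha>)\<^sup>2 / 3 + 1/6) + 0) / real n)\<bar> \<le>
         (2 * \<eta>\<^sup>2 + \<bar>z\<bar> * w / m) * real n powr (- 3/2)"
      by (simp add: \<sigma>_def V_def x_def N_def \<eta>_def z_def distrib_right)
  qed
qed

section \<open>Expected excess\<close>

text \<open>The main terms \<open>T\<close> differ by exactly (\<tau>1 - \<tau>2) / n, so on the
  central event the integrand \<open>?D\<close> itself is O(n^(-3/2)) and no cancellation between
  different X is involved.\<close>

lemma expected_excess_difference:
  fixes p \<alpha> :: real
  assumes p: "0 < p" "p < 1"
    and exp: "second_order_expansion \<alpha> \<tau>1 B1" "second_order_expansion \<alpha> \<tau>2 B2"
    and bounded: "\<And>n X. 1 \<le> n \<Longrightarrow> X \<le> n \<Longrightarrow> \<bar>B1 n X\<bar> \<le> C1" "\<And>n X. 1 \<le> n \<Longrightarrow> X \<le> n \<Longrightarrow> \<bar>B2 n X\<bar> \<le> C2"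
  shows "(\<lambda>n. expected_excess n p B1 - (expected_excess n p B2 + (\<tau>1 - \<tau>2) / real n)) \<in> O(\<lambda>n. real n powr (- 3/2))"
proof -
  \<comment> \<open>With this half-width, |x - p| < m forces m \<le> x \<le> 1 - m.\<close>
  define m where "m = min p (1 - p) / 2"
  have m: "0 < m" using p by (simp add: m_def)
  define T where "T = (\<lambda>\<tau> n X. let x = real X / real n; z = upper_normal_quantile \<alpha>
         in x + z * sqrt (x * (1 - x)) / sqrt (real n) + ((1 - 2 * x) * (z\<^sup>2 / 3 + 1/6) + \<tau>) / real n)"
  obtain K1 N1 where 1: "\<And>n X. N1 \<le> real n \<Longrightarrow> 1 \<le> n \<Longrightarrow> m \<le> real X / real n \<Longrightarrow> real X / real n \<le> 1 - m \<Longrightarrow>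
      \<bar>B1 n X - T \<tau>1 n X\<bar> \<le> K1 * real n powr (- 3/2)"
    using exp(1)[unfolded second_order_expansion_def Let_def, rule_format, OF m] unfolding T_def Let_def by blast
  obtain K2 N2 where 2: "\<And>n X. N2 \<le> real n \<Longrightarrow> 1 \<le> n \<Longrightarrow> m \<le> real X / real n \<Longrightarrow> real X / real n \<le> 1 - m \<Longrightarrow>
      \<bar>B2 n X - T \<tau>2 n X\<bar> \<le> K2 * real n powr (- 3/2)"
    using exp(2)[unfolded second_order_expansion_def Let_def, rule_format, OF m] unfolding T_def Let_def by blast
  define K where "K = \<bar>K1\<bar> + \<bar>K2\<bar>"
  define C where "C = \<bar>C1\<bar> + \<bar>C2\<bar> + \<bar>\<tau>1 - \<tau>2\<bar>"
  have bound: "\<bar>expected_excess n p B1 - (expected_excess n p B2 + (\<tau>1 - \<tau>2) / real n)\<bar>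
      \<le> K * real n powr (- 3/2) + C * (2 * exp (- 2 * real n * m\<^sup>2))"
    if n: "N1 \<le> real n" "N2 \<le> real n" "1 \<le> n" for n
  proof -
    let ?M = "measure_pmf (binomial_pmf n p)"
    let ?D = "\<lambda>X. B1 n X - B2 n X - (\<tau>1 - \<tau>2) / real n"
    let ?A = "{X. m \<le> \<bar>real X / real n - p\<bar>}"
    have fin: "finite (set_pmf (binomial_pmf n p))"
      using p by (simp add: set_pmf_binomial_eq)
    have int: "integrable ?M f" for f :: "nat \<Rightarrow> real"
      by (rule integrable_measure_pmf_finite[OF fin])
    have "expected_excess n p B1 - (expected_excess n p B2 + (\<tau>1 - \<tau>2) / real n) = integral\<^sup>L ?M ?D"
    proof -
      have "integral\<^sup>L ?M ?D = integral\<^sup>L ?M (\<lambda>X. (B1 n X - p) - (B2 n X - p) - (\<tau>1 - \<tau>2) / real n)"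
        by (rule Bochner_Integration.integral_cong) auto
      also have "\<dots> = integral\<^sup>L ?M (\<lambda>X. B1 n X - p) - integral\<^sup>L ?M (\<lambda>X. B2 n X - p) - (\<tau>1 - \<tau>2) / real n"
        by (simp add: int measure_pmf.prob_space)
      finally show ?thesis by (simp add: expected_excess_def)
    qed
    also have "\<bar>integral\<^sup>L ?M ?D\<bar> \<le> integral\<^sup>L ?M (\<lambda>X. \<bar>?D X\<bar>)" by (rule integral_abs_bound)
    also have "\<dots> \<le> integral\<^sup>L ?M (\<lambda>X. K * real n powr (- 3/2) + C * indicator ?A X)"
    proof (rule integral_mono_AE[OF int int], rule AE_pmfI)
      fix X assume "X \<in> set_pmf (binomial_pmf n p)"
      then have X: "X \<le> n" using p by (simp add: set_pmf_binomial_eq)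
      show "\<bar>?D X\<bar> \<le> K * real n powr (- 3/2) + C * indicator ?A X"
      proof (cases "X \<in> ?A")
        case True
        have "\<bar>(\<tau>1 - \<tau>2) / real n\<bar> \<le> \<bar>\<tau>1 - \<tau>2\<bar> / 1"
          unfolding abs_divide using n(3) by (intro frac_le) auto
        moreover have "\<bar>a - b - e\<bar> \<le> \<bar>C1\<bar> + \<bar>C2\<bar> + E" if "\<bar>a\<bar> \<le> C1" "\<bar>b\<bar> \<le> C2" "\<bar>e\<bar> \<le> E / 1" for a b e E :: real
          using that by linarith
        ultimately have "\<bar>?D X\<bar> \<le> C" using bounded[OF n(3) X] unfolding C_def by blast
        moreover have "0 \<le> K * real n powr (- 3/2)" by (simp add: K_def)
        ultimately show ?thesis using True by simp
      next
        case False
        have "2 * m \<le> p" "2 * m \<le> 1 - p" by (simp_all add: m_def)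
        moreover have "\<bar>real X / real n - p\<bar> < m" using False by simp
        ultimately have x: "m \<le> real X / real n" "real X / real n \<le> 1 - m" by linarith+
        have "T \<tau>1 n X - T \<tau>2 n X = (\<tau>1 - \<tau>2) / real n"
          by (simp add: T_def Let_def add_divide_distrib diff_divide_distrib)
        then have "\<bar>?D X\<bar> \<le> K1 * real n powr (- 3/2) + K2 * real n powr (- 3/2)"
          using 1[OF n(1,3) x] 2[OF n(2,3) x] by linarith
        also have "\<dots> = (K1 + K2) * real n powr (- 3/2)" by (simp only: distrib_right)
        also have "\<dots> \<le> K * real n powr (- 3/2)" by (intro mult_right_mono) (auto simp: K_def)
        finally show ?thesis using False by simp
      qed
    qed
    also have "\<dots> = K * real n powr (- 3/2) + C * measure_pmf.prob (binomial_pmf n p) ?A"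
      by (simp add: int measure_pmf.prob_space)
    also have "measure_pmf.prob (binomial_pmf n p) ?A \<le> 2 * exp (- 2 * real n * m\<^sup>2)"
    proof -
      \<comment> \<open>The fact \<open>prob_abs_ge'\<close> is Hoeffding's inequality for the
        relative frequency X / n.\<close>
      interpret binomial_distribution n p by unfold_locales (use p in auto)
      show ?thesis using prob_abs_ge'[of m] n(3) m by simp
    qed
    finally show ?thesis by (simp add: C_def mult_left_mono)
  qed
  have "(\<lambda>n. expected_excess n p B1 - (expected_excess n p B2 + (\<tau>1 - \<tau>2) / real n))
      \<in> O(\<lambda>n. K * real n powr (- 3/2) + C * (2 * exp (- 2 * real n * m\<^sup>2)))"
  proof (rule bigoI[of _ 1])
    have "\<forall>\<^sub>F n in sequentially. N1 \<le> real n \<and> N2 \<le> real n \<and> 1 \<le> n"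
      by (intro eventually_conj eventually_ge_at_top eventually_compose_filterlim[OF eventually_ge_at_top filterlim_real_sequentially])
    then show "\<forall>\<^sub>F n in sequentially. norm (expected_excess n p B1 - (expected_excess n p B2 + (\<tau>1 - \<tau>2) / real n))
        \<le> 1 * norm (K * real n powr (- 3/2) + C * (2 * exp (- 2 * real n * m\<^sup>2)))"
    proof eventually_elim
      case (elim n)
      then show ?case using bound[of n] by simp
    qed
  qed
  also have "(\<lambda>n. K * real n powr (- 3/2) + C * (2 * exp (- 2 * real n * m\<^sup>2))) \<in> O(\<lambda>n. real n powr (- 3/2))"
  proof (rule sum_in_bigo)
    show "(\<lambda>n. K * real n powr (- 3/2)) \<in> O(\<lambda>n. real n powr (- 3/2))" by simp
    have "(\<lambda>n. exp (- 2 * real n * m\<^sup>2)) \<in> O(\<lambda>n. real n powr (- 3/2))" using m by real_asymp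
    then show "(\<lambda>n. C * (2 * exp (- 2 * real n * m\<^sup>2))) \<in> O(\<lambda>n. real n powr (- 3/2))" by simp
  qed
  finally show ?thesis .
qed

text \<open>The small n with a negative radicand are included: \<open>sqrt\<close> is odd on the
  reals, so |sqrt a| = sqrt |a| \<le> 1 + |a| for every a.\<close>

lemma second_order_bound_bounded:
  obtains C where "\<And>n X. 1 \<le> n \<Longrightarrow> X \<le> n \<Longrightarrow> \<bar>second_order_bound \<alpha> n X\<bar> \<le> C"
proof -
  define z where "z = upper_normal_quantile \<alpha>"
  define \<eta> where "\<eta> = z\<^sup>2 / 3 + 1/6"
  define \<gamma>1 where "\<gamma>1 = - (13/18 * z\<^sup>2 + 17/18)"
  define \<gamma>2 where "\<gamma>2 = z\<^sup>2 / 18 + 7/36"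
  define w where "w = \<bar>\<gamma>1\<bar> + \<bar>\<gamma>2\<bar>"
  have \<eta>: "0 < \<eta>" by (simp add: \<eta>_def add_nonneg_pos)
  have "\<bar>second_order_bound \<alpha> n X\<bar> \<le> 1 + \<bar>z\<bar> * (2 + w)" if n: "1 \<le> n" and X: "X \<le> n" for n X
  proof -
    define x where "x = real X / real n"
    define V where "V = x * (1 - x)"
    define W where "W = \<gamma>1 * V + \<gamma>2"
    have x: "0 \<le> x" "x \<le> 1" using n X by (auto simp: x_def)
    have "V \<le> 1 * 1" unfolding V_def using x by (intro mult_mono) auto
    moreover have "0 \<le> V" using x by (simp add: V_def)
    ultimately have V: "0 \<le> V" "V \<le> 1" by auto
    have "\<bar>\<gamma>1 * V\<bar> \<le> \<bar>\<gamma>1\<bar>" using V by (simp add: abs_mult mult_left_le)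
    then have "\<bar>W\<bar> \<le> w" unfolding W_def w_def by linarith
    then have "\<bar>W\<bar> / real n \<le> w / 1" using n by (intro frac_le) auto
    then have "\<bar>V + W / real n\<bar> \<le> 1 + w" using V abs_triangle_ineq[of V "W / real n"] by (simp add: abs_divide)
    moreover have "\<bar>sqrt a\<bar> \<le> 1 + \<bar>a\<bar>" for a
    proof -
      have "sqrt \<bar>a\<bar> \<le> 1 + \<bar>a\<bar>"
        by (rule real_le_lsqrt) (simp_all add: power2_sum)
      then show ?thesis by (simp add: sqrt_def real_root_abs)
    qed
    ultimately have S: "\<bar>sqrt (V + W / real n)\<bar> \<le> 2 + w" by (smt (verit))
    have "real n powr (- 1/2) \<le> 1" using n by (simp add: powr_minus_divide powr_half_sqrt)
    then have "\<bar>z\<bar> * real n powr (- 1/2) * \<bar>sqrt (V + W / real n)\<bar> \<le> \<bar>z\<bar> * 1 * (2 + w)"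
      using S by (intro mult_mono) auto
    then have 2: "\<bar>z * real n powr (- 1/2) * sqrt (V + W / real n)\<bar> \<le> \<bar>z\<bar> * (2 + w)" by (simp add: abs_mult)
    have 1: "\<bar>(real X + \<eta>) / (real n + 2 * \<eta>)\<bar> \<le> 1" using \<eta> X by (simp add: abs_divide)
    have "second_order_bound \<alpha> n X = (real X + \<eta>) / (real n + 2 * \<eta>) + z * real n powr (- 1/2) * sqrt (V + W / real n)"
      by (simp add: second_order_bound_def Let_def W_def V_def x_def \<gamma>1_def \<gamma>2_def \<eta>_def z_def)
    then show ?thesis using 1 2 by linarith
  qed
  then show ?thesis by (rule that)
qed

theorem corollary2:
  fixes p \<alpha> :: real and U :: "nat \<Rightarrow> nat \<Rightarrow> real"
  assumes p: "0 < p" "p < 1"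
    and \<alpha>: "0 < \<alpha>" "\<alpha> < 1"
    and U: "U = jeffreys_bound \<alpha> \<or> U = second_order_bound \<alpha> \<or> is_modified_loglik_root_bound \<alpha> U"
  shows "(\<lambda>n. expected_excess n p (clopper_pearson_bound \<alpha>)
              - (expected_excess n p U + 1 / (2 * real n)))
           \<in> O(\<lambda>n. real n powr (- 3/2))"
proof -
  have "second_order_expansion \<alpha> 0 U"
    using U jeffreys_expansion[OF \<alpha>] second_order_bound_expansion modified_loglik_root_expansion by blast
  \<comment> \<open>This is for X outside the central range. For the loglikelihood root, the
    arbitrary values at X = 0 and X = n enter only through lying in the unit interval.\<close>
  moreover have "\<exists>C. \<forall>n X. 1 \<le> n \<longrightarrow> X \<le> n \<longrightarrow> \<bar>U n X\<bar> \<le> C"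
    using U
  proof (elim disjE)
    assume "U = jeffreys_bound \<alpha>"
    then have "\<bar>U n X\<bar> \<le> 1" if "X \<le> n" for n X using jeffreys_bound_range[OF that \<alpha>] by auto
    then show ?thesis by blast
  next
    assume "U = second_order_bound \<alpha>"
    then show ?thesis using second_order_bound_bounded[of \<alpha>] by metis
  next
    assume *: "is_modified_loglik_root_bound \<alpha> U"
    have "\<bar>U n X\<bar> \<le> 1" if "X \<le> n" for n X
    proof (cases "0 < X \<and> X < n")
      case True
      then have "U n X \<in> {0<..<1}" using * by (simp add: is_modified_loglik_root_bound_def)
      then show ?thesis by simp
    next
      case False
      then have "X \<in> {0, n}" using that by auto
      then have "U n X \<in> {0..1}" using * unfolding is_modified_loglik_root_bound_def by blast
      then show ?thesis by simp
    qed
    then show ?thesis by blast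
  qed
  then obtain C where "\<And>n X. 1 \<le> n \<Longrightarrow> X \<le> n \<Longrightarrow> \<bar>U n X\<bar> \<le> C" by blast
  moreover have "\<bar>clopper_pearson_bound \<alpha> n X\<bar> \<le> 1" if "X \<le> n" for n X
    using clopper_pearson_bound_range[OF that \<alpha>] by auto
  \<comment> \<open>The difference \<tau>1 - \<tau>2 = 1/2 - 0 produces the term 1 / (2 n).\<close>
  ultimately show ?thesis
    using expected_excess_difference[OF p clopper_pearson_expansion[OF \<alpha>], of 0 U 1 C] by simp
qed

end
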